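(* Let $d$ be a positive integer. There exist a compact metric space $(\mathcal{X}, \mathbf{d})$ and a continuous action $T\colon \mathbb{R}^d \times \mathcal{X} \to \mathcal{X}$ satisfying the following two conditions. (i) For any ergodic measure $\nu \in \mathscr{M}^T_{\mathrm{erg}}(\mathcal{X})$ we have $\mathrm{rdim}(\mathcal{X}, T, \mathbf{d}, \nu) = 0$. (ii) There exists $\mu\in \mathscr{M}^T(\mathcal{X})$ with $\mathrm{rdim}(\mathcal{X}, T, \mathbf{d}, \mu) = \infty$.
   Context: Conventions: $\log=\log_2$, and $\mathbf{m}$ is Lebesgue measure on $\mathbb{R}^d$. $\mathscr{M}^T(\mathcal{X})$ is the set of $T$-invariant Borel probability measures on $\mathcal{X}$; $\mathscr{M}^T_{\mathrm{erg}}(\mathcal{X})$ is the subset of ergodic ones, i.e. those $\mu$ for which there is no Borel set $A$ with $T^{-u}A=A$ for all $u\in\mathbb{R}^d$ and $0<\mu(A)<1$. Mutual information: for random variables $X,Y$ with values in finite sets, $I(X;Y)=H(X)+H(Y)-H(X,Y)$ where $H$ is Shannon entropy (base 2). For $X,Y$ with values in measurable spaces, $I(X;Y)$ is the supremum of $I(\alpha\circ X;\beta\circ Y)$ over all finite measurable partitions $\alpha,\beta$ of the two target spaces, where $\alpha\circ X$ is the index of the element of $\alpha$ containing $X$ (similarly $\beta\circ Y$). Rate distortion function: for $L>0$, $L^1([0,L)^d,\mathcal{X})$ is the space of measurable maps $[0,L)^d\to\mathcal{X}$ modulo $\mathbf{m}$-a.e. equality, with metric $D(f,g)=\int_{[0,L)^d}\mathbf{d}(f(u),g(u))\,d\mathbf{m}(u)$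 and its Borel $\sigma$-algebra. For $\mu\in\mathscr{M}^T(\mathcal{X})$ and $\varepsilon>0$, $R_L(\mathbf{d},\mu,\varepsilon)$ is the infimum of $I(X;Y)$ over pairs of random variables $X,Y$ defined on a common probability space such that $X$ takes values in $\mathcal{X}$ with law $\mu$, and $Y=(Y_u)_{u\in[0,L)^d}$ takes values in $L^1([0,L)^d,\mathcal{X})$ with $\mathbb{E}\big(\frac{1}{L^d}\int_{[0,L)^d}\mathbf{d}(T^uX,Y_u)\,d\mathbf{m}(u)\big)<\varepsilon$. Set $R(\mathbf{d},\mu,\varepsilon)=\lim_{L\to\infty}R_L(\mathbf{d},\mu,\varepsilon)/L^d$; this limit exists, is finite, and equals $\inf_{L>0}R_L(\mathbf{d},\mu,\varepsilon)/L^d$. Rate distortion dimension: $\mathrm{rdim}(\mathcal{X},T,\mathbf{d},\mu)=\lim_{\varepsilon\to0}\frac{R(\mathbf{d},\mu,\varepsilon)}{\log(1/\varepsilon)}\in[0,\infty]$ when this limit exists (i.e. when the upper and lower limits coincide). *)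

theory Defs
  imports "HOL-Probability.Probability"
begin

definition metric_borel :: "'a metric \<Rightarrow> 'a measure" where
  "metric_borel X = sigma (mspace X) {U. openin (mtopology_of X) U}"

definition continuous_action :: "'a metric \<Rightarrow> (real ^ 'n \<Rightarrow> 'a \<Rightarrow> 'a) \<Rightarrow> bool" where
  "continuous_action X T \<longleftrightarrow>
     continuous_map (prod_topology euclidean (mtopology_of X)) (mtopology_of X) (\<lambda>(u, x). T u x) \<and>
     (\<forall>x\<in>mspace X. T 0 x = x) \<and>
     (\<forall>u v. \<forall>x\<in>mspace X. T (u + v) x = T u (T v x))"

definition invariant_measures :: "'a metric \<Rightarrow> (real ^ 'n \<Rightarrow> 'a \<Rightarrow> 'a) \<Rightarrow> 'a measure set" where
  "invariant_measures X T =
     {\<mu>. prob_space \<mu> \<and> sets \<mu> = sets (metric_borel X) \<and>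
          (\<forall>u. distr \<mu> (metric_borel X) (T u) = \<mu>)}"

definition ergodic_measures :: "'a metric \<Rightarrow> (real ^ 'n \<Rightarrow> 'a \<Rightarrow> 'a) \<Rightarrow> 'a measure set" where
  "ergodic_measures X T =
     {\<mu> \<in> invariant_measures X T.
        \<not> (\<exists>A \<in> sets (metric_borel X).
              (\<forall>u. T (- u) ` A = A) \<and> 0 < measure \<mu> A \<and> measure \<mu> A < 1)}"


text \<open>Entropy and mutual information are in bits. The library's \<open>mutual_information\<close> is
  real-valued and so does not record infinite mutual information; here it is extended-real-valued
  and given by the supremum over finite measurable partitions.\<close>

definition shannon_entropy :: "'w measure \<Rightarrow> ('w \<Rightarrow> 'a) \<Rightarrow> real" where
  "shannon_entropy M X = prob_space.entropy M 2 (count_space (X ` space M)) X"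

definition finite_mutual_info :: "'w measure \<Rightarrow> ('w \<Rightarrow> 'a) \<Rightarrow> ('w \<Rightarrow> 'b) \<Rightarrow> real" where
  "finite_mutual_info M X Y =
     shannon_entropy M X + shannon_entropy M Y - shannon_entropy M (\<lambda>w. (X w, Y w))"

definition finite_measurable_partition :: "'a measure \<Rightarrow> 'a set set \<Rightarrow> bool" where
  "finite_measurable_partition S P \<longleftrightarrow> finite P \<and> P \<subseteq> sets S \<and> partition_on (space S) P"

text \<open>The cells themselves serve as the indices of a partition.\<close>

definition cell :: "'a set set \<Rightarrow> 'a \<Rightarrow> 'a set" where
  "cell P x = (THE A. A \<in> P \<and> x \<in> A)"

definition mutual_info ::
  "'w measure \<Rightarrow> 'a measure \<Rightarrow> 'b measure \<Rightarrow> ('w \<Rightarrow> 'a) \<Rightarrow> ('w \<Rightarrow> 'b) \<Rightarrow> ereal" where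
  "mutual_info M S T X Y =
     (SUP (P, Q) \<in> {(P, Q). finite_measurable_partition S P \<and> finite_measurable_partition T Q}.
        ereal (finite_mutual_info M (cell P \<circ> X) (cell Q \<circ> Y)))"


definition cube :: "real \<Rightarrow> (real ^ 'n) set" where
  "cube L = {u. \<forall>i. 0 \<le> u $ i \<and> u $ i < L}"

definition cube_measure :: "real \<Rightarrow> (real ^ 'n) measure" where
  "cube_measure L = restrict_space lborel (cube L)"

text \<open>The points of \<open>L1_space L X\<close> are classes of Borel maps \<open>[0,L)\<^sup>d \<rightarrow> X\<close> modulo equality
  almost everywhere (for compact \<open>X\<close>, Lebesgue measurable maps give the same space, since each
  agrees almost everywhere with a Borel one). Representatives are total functions; their values
  outside the cube are irrelevant, both for membership in a class and for the integrals below.\<close>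

definition L1_maps :: "real \<Rightarrow> 'a metric \<Rightarrow> (real ^ 'n \<Rightarrow> 'a) set" where
  "L1_maps L X = measurable (cube_measure L) (metric_borel X)"

definition ae_rel :: "real \<Rightarrow> 'a metric \<Rightarrow> ((real ^ 'n \<Rightarrow> 'a) \<times> (real ^ 'n \<Rightarrow> 'a)) set" where
  "ae_rel L X =
     {(f, g). f \<in> L1_maps L X \<and> g \<in> L1_maps L X \<and> (AE u in cube_measure L. f u = g u)}"

definition rep :: "'b set \<Rightarrow> 'b" where
  "rep F = (SOME f. f \<in> F)"

definition L1_dist :: "real \<Rightarrow> 'a metric \<Rightarrow> (real ^ 'n \<Rightarrow> 'a) set \<Rightarrow> (real ^ 'n \<Rightarrow> 'a) set \<Rightarrow> real" where
  "L1_dist L X F G = (LINT u|cube_measure L. mdist X (rep F u) (rep G u))"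

definition L1_space :: "real \<Rightarrow> 'a metric \<Rightarrow> (real ^ 'n \<Rightarrow> 'a) set metric" where
  "L1_space L X = metric (L1_maps L X // ae_rel L X, L1_dist L X)"


text \<open>The infimum ranges over random variables on probability spaces whose underlying type is
  \<open>'a \<times> (real ^ 'n \<Rightarrow> 'a) set\<close>. This loses nothing: mutual information and expected distortion
  depend only on the joint law of the pair, and the joint law itself lives on this type.\<close>

definition rate_distortion_L ::
  "'a metric \<Rightarrow> (real ^ 'n \<Rightarrow> 'a \<Rightarrow> 'a) \<Rightarrow> 'a measure \<Rightarrow> real \<Rightarrow> real \<Rightarrow> ereal" where
  "rate_distortion_L X T \<mu> L \<epsilon> =
     Inf {mutual_info M (metric_borel X) (metric_borel (L1_space L X)) \<xi> Y |
            (M :: ('a \<times> (real ^ 'n \<Rightarrow> 'a) set) measure) \<xi> Y.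
            prob_space M \<and>
            \<xi> \<in> measurable M (metric_borel X) \<and> distr M (metric_borel X) \<xi> = \<mu> \<and>
            Y \<in> measurable M (metric_borel (L1_space L X)) \<and>
            prob_space.expectation M
              (\<lambda>w. 1 / L ^ CARD('n) * (LINT u|cube_measure L. mdist X (T u (\<xi> w)) (rep (Y w) u)))
              < \<epsilon>}"

definition rate_distortion ::
  "'a metric \<Rightarrow> (real ^ 'n \<Rightarrow> 'a \<Rightarrow> 'a) \<Rightarrow> 'a measure \<Rightarrow> real \<Rightarrow> ereal" where
  "rate_distortion X T \<mu> \<epsilon> =
     Lim at_top (\<lambda>L. rate_distortion_L X T \<mu> L \<epsilon> / ereal (L ^ CARD('n)))"

text \<open>The rate distortion dimension is defined only when the limit exists, so it is
  rendered as a relation: the limit exists and equals \<open>c\<close>.\<close>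

definition has_rdim ::
  "'a metric \<Rightarrow> (real ^ 'n \<Rightarrow> 'a \<Rightarrow> 'a) \<Rightarrow> 'a measure \<Rightarrow> ereal \<Rightarrow> bool" where
  "has_rdim X T \<mu> c \<longleftrightarrow>
     ((\<lambda>\<epsilon>. rate_distortion X T \<mu> \<epsilon> / ereal (log 2 (1 / \<epsilon>))) \<longlongrightarrow> c) (at_right 0)"

end

(*
The rate of an invariant measure is, in the limit, an infimum over finite codes: a Markov kernel
from the source to finitely many code words, charged with the information it carries relative to
reference weights. Coding disjoint blocks independently given the source shows that the rate per
volume converges to its infimum, and the Donsker--Varadhan inequality bounds the information of a
code from below.

The space consists of the zero function and of the translates of functions v |-> 2^-k f(4^k v),
where f is a field of bumps on the unit cells of R^d switched on and off by bits; R^d acts by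
translation. The k-th layer has diameter of order 2^-k and finite entropy of order 4^(kd). An ergodic
measure lives on a single layer, so its rate is bounded and its dimension is 0. Give layer k,
with independent fair bits, the weight 2^-(k+1). At resolution 4^-k this weighted layer alone
forces a rate of order 2^-k 4^(kd) >= 2^k, which beats log(1/epsilon) of order k.
*)
theory Submission
  imports Defs
begin

section \<open>Finite mutual information\<close>

text \<open>Three scales are in competition. Amplitude 2^-k makes the layers accumulate only at the
  zero function, so that infinitely many of them still form a compact space. Amplitude times weight
  sets the resolution 4^-k at which layer k is felt. The frequency 4^k supplies enough bits to
  outgrow the weight in every dimension d >= 1. Independent bits on the integer lattice are
  invariant under integer shifts only; a uniform phase in the unit cube makes each layer invariant
  under all translations. The obstacle in the definition is a supremum over partitions inside an
  infimum over random maps, with values in a space that is not compact. Codes with free reference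
  weights remove it: weights multiply along blocks, so rates add exactly, and the inequality
  \<open>ln s \<le> s - 1\<close> bounds mutual information by the rate as well as the rate from
  below. Since the rate is a \<open>Lim\<close>, convergence has to be proved before any value can
  be read off. The factor \<open>exp (- norm v)\<close> in the metric makes every translation
  Lipschitz. Distortions then are Lipschitz functions, and all measurability rests on that.\<close>

lemma abs_mult_log_le:
  fixes z r :: real
  assumes "0 \<le> z" "z \<le> 1" "0 < r"
  shows "\<bar>z * log 2 (z / r)\<bar> \<le> (1 + \<bar>ln r\<bar>) / ln 2"
proof (cases "z = 0")
  case False
  then have z: "z > 0" using assms by simp
  have "ln z \<le> 0" using z assms by simp
  \<comment> \<open>Near 0 the factor \<open>z\<close> beats the logarithm: this is
    \<open>ln s \<le> s - 1\<close> at \<open>s = 1 / z\<close>. It keeps the integrand of a code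
    rate bounded, hence integrable.\<close>
  moreover have "z * ln z \<ge> z - 1"
  proof -
    have "ln (1/z) \<le> 1/z - 1" using z by (intro ln_le_minus_one) auto
    then have "z * (- ln z) \<le> z * (1/z - 1)" using z by (intro mult_left_mono) (auto simp: ln_div)
    then show ?thesis using z by (simp add: algebra_simps)
  qed
  ultimately have "\<bar>z * ln z\<bar> \<le> 1" using z assms by (auto simp: abs_le_iff mult_nonneg_nonpos intro: order_trans)
  moreover have "\<bar>z * ln r\<bar> \<le> \<bar>ln r\<bar>" using z assms by (simp add: abs_mult mult_left_le_one_le)
  moreover have "z * log 2 (z / r) = (z * ln z - z * ln r) / ln 2"
    using z assms by (simp add: log_def ln_div algebra_simps diff_divide_distrib)
  ultimately show ?thesis by (auto simp: abs_divide intro!: divide_right_mono)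
next
  case True
  have "0 \<le> (1 + \<bar>ln r\<bar>) / ln 2" by simp
  with True show ?thesis by (simp only: True mult_zero_left abs_zero)
qed

text \<open>\<open>V\<close> may exceed the range of \<open>h\<close>, so that later sums run over a
  whole partition without sorting out unattained cells.\<close>

lemma (in finite_measure) integral_comp_simple_function:
  fixes f :: "'b \<Rightarrow> real"
  assumes h: "simple_function M h" and V: "finite V" "h ` space M \<subseteq> V"
  shows "(\<integral>x. f (h x) \<partial>M) = (\<Sum>v\<in>V. measure M {x \<in> space M. h x = v} * f v)" (is ?eq)
    and "integrable M (\<lambda>x. f (h x))" (is ?int)
proof -
  have [measurable]: "h \<in> measurable M (count_space UNIV)"
    using h by (auto intro: measurable_simple_function)
  have i: "integrable M (\<lambda>x. indicator {x \<in> space M. h x = v} x * f v)" for v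
  proof -
    have [measurable]: "{x \<in> space M. h x = v} \<in> sets M" by measurable
    show ?thesis
      by (rule integrable_const_bound[where B="\<bar>f v\<bar>"]) (auto simp: indicator_def)
  qed
  have eq: "f (h x) = (\<Sum>v\<in>V. indicator {x \<in> space M. h x = v} x * f v)" if "x \<in> space M" for x
  proof -
    have "h x \<in> V" using V that by auto
    then show ?thesis
      using V(1) that by (simp add: indicator_def if_distrib[where f="\<lambda>z. z * _"] cong: if_cong)
  qed
  show ?int
    by (subst Bochner_Integration.integrable_cong[OF refl eq]) (auto intro: i)
  have "(\<integral>x. f (h x) \<partial>M) = (\<integral>x. (\<Sum>v\<in>V. indicator {x \<in> space M. h x = v} x * f v) \<partial>M)"
    using eq by (intro Bochner_Integration.integral_cong) auto
  also have "\<dots> = (\<Sum>v\<in>V. measure M {x \<in> space M. h x = v} * f v)"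
  proof (subst Bochner_Integration.integral_sum)
    show "integrable M (\<lambda>x. indicator {x \<in> space M. h x = v} x * f v)" for v by (rule i)
  qed simp
  finally show ?eq .
qed

lemma (in finite_measure) measure_eq_sum_joint:
  assumes A: "simple_function M A" and B: "simple_function M B" and SB: "finite SB" "B ` space M \<subseteq> SB"
  shows "measure M {w \<in> space M. A w = a} = (\<Sum>b\<in>SB. measure M {w \<in> space M. A w = a \<and> B w = b})"
proof -
  have [measurable]: "A \<in> measurable M (count_space UNIV)" "B \<in> measurable M (count_space UNIV)"
    using A B by (auto intro: measurable_simple_function)
  have "measure M {w \<in> space M. A w = a} = measure M (\<Union>b\<in>SB. {w \<in> space M. A w = a \<and> B w = b})"
    using SB by (intro arg_cong[where f="measure M"]) auto
  also have "\<dots> = (\<Sum>b\<in>SB. measure M {w \<in> space M. A w = a \<and> B w = b})"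
    by (rule finite_measure_finite_Union) (use SB in \<open>auto simp: disjoint_family_on_def\<close>)
  finally show ?thesis .
qed

text \<open>Merges the three entropies into one relative entropy of the joint law against the
  product of its marginals, the form that a variational inequality can bound.\<close>

lemma finite_mutual_info_eq:
  assumes "prob_space M" and A: "simple_function M A" and B: "simple_function M B"
    and SA: "finite SA" "A ` space M \<subseteq> SA" and SB: "finite SB" "B ` space M \<subseteq> SB"
  defines "P \<equiv> \<lambda>a b. measure M {w \<in> space M. A w = a \<and> B w = b}"
  shows "finite_mutual_info M A B = (\<Sum>a\<in>SA. \<Sum>b\<in>SB. P a b * log 2 (P a b /
           (measure M {w \<in> space M. A w = a} * measure M {w \<in> space M. B w = b})))"
proof -
  interpret prob_space M by fact
  interpret information_space M 2 by standard auto
  let ?PA = "\<lambda>a. measure M {w \<in> space M. A w = a}"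
  let ?PB = "\<lambda>b. measure M {w \<in> space M. B w = b}"
  have sAB: "simple_function M (\<lambda>w. (A w, B w))"
    using A B by (rule simple_function_Pair)
  have mA[measurable]: "A \<in> measurable M (count_space UNIV)" and mB[measurable]: "B \<in> measurable M (count_space UNIV)"
    using A B by (auto intro: measurable_simple_function)
  have ent: "shannon_entropy M Z = - (\<Sum>z\<in>S. measure M {w \<in> space M. Z w = z} * log 2 (measure M {w \<in> space M. Z w = z}))"
    if Z: "simple_function M Z" and S: "finite S" "Z ` space M \<subseteq> S" for Z :: "'a \<Rightarrow> 'z" and S
  proof -
    have "simple_distributed M Z (\<lambda>z. measure M (Z -` {z} \<inter> space M))"
      using Z by (rule simple_distributedI) auto
    then have "shannon_entropy M Z = - (\<Sum>z\<in>Z`space M. measure M (Z -` {z} \<inter> space M) * log 2 (measure M (Z -` {z} \<inter> space M)))"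
      unfolding shannon_entropy_def by (rule entropy_simple_distributed)
    also have "(\<Sum>z\<in>Z`space M. measure M (Z -` {z} \<inter> space M) * log 2 (measure M (Z -` {z} \<inter> space M)))
      = (\<Sum>z\<in>Z`space M. measure M {w \<in> space M. Z w = z} * log 2 (measure M {w \<in> space M. Z w = z}))"
      by (intro sum.cong refl arg_cong2[where f="(*)"] arg_cong[where f="log 2"] arg_cong[where f="measure M"]) auto
    also have "\<dots> = (\<Sum>z\<in>S. measure M {w \<in> space M. Z w = z} * log 2 (measure M {w \<in> space M. Z w = z}))"
    \<comment> \<open>Unattained values have probability 0 and contribute nothing, so the range can
      be enlarged to \<open>S\<close>.\<close>
    proof (rule sum.mono_neutral_left)
      show "\<forall>i\<in>S - Z ` space M. measure M {w \<in> space M. Z w = i} * log 2 (measure M {w \<in> space M. Z w = i}) = 0"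
      proof
        fix i assume "i \<in> S - Z ` space M"
        then have "{w \<in> space M. Z w = i} = {}" by auto
        then show "measure M {w \<in> space M. Z w = i} * log 2 (measure M {w \<in> space M. Z w = i}) = 0"
          by (simp only: measure_empty mult_zero_left)
      qed
    qed (use S in auto)
    finally show ?thesis .
  qed
  have PA: "?PA a = (\<Sum>b\<in>SB. P a b)" for a
    unfolding P_def by (rule measure_eq_sum_joint[OF A B SB])
  have PB: "?PB b = (\<Sum>a\<in>SA. P a b)" for b
    unfolding P_def by (subst measure_eq_sum_joint[OF B A SA]) (simp add: conj_commute)
  have P0: "P a b \<ge> 0" for a b by (simp add: P_def)
  have leA: "P a b \<le> ?PA a" and leB: "P a b \<le> ?PB b" for a b
    unfolding P_def by (auto intro!: finite_measure_mono)
  have summand: "P a b * log 2 (P a b / (?PA a * ?PB b)) =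
      P a b * log 2 (P a b) - P a b * log 2 (?PA a) - P a b * log 2 (?PB b)" for a b
  proof (cases "P a b = 0")
    case False
    then have p: "P a b > 0" using P0[of a b] by simp
    have "?PA a > 0" "?PB b > 0" using p leA[of a b] leB[of a b] by linarith+
    with p show ?thesis by (simp add: log_divide log_mult algebra_simps)
  qed auto
  have "finite_mutual_info M A B = - (\<Sum>a\<in>SA. ?PA a * log 2 (?PA a)) - (\<Sum>b\<in>SB. ?PB b * log 2 (?PB b))
      + (\<Sum>z\<in>SA\<times>SB. P (fst z) (snd z) * log 2 (P (fst z) (snd z)))"
    unfolding finite_mutual_info_def ent[OF A SA] ent[OF B SB]
    using ent[OF sAB, of "SA \<times> SB"] SA SB
    by (force simp: P_def prod_eq_iff intro!: sum.cong)
  also have "(\<Sum>z\<in>SA\<times>SB. P (fst z) (snd z) * log 2 (P (fst z) (snd z))) = (\<Sum>a\<in>SA. \<Sum>b\<in>SB. P a b * log 2 (P a b))"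
    by (simp add: sum.cartesian_product split_beta)
  also have "(\<Sum>a\<in>SA. ?PA a * log 2 (?PA a)) = (\<Sum>a\<in>SA. \<Sum>b\<in>SB. P a b * log 2 (?PA a))"
    by (intro sum.cong refl) (subst PA, simp add: sum_distrib_right)
  also have "(\<Sum>b\<in>SB. ?PB b * log 2 (?PB b)) = (\<Sum>a\<in>SA. \<Sum>b\<in>SB. P a b * log 2 (?PB b))"
    by (subst sum.swap, intro sum.cong refl) (subst PB, simp add: sum_distrib_right)
  finally show ?thesis
    by (simp add: summand sum_subtractf)
qed

section \<open>Finite Markov kernels and the Gibbs variational inequality\<close>

text \<open>With finitely many code words a Markov kernel is a matrix of functions with rows of sum
  1, and integrals against it are finite sums under an integral over \<open>\<mu>\<close>.\<close>

locale kernel = prob_space \<mu> for \<mu> :: "'x measure" +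
  fixes \<kappa> :: "'x \<Rightarrow> 'b \<Rightarrow> real" and Bs :: "'b set"
  assumes finite_Bs: "finite Bs"
    and kernel_nonneg: "\<And>x b. x \<in> space \<mu> \<Longrightarrow> b \<in> Bs \<Longrightarrow> 0 \<le> \<kappa> x b"
    and kernel_sum: "\<And>x. x \<in> space \<mu> \<Longrightarrow> (\<Sum>b\<in>Bs. \<kappa> x b) = 1"
    and kernel_measurable: "\<And>b. b \<in> Bs \<Longrightarrow> (\<lambda>x. \<kappa> x b) \<in> borel_measurable \<mu>"
begin

lemma kernel_le_1: "x \<in> space \<mu> \<Longrightarrow> b \<in> Bs \<Longrightarrow> \<kappa> x b \<le> 1"
  using kernel_sum[of x] kernel_nonneg[of x] member_le_sum[of b Bs "\<kappa> x"] finite_Bs by simp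

lemma integrable_kernel_mult:
  assumes b: "b \<in> Bs" and g: "g \<in> borel_measurable \<mu>" "\<And>x. x \<in> space \<mu> \<Longrightarrow> \<bar>g x\<bar> \<le> C"
  shows "integrable \<mu> (\<lambda>x. \<kappa> x b * g x)"
proof (rule integrable_const_bound[where B="\<bar>C\<bar>"])
  show "AE x in \<mu>. norm (\<kappa> x b * g x) \<le> \<bar>C\<bar>"
  proof (rule AE_I2)
    fix x assume x: "x \<in> space \<mu>"
    have "\<bar>\<kappa> x b\<bar> * \<bar>g x\<bar> \<le> 1 * \<bar>C\<bar>"
      using g(2)[OF x] kernel_nonneg[OF x b] kernel_le_1[OF x b] by (intro mult_mono) auto
    then show "norm (\<kappa> x b * g x) \<le> \<bar>C\<bar>" by (simp add: abs_mult)
  qed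
  show "(\<lambda>x. \<kappa> x b * g x) \<in> borel_measurable \<mu>"
    using kernel_measurable[OF b] g(1) by (rule borel_measurable_times)
qed

lemma integrable_kernel_log:
  assumes b: "b \<in> Bs" and r: "0 < r"
  shows "integrable \<mu> (\<lambda>x. \<kappa> x b * log 2 (\<kappa> x b / r))"
proof (rule integrable_const_bound[where B="(1 + \<bar>ln r\<bar>) / ln 2"])
  show "AE x in \<mu>. norm (\<kappa> x b * log 2 (\<kappa> x b / r)) \<le> (1 + \<bar>ln r\<bar>) / ln 2"
    using abs_mult_log_le kernel_nonneg kernel_le_1 b r by (intro AE_I2) simp
  note [measurable] = kernel_measurable[OF b]
  show "(\<lambda>x. \<kappa> x b * log 2 (\<kappa> x b / r)) \<in> borel_measurable \<mu>" by measurable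
qed

text \<open>The common source of the upper and the lower bounds. With \<open>\<psi>\<close> the
  density of a joint law it bounds mutual information by the rate; with \<open>\<psi>\<close> a
  power of 2 it becomes the Donsker--Varadhan inequality. The normalisation couples \<open>q\<close>
  and \<open>\<psi>\<close> and holds only after averaging over \<open>\<mu>\<close>.\<close>

lemma gibbs:
  assumes q: "\<And>b. b \<in> Bs \<Longrightarrow> 0 < q b" "(\<Sum>b\<in>Bs. q b * (\<integral>x. \<psi> x b \<partial>\<mu>)) \<le> 1"
    and \<psi>: "\<And>b x. b \<in> Bs \<Longrightarrow> 0 \<le> \<psi> x b" "AE x in \<mu>. \<forall>b\<in>Bs. 0 < \<kappa> x b \<longrightarrow> 0 < \<psi> x b"
    and i: "\<And>b. b \<in> Bs \<Longrightarrow> integrable \<mu> (\<lambda>x. \<psi> x b)" "\<And>b. b \<in> Bs \<Longrightarrow> integrable \<mu> (\<lambda>x. \<kappa> x b * log 2 (\<psi> x b))"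
  shows "(\<integral>x. (\<Sum>b\<in>Bs. \<kappa> x b * log 2 (\<psi> x b)) \<partial>\<mu>) \<le> (\<integral>x. (\<Sum>b\<in>Bs. \<kappa> x b * log 2 (\<kappa> x b / q b)) \<partial>\<mu>)"
proof -
  let ?l = "\<lambda>x. \<Sum>b\<in>Bs. \<kappa> x b * log 2 (\<psi> x b)" and ?r = "\<lambda>x. \<Sum>b\<in>Bs. \<kappa> x b * log 2 (\<kappa> x b / q b)"
  have i1: "integrable \<mu> ?l" by (intro Bochner_Integration.integrable_sum i)
  have i2: "integrable \<mu> ?r" by (intro Bochner_Integration.integrable_sum integrable_kernel_log q)
  have i3: "integrable \<mu> (\<lambda>x. \<Sum>b\<in>Bs. q b * \<psi> x b)"
    by (intro Bochner_Integration.integrable_sum integrable_mult_right i)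
  \<comment> \<open>Termwise this is \<open>ln s \<le> s - 1\<close> at
    \<open>s = q b * \<psi> x b / \<kappa> x b\<close>, multiplied by \<open>\<kappa> x b\<close>. A
    term with \<open>\<kappa> x b = 0\<close> is 0 on the left and nonnegative on the right.\<close>
  have pw: "AE x in \<mu>. ?l x - ?r x \<le> ((\<Sum>b\<in>Bs. q b * \<psi> x b) - 1) / ln 2"
    using \<psi>(2)
  proof (rule AE_mp, intro AE_I2 impI)
    fix x assume x: "x \<in> space \<mu>" and pos: "\<forall>b\<in>Bs. 0 < \<kappa> x b \<longrightarrow> 0 < \<psi> x b"
    have "?l x - ?r x = (\<Sum>b\<in>Bs. \<kappa> x b * log 2 (\<psi> x b) - \<kappa> x b * log 2 (\<kappa> x b / q b))"
      by (simp add: sum_subtractf)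
    also have "\<dots> \<le> (\<Sum>b\<in>Bs. (q b * \<psi> x b - \<kappa> x b) / ln 2)"
    proof (rule sum_mono)
      fix b assume b: "b \<in> Bs"
      show "\<kappa> x b * log 2 (\<psi> x b) - \<kappa> x b * log 2 (\<kappa> x b / q b) \<le> (q b * \<psi> x b - \<kappa> x b) / ln 2"
      proof (cases "\<kappa> x b = 0")
        case True
        then show ?thesis using \<psi>(1)[OF b] q(1)[OF b] by (simp add: less_imp_le)
      next
        case False
        then have k: "0 < \<kappa> x b" using kernel_nonneg[OF x b] by simp
        then have r: "0 < \<psi> x b" using pos b by auto
        have "\<kappa> x b * log 2 (\<psi> x b) - \<kappa> x b * log 2 (\<kappa> x b / q b) = \<kappa> x b * ln (q b * \<psi> x b / \<kappa> x b) / ln 2"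
          using k r q(1)[OF b] by (simp add: log_def ln_div ln_mult field_simps)
        also have "\<dots> \<le> \<kappa> x b * (q b * \<psi> x b / \<kappa> x b - 1) / ln 2"
          using k r q(1)[OF b] by (intro divide_right_mono mult_left_mono ln_le_minus_one) auto
        also have "\<dots> = (q b * \<psi> x b - \<kappa> x b) / ln 2" using k by (simp add: field_simps)
        finally show ?thesis .
      qed
    qed
    also have "\<dots> = ((\<Sum>b\<in>Bs. q b * \<psi> x b) - 1) / ln 2"
      by (simp add: sum_subtractf kernel_sum[OF x] flip: sum_divide_distrib)
    finally show "?l x - ?r x \<le> ((\<Sum>b\<in>Bs. q b * \<psi> x b) - 1) / ln 2" .
  qed
  have "(\<integral>x. ?l x \<partial>\<mu>) - (\<integral>x. ?r x \<partial>\<mu>) = (\<integral>x. ?l x - ?r x \<partial>\<mu>)"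
    by (rule Bochner_Integration.integral_diff[OF i1 i2, symmetric])
  also have "\<dots> \<le> (\<integral>x. ((\<Sum>b\<in>Bs. q b * \<psi> x b) - 1) / ln 2 \<partial>\<mu>)"
    by (rule integral_mono_AE[OF _ _ pw]) (use i1 i2 i3 in auto)
  also have "\<dots> = ((\<Sum>b\<in>Bs. q b * (\<integral>x. \<psi> x b \<partial>\<mu>)) - 1) / ln 2"
    using i(1) i3 by (simp add: prob_space)
  also have "\<dots> \<le> 0" using q(2) by (intro divide_nonpos_pos) auto
  finally show ?thesis by simp
qed

text \<open>The reference weights \<open>q\<close> sit on the index \<open>b\<close>, which is finer than the value \<open>G b\<close>; summing over
  the values of \<open>F\<close> first makes the data processing inequality unnecessary.\<close>

lemma finite_mutual_info_le:
  assumes "prob_space M" and A: "simple_function M A" and B: "simple_function M B"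
    and F: "simple_function \<mu> F"
    and q0: "\<And>b. b \<in> Bs \<Longrightarrow> 0 < q b" and q1: "(\<Sum>b\<in>Bs. q b) \<le> 1"
    and joint: "\<And>a c. measure M {w \<in> space M. A w = a \<and> B w = c} =
       (\<integral>x. (\<Sum>b\<in>Bs. if F x = a \<and> G b = c then \<kappa> x b else 0) \<partial>\<mu>)"
  shows "finite_mutual_info M A B \<le> (\<integral>x. (\<Sum>b\<in>Bs. \<kappa> x b * log 2 (\<kappa> x b / q b)) \<partial>\<mu>)"
proof -
  interpret M: prob_space M by fact
  define SA where "SA = A ` space M \<union> F ` space \<mu>"
  define SB where "SB = B ` space M \<union> G ` Bs"
  have SA: "finite SA" "A ` space M \<subseteq> SA" "F ` space \<mu> \<subseteq> SA"
    using A F unfolding SA_def by (auto simp: simple_functionD)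
  have SB: "finite SB" "B ` space M \<subseteq> SB" "G ` Bs \<subseteq> SB"
    using B finite_Bs unfolding SB_def by (auto simp: simple_functionD)
  have [measurable]: "A \<in> measurable M (count_space UNIV)" "B \<in> measurable M (count_space UNIV)"
    and mF: "F \<in> measurable \<mu> (count_space UNIV)"
    using A B F by (auto intro: measurable_simple_function)
  define P where "P a c = measure M {w \<in> space M. A w = a \<and> B w = c}" for a c
  define PA where "PA a = measure M {w \<in> space M. A w = a}" for a
  define PB where "PB c = measure M {w \<in> space M. B w = c}" for c
  \<comment> \<open>Density of the joint law of the two indices against the product of the
    marginals. Division by 0 makes it 0 where a marginal vanishes.\<close>
  define \<rho> where "\<rho> a c = P a c / (PA a * PB c)" for a c
  have hi: "integrable \<mu> (\<lambda>x. \<kappa> x b * h (F x))" if b: "b \<in> Bs" for b and h :: "_ \<Rightarrow> real"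
  proof (rule integrable_kernel_mult[OF b, where C="\<Sum>a\<in>SA. \<bar>h a\<bar>"])
    show "(\<lambda>x. h (F x)) \<in> borel_measurable \<mu>" using mF by (rule measurable_compose) simp
    show "\<bar>h (F x)\<bar> \<le> (\<Sum>a\<in>SA. \<bar>h a\<bar>)" if "x \<in> space \<mu>" for x
      using SA that by (auto intro!: member_le_sum)
  qed
  have Kai: "integrable \<mu> (\<lambda>x. if F x = a then \<kappa> x b else 0)" if "b \<in> Bs" for a b
    using hi[OF that, of "\<lambda>z. if z = a then 1 else 0"] by (simp add: if_distrib[where f="\<lambda>z. _ * z"] cong: if_cong)
  define m where "m a b = (\<integral>x. (if F x = a then \<kappa> x b else 0) \<partial>\<mu>)" for a b
  have m0: "m a b \<ge> 0" if "b \<in> Bs" for a b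
    unfolding m_def using kernel_nonneg that by (intro integral_nonneg_AE AE_I2) auto
  have P_eq: "P a c = (\<Sum>b\<in>Bs. if G b = c then m a b else 0)" for a c
  proof -
    have "P a c = (\<integral>x. (\<Sum>b\<in>Bs. if G b = c then (if F x = a then \<kappa> x b else 0) else 0) \<partial>\<mu>)"
      unfolding P_def joint by (intro Bochner_Integration.integral_cong refl sum.cong) auto
    also have "\<dots> = (\<Sum>b\<in>Bs. \<integral>x. (if G b = c then (if F x = a then \<kappa> x b else 0) else 0) \<partial>\<mu>)"
    proof (rule Bochner_Integration.integral_sum)
      fix b assume "b \<in> Bs"
      then show "integrable \<mu> (\<lambda>x. if G b = c then (if F x = a then \<kappa> x b else 0) else 0)"
        using Kai[of b a] by (cases "G b = c") simp_all
    qed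
    also have "\<dots> = (\<Sum>b\<in>Bs. if G b = c then m a b else 0)"
      by (intro sum.cong refl) (auto simp: m_def)
    finally show ?thesis .
  qed
  have PA: "PA a = (\<Sum>c\<in>SB. P a c)" for a
    unfolding PA_def P_def by (rule M.measure_eq_sum_joint[OF A B SB(1,2)])
  have PB: "PB c = (\<Sum>a\<in>SA. P a c)" for c
    unfolding PB_def P_def by (subst M.measure_eq_sum_joint[OF B A SA(1,2)]) (simp add: conj_commute)
  have P0: "P a c \<ge> 0" "PA a \<ge> 0" "PB c \<ge> 0" for a c
    by (simp_all add: P_def PA_def PB_def)
  have leA: "P a c \<le> PA a" and leB: "P a c \<le> PB c" for a c
    unfolding P_def PA_def PB_def by (auto intro!: M.finite_measure_mono)
  \<comment> \<open>Summed over all values of \<open>B\<close>, the hypothesis \<open>joint\<close>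
    says that \<open>A\<close> has the law of \<open>F\<close> under \<open>\<mu>\<close>.\<close>
  have \<mu>F: "measure \<mu> {x \<in> space \<mu>. F x = a} = PA a" for a
  proof -
    have "PA a = (\<Sum>c\<in>SB. \<Sum>b\<in>Bs. if G b = c then m a b else 0)" by (simp add: PA P_eq)
    also have "\<dots> = (\<Sum>b\<in>Bs. \<Sum>c\<in>SB. if G b = c then m a b else 0)" by (rule sum.swap)
    also have "\<dots> = (\<Sum>b\<in>Bs. m a b)" using SB by (intro sum.cong refl) auto
    also have "\<dots> = (\<integral>x. (\<Sum>b\<in>Bs. if F x = a then \<kappa> x b else 0) \<partial>\<mu>)"
      unfolding m_def by (rule Bochner_Integration.integral_sum[symmetric]) (use Kai in auto)
    also have "\<dots> = (\<integral>x. indicator {x \<in> space \<mu>. F x = a} x \<partial>\<mu>)"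
      using kernel_sum by (intro Bochner_Integration.integral_cong refl) (auto simp: indicator_def)
    also have "\<dots> = measure \<mu> {x \<in> space \<mu>. F x = a}" by (simp add: Int_absorb2 subset_eq)
    finally show ?thesis by simp
  qed
  have \<rho>0: "\<rho> a c \<ge> 0" for a c using P0 by (simp add: \<rho>_def)
  have m_split: "(\<Sum>a\<in>SA. m a b * h a) = (\<integral>x. \<kappa> x b * h (F x) \<partial>\<mu>)" if b: "b \<in> Bs" for b and h :: "_ \<Rightarrow> real"
  proof -
    have "(\<integral>x. \<kappa> x b * h (F x) \<partial>\<mu>) = (\<integral>x. (\<Sum>a\<in>SA. (if F x = a then \<kappa> x b else 0) * h a) \<partial>\<mu>)"
    proof (intro Bochner_Integration.integral_cong refl)
      fix x assume "x \<in> space \<mu>"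
      then have "F x \<in> SA" using SA by auto
      then show "\<kappa> x b * h (F x) = (\<Sum>a\<in>SA. (if F x = a then \<kappa> x b else 0) * h a)"
        using SA(1) by (simp add: if_distrib[where f="\<lambda>z. z * _"] cong: if_cong)
    qed
    also have "\<dots> = (\<Sum>a\<in>SA. m a b * h a)"
      unfolding m_def by (subst Bochner_Integration.integral_sum) (use Kai[OF b] in auto)
    finally show ?thesis by simp
  qed
  \<comment> \<open>Where \<open>\<rho>\<close> vanishes the joint probability does too; then the
    kernel has integral 0 over that fibre of \<open>F\<close> and so is 0 almost everywhere on it.
    Only finitely many null sets are collected.\<close>
  have pos: "AE x in \<mu>. \<forall>b\<in>Bs. 0 < \<kappa> x b \<longrightarrow> 0 < \<rho> (F x) (G b)"
  proof (rule AE_finite_allI[OF finite_Bs])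
    fix b assume b: "b \<in> Bs"
    have "AE x in \<mu>. \<forall>a\<in>SA. \<rho> a (G b) = 0 \<longrightarrow> (if F x = a then \<kappa> x b else 0) = 0"
    proof (rule AE_finite_allI[OF SA(1)])
      fix a
      show "AE x in \<mu>. \<rho> a (G b) = 0 \<longrightarrow> (if F x = a then \<kappa> x b else 0) = 0"
      proof (cases "\<rho> a (G b) = 0")
        case True
        have "P a (G b) = 0"
          using True leA[of a "G b"] leB[of a "G b"] P0(1)[of a "G b"] by (auto simp: \<rho>_def)
        moreover have "m a b \<le> P a (G b)"
          unfolding P_eq using finite_Bs b m0 by (intro order_trans[OF _ member_le_sum[of b]]) auto
        ultimately have "m a b = 0" using m0[OF b, of a] by simp
        then have "AE x in \<mu>. (if F x = a then \<kappa> x b else 0) = 0"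
          unfolding m_def by (subst (asm) integral_nonneg_eq_0_iff_AE) (use Kai b kernel_nonneg in \<open>auto intro!: AE_I2\<close>)
        then show ?thesis by eventually_elim simp
      qed auto
    qed
    then show "AE x in \<mu>. 0 < \<kappa> x b \<longrightarrow> 0 < \<rho> (F x) (G b)"
    proof (rule AE_mp, intro AE_I2 impI)
      fix x assume x: "x \<in> space \<mu>" and *: "\<forall>a\<in>SA. \<rho> a (G b) = 0 \<longrightarrow> (if F x = a then \<kappa> x b else 0) = 0" "0 < \<kappa> x b"
      have "F x \<in> SA" using SA x by auto
      then have "\<rho> (F x) (G b) \<noteq> 0" using * by force
      then show "0 < \<rho> (F x) (G b)" using \<rho>0[of "F x" "G b"] by simp
    qed
  qed
  have hi_log: "integrable \<mu> (\<lambda>x. \<kappa> x b * log 2 (\<rho> (F x) (G b)))" if "b \<in> Bs" for b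
    using hi[OF that, of "\<lambda>a. log 2 (\<rho> a (G b))"] .
  have "finite_mutual_info M A B = (\<Sum>a\<in>SA. \<Sum>c\<in>SB. P a c * log 2 (\<rho> a c))"
    using finite_mutual_info_eq[OF \<open>prob_space M\<close> A B SA(1,2) SB(1,2)]
    by (simp add: P_def PA_def PB_def \<rho>_def)
  also have "\<dots> = (\<Sum>a\<in>SA. \<Sum>c\<in>SB. \<Sum>b\<in>Bs. if G b = c then m a b * log 2 (\<rho> a c) else 0)"
    by (simp add: P_eq sum_distrib_right if_distrib[where f="\<lambda>z. z * _"] cong: if_cong)
  also have "\<dots> = (\<Sum>a\<in>SA. \<Sum>b\<in>Bs. \<Sum>c\<in>SB. if G b = c then m a b * log 2 (\<rho> a c) else 0)"
    by (intro sum.cong refl) (rule sum.swap)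
  also have "\<dots> = (\<Sum>a\<in>SA. \<Sum>b\<in>Bs. m a b * log 2 (\<rho> a (G b)))"
    using SB by (intro sum.cong refl) auto
  also have "\<dots> = (\<Sum>b\<in>Bs. \<Sum>a\<in>SA. m a b * log 2 (\<rho> a (G b)))" by (rule sum.swap)
  also have "\<dots> = (\<Sum>b\<in>Bs. \<integral>x. \<kappa> x b * log 2 (\<rho> (F x) (G b)) \<partial>\<mu>)"
    using m_split[of _ "\<lambda>a. log 2 (\<rho> a (G b))" for b] by (intro sum.cong refl)
  also have "\<dots> = (\<integral>x. (\<Sum>b\<in>Bs. \<kappa> x b * log 2 (\<rho> (F x) (G b))) \<partial>\<mu>)"
    by (rule Bochner_Integration.integral_sum[symmetric]) (rule hi_log)
  also have "\<dots> \<le> (\<integral>x. (\<Sum>b\<in>Bs. \<kappa> x b * log 2 (\<kappa> x b / q b)) \<partial>\<mu>)"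
  \<comment> \<open>With \<open>\<rho>\<close> as \<open>\<psi>\<close>: for each \<open>b\<close>
    its mean over \<open>\<mu>\<close> is at most 1, so the normalisation follows from
    \<open>q1\<close>.\<close>
  proof (rule gibbs[OF q0 _ \<rho>0 pos _ hi_log])
    show "integrable \<mu> (\<lambda>x. \<rho> (F x) (G b))" for b
      using integral_comp_simple_function(2)[OF F SA(1,3), of "\<lambda>a. \<rho> a (G b)"] .
    have "(\<Sum>b\<in>Bs. q b * (\<integral>x. \<rho> (F x) (G b) \<partial>\<mu>)) \<le> (\<Sum>b\<in>Bs. q b)"
    proof (rule sum_mono)
      fix b assume b: "b \<in> Bs"
      have "(\<integral>x. \<rho> (F x) (G b) \<partial>\<mu>) = (\<Sum>a\<in>SA. PA a * \<rho> a (G b))"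
        using integral_comp_simple_function(1)[OF F SA(1,3), of "\<lambda>a. \<rho> a (G b)"] by (simp add: \<mu>F)
      also have "\<dots> = (\<Sum>a\<in>SA. P a (G b)) / PB (G b)"
        unfolding sum_divide_distrib
      proof (rule sum.cong[OF refl])
        fix a
        have "P a (G b) = 0" if "PA a = 0" using leA[of a "G b"] P0(1)[of a "G b"] that by simp
        then show "PA a * \<rho> a (G b) = P a (G b) / PB (G b)" by (auto simp: \<rho>_def)
      qed
      also have "\<dots> \<le> 1" unfolding PB[symmetric] by simp
      finally show "q b * (\<integral>x. \<rho> (F x) (G b) \<partial>\<mu>) \<le> q b" using q0[OF b] by (simp add: mult_left_le)
    qed
    with q1 show "(\<Sum>b\<in>Bs. q b * (\<integral>x. \<rho> (F x) (G b) \<partial>\<mu>)) \<le> 1" by linarith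
  qed
  finally show ?thesis .
qed

end

section \<open>Borel sets of metric spaces and the space of maps\<close>

lemma sets_metric_borel: "sets (metric_borel X) = sigma_sets (mspace X) {U. openin (mtopology_of X) U}"
  unfolding metric_borel_def
  by (rule sets_measure_of) (use openin_subset in fastforce)

lemma space_metric_borel [simp]: "space (metric_borel X) = mspace X"
  unfolding metric_borel_def by (rule space_measure_of) (use openin_subset in fastforce)

lemma openin_sets_metric_borel: "openin (mtopology_of X) U \<Longrightarrow> U \<in> sets (metric_borel X)"
  unfolding sets_metric_borel by (rule sigma_sets.Basic) simp

lemma closedin_sets_metric_borel:
  assumes "closedin (mtopology_of X) U" shows "U \<in> sets (metric_borel X)"
proof -
  have "mspace X - (mspace X - U) \<in> sets (metric_borel X)"
    using openin_sets_metric_borel[of X "mspace X - U"] assms sets.compl_sets[of "mspace X - U" "metric_borel X"]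
    by (auto simp: closedin_def)
  moreover have "mspace X - (mspace X - U) = U" using assms by (auto simp: closedin_def)
  ultimately show ?thesis by simp
qed

lemma openin_mtopology_of: "openin (mtopology_of X) U \<longleftrightarrow>
    U \<subseteq> mspace X \<and> (\<forall>x\<in>U. \<exists>r>0. \<forall>y\<in>mspace X. mdist X x y < r \<longrightarrow> y \<in> U)"
proof -
  interpret Metric_space "mspace X" "mdist X" by simp
  have "(mball x r \<subseteq> U) \<longleftrightarrow> (\<forall>y\<in>mspace X. mdist X x y < r \<longrightarrow> y \<in> U)" if "x \<in> mspace X" for x r
    using that by (auto simp: subset_iff)
  then show ?thesis
    unfolding mtopology_of_def openin_mtopology by (metis subsetD)
qed

lemma openin_mtopology_of_mball: "openin (mtopology_of X) {y \<in> mspace X. mdist X x y < r}" if "x \<in> mspace X"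
  unfolding openin_mtopology_of
proof (intro conjI ballI)
  fix y assume y: "y \<in> {y \<in> mspace X. mdist X x y < r}"
  show "\<exists>s>0. \<forall>z\<in>mspace X. mdist X y z < s \<longrightarrow> z \<in> {y \<in> mspace X. mdist X x y < r}"
  proof (intro exI[of _ "r - mdist X x y"] conjI ballI impI)
    fix z assume "z \<in> mspace X" "mdist X y z < r - mdist X x y"
    then show "z \<in> {y \<in> mspace X. mdist X x y < r}"
      using y that mdist_triangle[of x X y z] by auto
  qed (use y in auto)
qed auto

text \<open>The inequality ranges over ordered pairs and hence is two-sided; superlevel sets of a
  Lipschitz function are open. Every measurability proof for distances and distortions passes
  through this criterion or through its consequences.\<close>

lemma lipschitz_measurable_metric_borel:
  assumes lip: "\<And>x y. x \<in> mspace X \<Longrightarrow> y \<in> mspace X \<Longrightarrow> f x \<le> f y + C * mdist X x y"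
  shows "f \<in> borel_measurable (metric_borel X)"
proof (rule borel_measurableI_greater)
  fix a :: real
  \<comment> \<open>A positive constant, so that the radius below is a genuine quotient whatever the
    sign of \<open>C\<close>.\<close>
  let ?C = "max C 1"
  have "openin (mtopology_of X) {x \<in> mspace X. a < f x}"
    unfolding openin_mtopology_of
  proof (intro conjI ballI)
    fix x assume x: "x \<in> {x \<in> mspace X. a < f x}"
    show "\<exists>r>0. \<forall>y\<in>mspace X. mdist X x y < r \<longrightarrow> y \<in> {x \<in> mspace X. a < f x}"
    proof (intro exI[of _ "(f x - a) / ?C"] conjI ballI impI)
      fix y assume y: "y \<in> mspace X" "mdist X x y < (f x - a) / ?C"
      have "f x \<le> f y + C * mdist X x y" using x y lip by auto
      also have "C * mdist X x y \<le> ?C * mdist X x y" by (rule mult_right_mono) auto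
      also have "?C * mdist X x y < f x - a" using y(2) by (simp add: pos_less_divide_eq mult.commute)
      finally show "y \<in> {x \<in> mspace X. a < f x}" using y by auto
    qed (use x in auto)
  qed auto
  then show "{x \<in> space (metric_borel X). a < f x} \<in> sets (metric_borel X)"
    by (simp add: openin_sets_metric_borel)
qed

lemma mdist_right_measurable [measurable]:
  assumes "a \<in> mspace X" shows "(\<lambda>x. mdist X a x) \<in> borel_measurable (metric_borel X)"
proof (rule lipschitz_measurable_metric_borel)
  fix x y assume "x \<in> mspace X" "y \<in> mspace X"
  then show "mdist X a x \<le> mdist X a y + 1 * mdist X x y"
    using assms mdist_triangle[of a X y x] by (simp add: mdist_commute)
qed

locale compact_metric =
  fixes X :: "'a metric"
  assumes compact: "compact_space (mtopology_of X)"
begin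

lemma totally_bounded:
  assumes "0 < e" obtains K where "finite K" "K \<subseteq> mspace X" "\<And>x. x \<in> mspace X \<Longrightarrow> \<exists>a\<in>K. mdist X a x < e"
proof -
  interpret Metric_space "mspace X" "mdist X" by simp
  have "mtotally_bounded (mspace X)"
    using compact by (intro compactin_imp_mtotally_bounded) (simp add: compact_space_def mtopology_of_def)
  then obtain K where K: "finite K" "K \<subseteq> mspace X" "mspace X \<subseteq> (\<Union>x\<in>K. mball x e)"
    unfolding mtotally_bounded_def using assms by meson
  have "\<exists>a\<in>K. mdist X a x < e" if "x \<in> mspace X" for x
    using K(3) that by (auto simp: subset_iff in_mball)
  with K(1,2) show ?thesis by (rule that)
qed

lemma bounded_mdist: "\<exists>B\<ge>0. \<forall>x\<in>mspace X. \<forall>y\<in>mspace X. mdist X x y \<le> B"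
proof -
  obtain K where K: "finite K" "K \<subseteq> mspace X" "\<And>x. x \<in> mspace X \<Longrightarrow> \<exists>a\<in>K. mdist X a x < 1"
    using totally_bounded[of 1] by auto
  show ?thesis
  proof (intro exI[of _ "(\<Sum>a\<in>K. \<Sum>b\<in>K. mdist X a b) + 2"] conjI ballI)
    fix x y assume xy: "x \<in> mspace X" "y \<in> mspace X"
    obtain a b where a: "a \<in> K" "mdist X a x < 1" and b: "b \<in> K" "mdist X b y < 1"
      using K(3) xy by meson
    have "mdist X x y \<le> mdist X x a + (mdist X a b + mdist X b y)"
      using mdist_triangle[of x X a y] mdist_triangle[of a X b y] xy a b K by (auto simp: subset_iff)
    moreover have "mdist X a b \<le> (\<Sum>b\<in>K. mdist X a b)" using b K by (intro member_le_sum) auto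
    moreover have "(\<Sum>b\<in>K. mdist X a b) \<le> (\<Sum>a\<in>K. \<Sum>b\<in>K. mdist X a b)"
      using a K by (intro member_le_sum[where f="\<lambda>a. \<Sum>b\<in>K. mdist X a b"]) (auto intro: sum_nonneg)
    ultimately show "mdist X x y \<le> (\<Sum>a\<in>K. \<Sum>b\<in>K. mdist X a b) + 2"
      using a b by (simp add: mdist_commute)
  qed (auto intro!: sum_nonneg add_nonneg_nonneg)
qed

text \<open>Some bound on the distances, not necessarily the least; it plays the part of the worst
  distortion per unit of volume.\<close>

definition diam :: real where
  "diam = (SOME B. 0 \<le> B \<and> (\<forall>x\<in>mspace X. \<forall>y\<in>mspace X. mdist X x y \<le> B))"

lemma diam_nonneg: "0 \<le> diam" and mdist_le_diam: "x \<in> mspace X \<Longrightarrow> y \<in> mspace X \<Longrightarrow> mdist X x y \<le> diam"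
proof -
  have "0 \<le> diam \<and> (\<forall>x\<in>mspace X. \<forall>y\<in>mspace X. mdist X x y \<le> diam)"
    unfolding diam_def using bounded_mdist by (rule someI_ex[of "\<lambda>B. 0 \<le> B \<and> (\<forall>x\<in>mspace X. \<forall>y\<in>mspace X. mdist X x y \<le> B)"])
  then show "0 \<le> diam" "x \<in> mspace X \<Longrightarrow> y \<in> mspace X \<Longrightarrow> mdist X x y \<le> diam" by auto
qed

lemma separable:
  obtains D where "countable D" "D \<subseteq> mspace X"
    "\<And>x e. x \<in> mspace X \<Longrightarrow> 0 < e \<Longrightarrow> \<exists>a\<in>D. mdist X a x < e"
proof -
  have "\<exists>K. finite K \<and> K \<subseteq> mspace X \<and> (\<forall>x\<in>mspace X. \<exists>a\<in>K. mdist X a x < 1 / real (Suc n))" for n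
    using totally_bounded[of "1 / real (Suc n)"] by (metis divide_pos_pos of_nat_0_less_iff zero_less_Suc zero_less_one)
  then obtain K where K: "\<And>n. finite (K n)" "\<And>n. K n \<subseteq> mspace X"
      "\<And>n x. x \<in> mspace X \<Longrightarrow> \<exists>a\<in>K n. mdist X a x < 1 / real (Suc n)"
    by metis
  show ?thesis
  proof (rule that[of "\<Union>n. K n"])
    fix x and e :: real assume x: "x \<in> mspace X" and e: "0 < e"
    obtain n where "1 / real (Suc n) < e" using e nat_approx_posE by blast
    moreover obtain a where "a \<in> K n" "mdist X a x < 1 / real (Suc n)" using K(3) x by blast
    ultimately show "\<exists>a\<in>\<Union> (range K). mdist X a x < e" by (intro bexI[of _ a]) auto
  qed (use K(1,2) in \<open>auto intro: countable_finite\<close>)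
qed

text \<open>By separability an open set is a countable union of balls with centres in a dense set,
  so the distances to fixed points determine measurability.\<close>

lemma measurable_metric_borelI:
  assumes sp: "\<And>w. w \<in> space N \<Longrightarrow> h w \<in> mspace X"
    and meas: "\<And>a. a \<in> mspace X \<Longrightarrow> (\<lambda>w. mdist X a (h w)) \<in> borel_measurable N"
  shows "h \<in> measurable N (metric_borel X)"
  unfolding metric_borel_def
proof (rule measurable_measure_of)
  fix U assume "U \<in> {U. openin (mtopology_of X) U}"
  then have U: "U \<subseteq> mspace X" "\<And>x. x \<in> U \<Longrightarrow> \<exists>r>0. \<forall>y\<in>mspace X. mdist X x y < r \<longrightarrow> y \<in> U"
    unfolding openin_mtopology_of by auto
  obtain D where D: "countable D" "D \<subseteq> mspace X"
    "\<And>x e. x \<in> mspace X \<Longrightarrow> 0 < e \<Longrightarrow> \<exists>a\<in>D. mdist X a x < e" using separable by blast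
  define J where "J = {(a, n) \<in> D \<times> (UNIV :: nat set). {y \<in> mspace X. mdist X a y < 1 / real (Suc n)} \<subseteq> U}"
  have "countable J" unfolding J_def by (rule countable_subset[of _ "D \<times> UNIV"]) (use D in auto)
  have "h -` U \<inter> space N = (\<Union>(a, n)\<in>J. {w \<in> space N. mdist X a (h w) < 1 / real (Suc n)})"
  proof (intro set_eqI iffI)
    fix w assume "w \<in> h -` U \<inter> space N"
    then have w: "w \<in> space N" "h w \<in> U" by auto
    obtain r where r: "r > 0" "\<forall>y\<in>mspace X. mdist X (h w) y < r \<longrightarrow> y \<in> U" using U(2) w by blast
    obtain n where n: "1 / real (Suc n) < r / 2" using r nat_approx_posE by (meson half_gt_zero)
    obtain a where a: "a \<in> D" "mdist X a (h w) < 1 / real (Suc n)" using D(3)[of "h w" "1 / real (Suc n)"] w U by auto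
    have "{y \<in> mspace X. mdist X a y < 1 / real (Suc n)} \<subseteq> U"
    proof safe
      fix y assume y: "y \<in> mspace X" "mdist X a y < 1 / real (Suc n)"
      have "mdist X (h w) y \<le> mdist X (h w) a + mdist X a y"
        using w U y a D by (intro mdist_triangle) auto
      then have "mdist X (h w) y < r" using a y n by (simp add: mdist_commute)
      then show "y \<in> U" using r y by auto
    qed
    then show "w \<in> (\<Union>(a, n)\<in>J. {w \<in> space N. mdist X a (h w) < 1 / real (Suc n)})"
      using a w by (auto simp: J_def)
  qed (use sp in \<open>auto simp: J_def\<close>)
  also have "\<dots> \<in> sets N"
  proof (rule sets.countable_UN''[OF \<open>countable J\<close>])
    fix p assume "p \<in> J"
    then have "fst p \<in> mspace X" using D by (auto simp: J_def)
    from meas[OF this] show "(case p of (a, n) \<Rightarrow> {w \<in> space N. mdist X a (h w) < 1 / real (Suc n)}) \<in> sets N"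
      by (cases p) simp
  qed
  finally show "h -` U \<inter> space N \<in> sets N" .
qed (use sp openin_subset[of "mtopology_of X"] in \<open>force+\<close>)

text \<open>The distance of two maps is the infimum over a countable dense set of
  \<open>mdist X a (f w) + mdist X a (g w)\<close>. This avoids comparing the Borel sets of a
  product with the product of the Borel sets.\<close>

lemma mdist_measurable [measurable (raw)]:
  assumes f: "f \<in> measurable N (metric_borel X)" and g: "g \<in> measurable N (metric_borel X)"
  shows "(\<lambda>w. mdist X (f w) (g w)) \<in> borel_measurable N"
proof (rule borel_measurableI_less)
  fix r :: real
  obtain D where D: "countable D" "D \<subseteq> mspace X"
    "\<And>x e. x \<in> mspace X \<Longrightarrow> 0 < e \<Longrightarrow> \<exists>a\<in>D. mdist X a x < e" using separable by blast
  have fg: "f w \<in> mspace X" "g w \<in> mspace X" if "w \<in> space N" for w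
    using f g that by (auto dest: measurable_space)
  have m: "{w \<in> space N. mdist X a (f w) + mdist X a (g w) < r} \<in> sets N" if "a \<in> D" for a
  proof -
    have [measurable]: "(\<lambda>w. mdist X a (f w)) \<in> borel_measurable N" "(\<lambda>w. mdist X a (g w)) \<in> borel_measurable N"
      using measurable_compose[OF f mdist_right_measurable] measurable_compose[OF g mdist_right_measurable] that D by auto
    show ?thesis by measurable
  qed
  have "{w \<in> space N. mdist X (f w) (g w) < r} = (\<Union>a\<in>D. {w \<in> space N. mdist X a (f w) + mdist X a (g w) < r})"
  proof (intro set_eqI iffI)
    fix w assume "w \<in> {w \<in> space N. mdist X (f w) (g w) < r}"
    then have w: "w \<in> space N" "mdist X (f w) (g w) < r" by auto
    obtain a where a: "a \<in> D" "mdist X a (f w) < (r - mdist X (f w) (g w)) / 2"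
      using D(3)[of "f w" "(r - mdist X (f w) (g w)) / 2"] fg w by auto
    have "mdist X a (g w) \<le> mdist X a (f w) + mdist X (f w) (g w)"
      using fg w a D by (intro mdist_triangle) auto
    then show "w \<in> (\<Union>a\<in>D. {w \<in> space N. mdist X a (f w) + mdist X a (g w) < r})"
      using w a by force
  next
    fix w assume "w \<in> (\<Union>a\<in>D. {w \<in> space N. mdist X a (f w) + mdist X a (g w) < r})"
    then obtain a where a: "a \<in> D" "w \<in> space N" "mdist X a (f w) + mdist X a (g w) < r" by auto
    moreover have "mdist X (f w) (g w) \<le> mdist X (f w) a + mdist X a (g w)"
      using fg a D by (intro mdist_triangle) auto
    ultimately show "w \<in> {w \<in> space N. mdist X (f w) (g w) < r}" by (simp add: mdist_commute)
  qed
  also have "\<dots> \<in> sets N" using D m by (intro sets.countable_UN'') auto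
  finally show "{w \<in> space N. mdist X (f w) (g w) < r} \<in> sets N" .
qed

end

section \<open>Cubes and the space of maps on a cube\<close>

lemma cube_borel [measurable]: "cube L \<in> sets borel"
proof -
  have "cube L = {u \<in> space borel. \<forall>i. 0 \<le> u $ i \<and> u $ i < L}" by (auto simp: cube_def)
  also have "\<dots> \<in> sets borel" by measurable
  finally show ?thesis .
qed

text \<open>The half-open cube lies between the open and the closed box, which have the same
  volume.\<close>

lemma emeasure_cube:
  assumes "0 \<le> L" shows "emeasure lborel (cube L :: (real ^ 'n) set) = ennreal (L ^ CARD('n))"
proof -
  have b: "(\<Prod>b\<in>Basis. ((\<chi> i. L) - 0 :: real ^ 'n) \<bullet> b) = L ^ CARD('n)"
  proof -
    have "((\<chi> i. L) - 0 :: real ^ 'n) \<bullet> b = L" if "b \<in> Basis" for b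
      using that by (auto simp: Basis_vec_def inner_axis)
    then show ?thesis by simp
  qed
  have le: "\<And>b. b \<in> Basis \<Longrightarrow> (0 :: real ^ 'n) \<bullet> b \<le> (\<chi> i. L) \<bullet> b"
    using assms by (auto simp: Basis_vec_def inner_axis)
  have "emeasure lborel (cube L :: (real ^ 'n) set) \<le> emeasure lborel (cbox 0 (\<chi> i. L) :: (real ^ 'n) set)"
    by (rule emeasure_mono) (simp_all add: cube_def mem_box_cart subset_iff less_imp_le)
  also have "\<dots> = ennreal (L ^ CARD('n))" using emeasure_lborel_cbox[OF le] b by simp
  finally have 1: "emeasure lborel (cube L :: (real ^ 'n) set) \<le> ennreal (L ^ CARD('n))" .
  have "ennreal (L ^ CARD('n)) = emeasure lborel (box 0 (\<chi> i. L) :: (real ^ 'n) set)"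
    using emeasure_lborel_box[OF le] b by simp
  also have "\<dots> \<le> emeasure lborel (cube L :: (real ^ 'n) set)"
    by (rule emeasure_mono) (simp_all add: cube_def mem_box_cart subset_iff less_imp_le)
  finally show ?thesis using 1 by (simp add: antisym)
qed

lemma space_cube_measure [simp]: "space (cube_measure L) = cube L"
  by (simp add: cube_measure_def)

lemma finite_measure_cube_measure: "finite_measure (cube_measure L :: (real ^ 'n) measure)"
proof -
  have "cube L = ({} :: (real ^ 'n) set)" if "\<not> 0 \<le> L"
    using that by (auto simp: cube_def)
  then have "emeasure lborel (cube L :: (real ^ 'n) set) < \<top>"
    by (cases "0 \<le> L") (auto simp: emeasure_cube)
  then show ?thesis
    by (intro finite_measureI) (simp add: cube_measure_def emeasure_restrict_space less_top)
qed

lemma measure_cube_measure: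
  "0 \<le> L \<Longrightarrow> measure (cube_measure L :: (real ^ 'n) measure) (cube L) = L ^ CARD('n)"
  by (simp add: cube_measure_def measure_def emeasure_restrict_space emeasure_cube)

lemma cube_norm_le: "norm u \<le> real CARD('n) * L" if "u \<in> cube L" for u :: "real ^ 'n"
proof -
  have "norm u \<le> (\<Sum>i\<in>UNIV. \<bar>u $ i\<bar>)" by (rule norm_le_l1_cart)
  also have "\<dots> \<le> (\<Sum>i\<in>(UNIV::'n set). L)" using that by (intro sum_mono) (auto simp: cube_def less_imp_le)
  finally show ?thesis by simp
qed

context compact_metric
begin

lemma L1_maps_space: "f \<in> L1_maps L X \<Longrightarrow> u \<in> cube L \<Longrightarrow> f u \<in> mspace X"
  by (auto simp: L1_maps_def dest: measurable_space)

lemma integrable_mdist: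
  fixes f :: "real ^ 'n \<Rightarrow> 'a"
  assumes "f \<in> L1_maps L X" "g \<in> L1_maps L X"
  shows "integrable (cube_measure L) (\<lambda>u. mdist X (f u) (g u))"
proof -
  interpret finite_measure "cube_measure L :: (real ^ 'n) measure" by (rule finite_measure_cube_measure)
  show ?thesis
  proof (rule integrable_const_bound[where B=diam])
    show "AE u in cube_measure L. norm (mdist X (f u) (g u)) \<le> diam"
      using assms by (intro AE_I2) (simp add: mdist_le_diam L1_maps_space)
  qed (use assms mdist_measurable in \<open>unfold L1_maps_def, blast\<close>)
qed

lemma equiv_ae_rel: "equiv (L1_maps L X :: (real ^ 'n \<Rightarrow> 'a) set) (ae_rel L X)"
proof (rule equivI)
  show "sym (ae_rel L X :: ((real ^ 'n \<Rightarrow> 'a) \<times> _) set)"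
    unfolding sym_def ae_rel_def by (simp add: eq_commute)
  show "trans (ae_rel L X :: ((real ^ 'n \<Rightarrow> 'a) \<times> _) set)"
  proof (rule transI)
    fix f g h :: "real ^ 'n \<Rightarrow> 'a"
    assume *: "(f, g) \<in> ae_rel L X" "(g, h) \<in> ae_rel L X"
    then have "AE u in cube_measure L. f u = g u" "AE u in cube_measure L. g u = h u" by (auto simp: ae_rel_def)
    then have "AE u in cube_measure L. f u = h u" by eventually_elim simp
    with * show "(f, h) \<in> ae_rel L X" by (simp add: ae_rel_def)
  qed
qed (auto simp: refl_on_def ae_rel_def)

lemma rep_in:
  assumes "F \<in> L1_maps L X // ae_rel L X" shows "rep F \<in> F" "rep F \<in> L1_maps L X"
proof -
  have "F \<noteq> {}" using assms equiv_ae_rel in_quotient_imp_non_empty by metis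
  then show "rep F \<in> F" unfolding rep_def by (simp add: some_in_eq)
  then show "rep F \<in> L1_maps L X" using assms equiv_ae_rel in_quotient_imp_subset by blast
qed

definition ae_class :: "real \<Rightarrow> (real ^ 'n \<Rightarrow> 'a) \<Rightarrow> (real ^ 'n \<Rightarrow> 'a) set" where
  "ae_class L f = ae_rel L X `` {f}"

lemma ae_class_in: "f \<in> L1_maps L X \<Longrightarrow> ae_class L f \<in> L1_maps L X // ae_rel L X"
  unfolding ae_class_def by (rule quotientI)

lemma rep_ae_class: "f \<in> L1_maps L X \<Longrightarrow> AE u in cube_measure L. rep (ae_class L f) u = f u"
proof -
  assume "f \<in> L1_maps L X"
  then have "rep (ae_class L f) \<in> ae_class L f" by (intro rep_in(1)[of _ L] ae_class_in)
  moreover have "AE u in cube_measure L. f u = g u" if "g \<in> ae_class L f" for g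
    using that by (simp add: ae_class_def ae_rel_def)
  ultimately have "AE u in cube_measure L. f u = rep (ae_class L f) u" by blast
  then show ?thesis by eventually_elim simp
qed

text \<open>\<open>L1_dist\<close> is computed on chosen representatives, so the axioms are
  integrated pointwise facts about these. Only the step from distance 0 to equality uses that the
  points are classes.\<close>

lemma Metric_space_L1: "Metric_space (L1_maps L X // ae_rel L X :: (real ^ 'n \<Rightarrow> 'a) set set) (L1_dist L X)"
proof
  fix F G H :: "(real ^ 'n \<Rightarrow> 'a) set"
  show "0 \<le> L1_dist L X F G" by (simp add: L1_dist_def)
  show "L1_dist L X F G = L1_dist L X G F" by (simp add: L1_dist_def mdist_commute)
  assume F: "F \<in> L1_maps L X // ae_rel L X" and G: "G \<in> L1_maps L X // ae_rel L X"
  note f = rep_in[OF F] and g = rep_in[OF G]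
  show "L1_dist L X F G = 0 \<longleftrightarrow> F = G"
  proof
    assume "L1_dist L X F G = 0"
    then have "AE u in cube_measure L. mdist X (rep F u) (rep G u) = 0"
      unfolding L1_dist_def
      using integral_nonneg_eq_0_iff_AE[OF integrable_mdist[OF f(2) g(2)]] by simp
    then have "AE u in cube_measure L. rep F u = rep G u"
    proof (rule AE_mp, intro AE_I2 impI)
      fix u :: "real ^ 'n" assume "u \<in> space (cube_measure L)" "mdist X (rep F u) (rep G u) = 0"
      then show "rep F u = rep G u" using f(2) g(2) by (simp add: L1_maps_space)
    qed
    then have "(rep F, rep G) \<in> ae_rel L X" using f g by (simp add: ae_rel_def)
    then show "F = G" using quotient_eqI[OF equiv_ae_rel F G f(1) g(1)] by simp
  next
    assume "F = G"
    have "L1_dist L X F F = (\<integral>u. 0 \<partial>(cube_measure L :: (real ^ 'n) measure))"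
      unfolding L1_dist_def
      using L1_maps_space[OF f(2)] by (intro Bochner_Integration.integral_cong refl) simp
    with \<open>F = G\<close> show "L1_dist L X F G = 0" by simp
  qed
  assume H: "H \<in> L1_maps L X // ae_rel L X"
  note h = rep_in[OF H]
  have "L1_dist L X F H \<le> (\<integral>u. mdist X (rep F u) (rep G u) + mdist X (rep G u) (rep H u) \<partial>cube_measure L)"
    unfolding L1_dist_def
  proof (rule integral_mono)
    fix u :: "real ^ 'n" assume "u \<in> space (cube_measure L)"
    then show "mdist X (rep F u) (rep H u) \<le> mdist X (rep F u) (rep G u) + mdist X (rep G u) (rep H u)"
      using f(2) g(2) h(2) by (intro mdist_triangle) (simp_all add: L1_maps_space)
  qed (use f(2) g(2) h(2) in \<open>simp_all add: integrable_mdist\<close>)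
  also have "\<dots> = L1_dist L X F G + L1_dist L X G H"
    unfolding L1_dist_def using f(2) g(2) h(2) by (intro Bochner_Integration.integral_add integrable_mdist)
  finally show "L1_dist L X F H \<le> L1_dist L X F G + L1_dist L X G H" .
qed

lemma mspace_L1_space [simp]: "mspace (L1_space L X) = L1_maps L X // ae_rel L X"
  using Metric_space.mspace_metric[OF Metric_space_L1, of L] by (simp only: L1_space_def)

lemma mdist_L1_space [simp]: "mdist (L1_space L X) = L1_dist L X"
  using Metric_space.mdist_metric[OF Metric_space_L1, of L] by (simp only: L1_space_def)

end

section \<open>Distortion\<close>

text \<open>The exponential growth is what the weight \<open>exp (- norm v)\<close> of the later
  metric allows. On a bounded cube it makes the distortion Lipschitz in the source point.\<close>

locale lipschitz_action = compact_metric X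
  for X :: "'a metric" +
  fixes T :: "real ^ 'n \<Rightarrow> 'a \<Rightarrow> 'a"
  assumes action: "continuous_action X T"
    and lipschitz: "\<And>u x y. x \<in> mspace X \<Longrightarrow> y \<in> mspace X \<Longrightarrow> mdist X (T u x) (T u y) \<le> exp (norm u) * mdist X x y"
begin

lemma T_in_mspace [simp]: "x \<in> mspace X \<Longrightarrow> T u x \<in> mspace X"
proof -
  assume x: "x \<in> mspace X"
  have "continuous_map (prod_topology euclidean (mtopology_of X)) (mtopology_of X) (\<lambda>(u, x). T u x)"
    using action by (simp add: continuous_action_def)
  from continuous_map_funspace[OF this] x show ?thesis
    by (auto simp: Pi_iff)
qed

lemma T_add: "x \<in> mspace X \<Longrightarrow> T (u + v) x = T u (T v x)"
  using action by (simp add: continuous_action_def)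

lemma orbit_measurable: "x \<in> mspace X \<Longrightarrow> (\<lambda>u. T u x) \<in> measurable borel (metric_borel X)"
proof -
  assume x: "x \<in> mspace X"
  have c: "continuous_map (prod_topology euclidean (mtopology_of X)) (mtopology_of X) (\<lambda>(u, x). T u x)"
    using action by (simp add: continuous_action_def)
  have "continuous_map euclidean (prod_topology euclidean (mtopology_of X)) (\<lambda>u. (u, x))"
    using x by (simp add: continuous_map_pairedI)
  from continuous_map_compose[OF this c]
  have orb: "continuous_map euclidean (mtopology_of X) (\<lambda>u. T u x)" by (simp add: o_def)
  show ?thesis
    unfolding metric_borel_def
  proof (rule measurable_measure_of)
    fix U assume "U \<in> {U. openin (mtopology_of X) U}"
    then have "open {u. T u x \<in> U}"
      using openin_continuous_map_preimage[OF orb, of U] by simp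
    then show "(\<lambda>u. T u x) -` U \<inter> space borel \<in> sets borel" by (simp add: vimage_def)
  qed (use x openin_subset[of "mtopology_of X"] in \<open>force+\<close>)
qed

lemma orbit_L1_maps: "x \<in> mspace X \<Longrightarrow> (\<lambda>u. T u x) \<in> L1_maps L X"
  unfolding L1_maps_def cube_measure_def
  by (rule measurable_restrict_space1) (simp add: orbit_measurable)

lemma T_measurable: "T u \<in> measurable (metric_borel X) (metric_borel X)"
proof (rule measurable_metric_borelI)
  fix a assume a: "a \<in> mspace X"
  show "(\<lambda>x. mdist X a (T u x)) \<in> borel_measurable (metric_borel X)"
  proof (rule lipschitz_measurable_metric_borel)
    fix x y assume xy: "x \<in> mspace X" "y \<in> mspace X"
    have "mdist X a (T u x) \<le> mdist X a (T u y) + mdist X (T u y) (T u x)"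
      using xy a by (intro mdist_triangle) auto
    then show "mdist X a (T u x) \<le> mdist X a (T u y) + exp (norm u) * mdist X x y"
      using lipschitz[OF xy, of u] by (simp add: mdist_commute)
  qed
qed simp

text \<open>Left without division by \<open>L ^ CARD('n)\<close>, so that distortions of disjoint
  blocks add up; the volume is moved to the side of the bound.\<close>

definition distortion :: "real \<Rightarrow> 'a \<Rightarrow> (real ^ 'n \<Rightarrow> 'a) \<Rightarrow> real" where
  "distortion L x f = (LINT u|cube_measure L. mdist X (T u x) (f u))"

lemma distortion_nonneg: "0 \<le> distortion L x f"
  by (simp add: distortion_def)

lemma integrable_distortion:
  "x \<in> mspace X \<Longrightarrow> f \<in> L1_maps L X \<Longrightarrow> integrable (cube_measure L) (\<lambda>u. mdist X (T u x) (f u))"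
  by (rule integrable_mdist[OF orbit_L1_maps])

text \<open>Turns a pointwise comparison into one of distortions. Taking for \<open>g\<close> the
  orbit of the source point, whose distortion is 0, gives absolute bounds.\<close>

lemma distortion_mono_const:
  assumes "0 \<le> L" "x \<in> mspace X" "x' \<in> mspace X" "f \<in> L1_maps L X" "g \<in> L1_maps L X" 
    and "\<And>u. u \<in> cube L \<Longrightarrow> mdist X (T u x) (f u) \<le> mdist X (T u x') (g u) + c"
  shows "distortion L x f \<le> distortion L x' g + L ^ CARD('n) * c"
proof -
  interpret finite_measure "cube_measure L :: (real ^ 'n) measure" by (rule finite_measure_cube_measure)
  have "distortion L x f \<le> (LINT u|cube_measure L. mdist X (T u x') (g u) + c)"
    unfolding distortion_def
    by (rule integral_mono) (simp_all add: assms integrable_distortion)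
  also have "\<dots> = distortion L x' g + (LINT u|(cube_measure L :: (real ^ 'n) measure). c)"
    unfolding distortion_def
    by (rule Bochner_Integration.integral_add) (simp_all add: assms integrable_distortion)
  also have "\<dots> = distortion L x' g + L ^ CARD('n) * c"
    using assms(1) by (simp add: measure_cube_measure)
  finally show ?thesis .
qed

lemma distortion_le_diam:
  assumes "0 \<le> L" "x \<in> mspace X" "f \<in> L1_maps L X"
  shows "distortion L x f \<le> L ^ CARD('n) * diam"
proof -
  have "distortion L x f \<le> distortion L x (\<lambda>u. T u x) + L ^ CARD('n) * diam"
  proof (rule distortion_mono_const)
    fix u :: "real ^ 'n" assume "u \<in> cube L"
    then show "mdist X (T u x) (f u) \<le> mdist X (T u x) (T u x) + diam"
      using assms mdist_le_diam[of "T u x" "f u"] mdist_nonneg[of X "T u x" "T u x"] L1_maps_space[of f L u]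
      by (simp del: mdist_nonneg)
  qed (simp_all add: assms orbit_L1_maps)
  also have "distortion L x (\<lambda>u. T u x) = 0"
    using assms mdist_zero[of "T u x" X "T u x" for u] by (simp add: distortion_def del: mdist_zero)
  finally show ?thesis by simp
qed

lemma distortion_lipschitz:
  assumes "0 \<le> L" "x \<in> mspace X" "x' \<in> mspace X" "f \<in> L1_maps L X"
  shows "distortion L x f \<le> distortion L x' f + L ^ CARD('n) * exp (real CARD('n) * L) * mdist X x x'"
proof -
  have "distortion L x f \<le> distortion L x' f + L ^ CARD('n) * (exp (real CARD('n) * L) * mdist X x x')"
  proof (rule distortion_mono_const)
    fix u :: "real ^ 'n" assume u: "u \<in> cube L"
    have "mdist X (T u x) (f u) \<le> mdist X (T u x) (T u x') + mdist X (T u x') (f u)"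
      using assms u by (intro mdist_triangle) (auto intro: L1_maps_space)
    moreover have "mdist X (T u x) (T u x') \<le> exp (real CARD('n) * L) * mdist X x x'"
      using lipschitz[OF assms(2,3), of u] cube_norm_le[OF u]
      by (elim order_trans) (auto intro!: mult_right_mono)
    ultimately show "mdist X (T u x) (f u) \<le> mdist X (T u x') (f u) + exp (real CARD('n) * L) * mdist X x x'" by simp
  qed (use assms in auto)
  then show ?thesis by (simp add: mult.assoc)
qed

lemma distortion_measurable:
  assumes "0 \<le> L" "f \<in> L1_maps L X"
  shows "(\<lambda>x. distortion L x f) \<in> borel_measurable (metric_borel X)"
  by (rule lipschitz_measurable_metric_borel[where C="L ^ CARD('n) * exp (real CARD('n) * L)"])
     (use distortion_lipschitz assms in auto)

lemma distortion_cong_AE: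
  fixes f g :: "real ^ 'n \<Rightarrow> 'a"
  assumes x: "x \<in> mspace X" and f: "f \<in> L1_maps L X" and g: "g \<in> L1_maps L X"
    and eq: "AE u in cube_measure L. f u = g u"
  shows "distortion L x f = distortion L x g"
  unfolding distortion_def
proof (rule integral_cong_AE)
  show "AE u in cube_measure L. mdist X (T u x) (f u) = mdist X (T u x) (g u)"
    using eq by eventually_elim simp
qed (use integrable_distortion[OF x f] integrable_distortion[OF x g] in \<open>simp_all add: borel_measurable_integrable\<close>)

text \<open>By the triangle inequality at each point of the cube, the distortion is 1-Lipschitz for
  \<open>L1_dist\<close>.\<close>

lemma distortion_rep_measurable:
  assumes x: "x \<in> mspace X"
  shows "(\<lambda>F. distortion L x (rep F)) \<in> borel_measurable (metric_borel (L1_space L X))"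
proof (rule lipschitz_measurable_metric_borel)
  fix F G :: "(real ^ 'n \<Rightarrow> 'a) set" assume "F \<in> mspace (L1_space L X)" "G \<in> mspace (L1_space L X)"
  then have F: "rep F \<in> L1_maps L X" and G: "rep G \<in> L1_maps L X" by (auto intro: rep_in)
  have "distortion L x (rep F) \<le> (LINT u|cube_measure L. mdist X (T u x) (rep G u) + mdist X (rep F u) (rep G u))"
    unfolding distortion_def
  proof (rule integral_mono)
    fix u :: "real ^ 'n" assume "u \<in> space (cube_measure L)"
    then show "mdist X (T u x) (rep F u) \<le> mdist X (T u x) (rep G u) + mdist X (rep F u) (rep G u)"
      using mdist_triangle[of "T u x" X "rep G u" "rep F u"] L1_maps_space[OF F] L1_maps_space[OF G] x
      by (simp add: mdist_commute)
  qed (simp_all add: F G x integrable_distortion integrable_mdist)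
  also have "\<dots> = distortion L x (rep G) + L1_dist L X F G"
    unfolding distortion_def L1_dist_def
    by (rule Bochner_Integration.integral_add) (simp_all add: F G x integrable_distortion integrable_mdist)
  finally show "distortion L x (rep F) \<le> distortion L x (rep G) + 1 * mdist (L1_space L X) F G" by simp
qed

text \<open>The distortion is an infimal convolution over a countable dense set in the first argument, so
  no separability of the space of maps is needed.\<close>

lemma distortion_joint_measurable:
  assumes L: "0 \<le> L" and \<xi>: "\<xi> \<in> measurable M (metric_borel X)"
    and Y: "Y \<in> measurable M (metric_borel (L1_space L X))"
  shows "(\<lambda>w. distortion L (\<xi> w) (rep (Y w))) \<in> borel_measurable M"
proof (rule borel_measurableI_less)
  fix r :: real
  define C where "C = L ^ CARD('n) * exp (real CARD('n) * L)"
  have C: "0 \<le> C" using L by (simp add: C_def)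
  obtain D where D: "countable D" "D \<subseteq> mspace X"
    "\<And>x e. x \<in> mspace X \<Longrightarrow> 0 < e \<Longrightarrow> \<exists>a\<in>D. mdist X a x < e" using separable by blast
  have \<xi>s: "\<xi> w \<in> mspace X" if "w \<in> space M" for w using measurable_space[OF \<xi> that] by simp
  have Ys: "rep (Y w) \<in> L1_maps L X" if "w \<in> space M" for w using measurable_space[OF Y that] by (auto intro: rep_in)
  have m: "{w \<in> space M. distortion L a (rep (Y w)) + C * mdist X a (\<xi> w) < r} \<in> sets M" if "a \<in> D" for a
  proof -
    have a: "a \<in> mspace X" using that D by auto
    have [measurable]: "(\<lambda>w. mdist X a (\<xi> w)) \<in> borel_measurable M"
      using measurable_compose[OF \<xi> mdist_right_measurable[OF a]] .
    have [measurable]: "(\<lambda>w. distortion L a (rep (Y w))) \<in> borel_measurable M"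
      using measurable_compose[OF Y distortion_rep_measurable[OF a]] .
    show ?thesis by measurable
  qed
  have "{w \<in> space M. distortion L (\<xi> w) (rep (Y w)) < r} =
    (\<Union>a\<in>D. {w \<in> space M. distortion L a (rep (Y w)) + C * mdist X a (\<xi> w) < r})" (is "?l = ?r")
  proof (intro set_eqI iffI)
    fix w assume "w \<in> ?l"
    then have w: "w \<in> space M" "distortion L (\<xi> w) (rep (Y w)) < r" by auto
    \<comment> \<open>Moving to \<open>a\<close> and paying the penalty costs \<open>C * e\<close>
      each, together less than the slack; the added 1 covers \<open>C = 0\<close>.\<close>
    define e where "e = (r - distortion L (\<xi> w) (rep (Y w))) / (2 * C + 1)"
    have e: "e > 0" using w C by (simp add: e_def)
    obtain a where a: "a \<in> D" "mdist X a (\<xi> w) < e" using D(3)[OF \<xi>s[OF w(1)] e] by blast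
    have "distortion L a (rep (Y w)) \<le> distortion L (\<xi> w) (rep (Y w)) + C * mdist X a (\<xi> w)"
      unfolding C_def using a D \<xi>s[OF w(1)] Ys[OF w(1)] L by (intro distortion_lipschitz) auto
    moreover have "2 * (C * mdist X a (\<xi> w)) \<le> 2 * C * e" using a C by (simp add: mult_left_mono)
    moreover have "2 * C * e < r - distortion L (\<xi> w) (rep (Y w))"
      using w C by (simp add: e_def divide_simps) 
    ultimately show "w \<in> ?r" using a w by force
  next
    fix w assume "w \<in> ?r"
    then obtain a where a: "a \<in> D" "w \<in> space M" "distortion L a (rep (Y w)) + C * mdist X a (\<xi> w) < r" by auto
    have "distortion L (\<xi> w) (rep (Y w)) \<le> distortion L a (rep (Y w)) + C * mdist X (\<xi> w) a"
      unfolding C_def using a D \<xi>s[OF a(2)] Ys[OF a(2)] L by (intro distortion_lipschitz) auto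
    with a show "w \<in> ?l" by (simp add: mdist_commute)
  qed
  also have "\<dots> \<in> sets M" using D m by (intro sets.countable_UN'') auto
  finally show "?l \<in> sets M" .
qed

end

section \<open>Cells of finite partitions\<close>

text \<open>\<open>cell\<close> is a definite description: covering gives existence, disjointness
  gives uniqueness.\<close>

lemma cell_in:
  assumes "finite_measurable_partition S P" "x \<in> space S"
  shows "cell P x \<in> P" "x \<in> cell P x"
proof -
  obtain A where A: "A \<in> P" "x \<in> A"
    using assms by (auto simp: finite_measurable_partition_def partition_on_def)
  have "disjoint P" using assms(1) by (auto simp: finite_measurable_partition_def partition_on_def)
  have uniq: "B = A" if "B \<in> P \<and> x \<in> B" for B
  proof (rule ccontr)
    assume "B \<noteq> A"
    from disjointD[OF \<open>disjoint P\<close> _ A(1) this] A(2) that show False by blast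
  qed
  have "\<exists>!A. A \<in> P \<and> x \<in> A" 
  proof (rule ex1I)
    show "A \<in> P \<and> x \<in> A" using A by (rule conjI)
    show "B = A" if "B \<in> P \<and> x \<in> B" for B by (rule uniq[OF that])
  qed
  from theI'[OF this] show "cell P x \<in> P" "x \<in> cell P x" by (auto simp: cell_def)
qed

lemma cell_eq:
  assumes "finite_measurable_partition S P" "A \<in> P" "x \<in> A"
  shows "cell P x = A"
proof -
  have "x \<in> space S" using assms by (auto simp: finite_measurable_partition_def partition_on_def)
  note c = cell_in[OF assms(1) this]
  have "disjoint P" using assms(1) by (auto simp: finite_measurable_partition_def partition_on_def)
  show ?thesis
  proof (rule ccontr)
    assume "cell P x \<noteq> A"
    from disjointD[OF \<open>disjoint P\<close> c(1) assms(2) this] c(2) assms(3) show False by blast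
  qed
qed

lemma simple_function_cell:
  assumes P: "finite_measurable_partition S P" and "sets M = sets S"
  shows "simple_function M (cell P)"
  unfolding simple_function_def
proof
  have sp: "space M = space S" using assms(2) by (rule sets_eq_imp_space_eq)
  have im: "cell P ` space M \<subseteq> P" using cell_in(1)[OF P] sp by auto
  then show "finite (cell P ` space M)" using P by (auto simp: finite_measurable_partition_def intro: finite_subset)
  show "\<forall>A\<in>cell P ` space M. cell P -` {A} \<inter> space M \<in> sets M"
  proof
    fix A assume "A \<in> cell P ` space M"
    then have A: "A \<in> P" using im by auto
    have "A \<subseteq> space S" using A P by (auto simp: finite_measurable_partition_def partition_on_def)
    have "cell P -` {A} \<inter> space M = A"
    proof (intro set_eqI iffI)
      fix x assume "x \<in> cell P -` {A} \<inter> space M"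
      then show "x \<in> A" using cell_in(2)[OF P, of x] sp by simp
    next
      fix x assume "x \<in> A"
      then show "x \<in> cell P -` {A} \<inter> space M" using cell_eq[OF P A, of x] \<open>A \<subseteq> space S\<close> sp by auto
    qed
    then show "cell P -` {A} \<inter> space M \<in> sets M"
      using A P assms(2) by (auto simp: finite_measurable_partition_def)
  qed
qed

section \<open>Codes\<close>

context kernel
begin

text \<open>The joint law of source point and code word, written as a density so that its integrals
  reduce to finite sums under \<open>\<mu>\<close>.\<close>

definition channel :: "('x \<times> 'b) measure" where
  "channel = density (\<mu> \<Otimes>\<^sub>M count_space Bs) (\<lambda>p. ennreal (\<kappa> (fst p) (snd p)))"

lemma sets_channel [measurable_cong]: "sets channel = sets (\<mu> \<Otimes>\<^sub>M count_space Bs)"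
  by (simp add: channel_def)

lemma space_channel: "space channel = space \<mu> \<times> Bs"
  by (simp add: channel_def space_pair_measure)

lemma measurable_on_channel:
  assumes "\<And>b. b \<in> Bs \<Longrightarrow> (\<lambda>x. g x b) \<in> measurable \<mu> N"
  shows "(\<lambda>p. g (fst p) (snd p)) \<in> measurable (\<mu> \<Otimes>\<^sub>M count_space Bs) N"
proof (rule measurable_compose_countable'[where f="\<lambda>b p. g (fst p) b" and g=snd and I=Bs])
  show "(\<lambda>p. g (fst p) b) \<in> measurable (\<mu> \<Otimes>\<^sub>M count_space Bs) N" if "b \<in> Bs" for b
    using measurable_compose[OF measurable_fst assms[OF that]] .
qed (use finite_Bs countable_finite in auto)

lemma nn_integral_channel:
  assumes g: "\<And>b. b \<in> Bs \<Longrightarrow> (\<lambda>x. g x b) \<in> borel_measurable \<mu>"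
  shows "(\<integral>\<^sup>+p. g (fst p) (snd p) \<partial>channel) = (\<integral>\<^sup>+x. (\<Sum>b\<in>Bs. ennreal (\<kappa> x b) * g x b) \<partial>\<mu>)"
proof -
  interpret C: sigma_finite_measure "count_space Bs"
    using finite_Bs by (rule sigma_finite_measure_count_space_finite)
  have km: "(\<lambda>p. ennreal (\<kappa> (fst p) (snd p))) \<in> borel_measurable (\<mu> \<Otimes>\<^sub>M count_space Bs)"
    using kernel_measurable by (intro measurable_on_channel[where g="\<lambda>x b. ennreal (\<kappa> x b)"]) auto
  have gm: "(\<lambda>p. g (fst p) (snd p)) \<in> borel_measurable (\<mu> \<Otimes>\<^sub>M count_space Bs)"
    using g by (rule measurable_on_channel)
  have "(\<integral>\<^sup>+p. g (fst p) (snd p) \<partial>channel)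
    = (\<integral>\<^sup>+p. ennreal (\<kappa> (fst p) (snd p)) * g (fst p) (snd p) \<partial>(\<mu> \<Otimes>\<^sub>M count_space Bs))"
    unfolding channel_def using km gm by (rule nn_integral_density)
  also have "\<dots> = (\<integral>\<^sup>+x. \<integral>\<^sup>+b. ennreal (\<kappa> x b) * g x b \<partial>count_space Bs \<partial>\<mu>)"
    by (subst C.nn_integral_fst[symmetric]) (use km gm in auto)
  finally show ?thesis
    by (simp add: nn_integral_count_space_finite finite_Bs)
qed

lemma integral_channel:
  assumes g: "\<And>b. b \<in> Bs \<Longrightarrow> (\<lambda>x. g x b) \<in> borel_measurable \<mu>"
    and g0: "\<And>x b. x \<in> space \<mu> \<Longrightarrow> b \<in> Bs \<Longrightarrow> 0 \<le> g x b"
  shows "(\<integral>p. g (fst p) (snd p) \<partial>channel) = (\<integral>x. (\<Sum>b\<in>Bs. \<kappa> x b * g x b) \<partial>\<mu>)"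
proof -
  have gm: "(\<lambda>p. g (fst p) (snd p)) \<in> borel_measurable channel"
    using measurable_on_channel[where g=g, OF g] by (simp add: channel_def)
  have km: "(\<lambda>x. \<Sum>b\<in>Bs. \<kappa> x b * g x b) \<in> borel_measurable \<mu>"
    using kernel_measurable g by (intro borel_measurable_sum borel_measurable_times)
  have "(\<integral>p. g (fst p) (snd p) \<partial>channel) = enn2real (\<integral>\<^sup>+p. ennreal (g (fst p) (snd p)) \<partial>channel)"
    using gm g0 by (intro integral_eq_nn_integral AE_I2) (auto simp: space_channel)
  also have "(\<integral>\<^sup>+p. ennreal (g (fst p) (snd p)) \<partial>channel) = (\<integral>\<^sup>+x. (\<Sum>b\<in>Bs. ennreal (\<kappa> x b) * ennreal (g x b)) \<partial>\<mu>)"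
    by (rule nn_integral_channel) (use g in auto)
  also have "\<dots> = (\<integral>\<^sup>+x. ennreal (\<Sum>b\<in>Bs. \<kappa> x b * g x b) \<partial>\<mu>)"
    using kernel_nonneg g0 by (intro nn_integral_cong) (simp add: sum_ennreal ennreal_mult flip: ennreal_mult)
  also have "enn2real \<dots> = (\<integral>x. (\<Sum>b\<in>Bs. \<kappa> x b * g x b) \<partial>\<mu>)"
    using km kernel_nonneg g0 by (intro integral_eq_nn_integral[symmetric] AE_I2) (auto intro!: sum_nonneg)
  finally show ?thesis .
qed

lemma emeasure_channel_fst:
  assumes A: "A \<in> sets \<mu>" shows "emeasure channel (fst -` A \<inter> space channel) = emeasure \<mu> A"
proof -
  have Am: "fst -` A \<inter> space channel \<in> sets channel"
    using A by (intro measurable_sets[of fst channel \<mu>]) simp_all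
  have "emeasure channel (fst -` A \<inter> space channel) = (\<integral>\<^sup>+p. indicator A (fst p) \<partial>channel)"
  proof -
    have "(\<integral>\<^sup>+p. indicator A (fst p) \<partial>channel) = (\<integral>\<^sup>+p. indicator (fst -` A \<inter> space channel) p \<partial>channel)"
      by (rule nn_integral_cong) (simp add: indicator_def)
    then show ?thesis using Am by simp
  qed
  also have "\<dots> = (\<integral>\<^sup>+x. (\<Sum>b\<in>Bs. ennreal (\<kappa> x b) * indicator A x) \<partial>\<mu>)"
    by (rule nn_integral_channel[where g="\<lambda>x b. indicator A x"]) (use A in auto)
  also have "\<dots> = (\<integral>\<^sup>+x. indicator A x \<partial>\<mu>)"
  proof (rule nn_integral_cong)
    fix x assume x: "x \<in> space \<mu>"
    have "(\<Sum>b\<in>Bs. ennreal (\<kappa> x b)) = ennreal (\<Sum>b\<in>Bs. \<kappa> x b)"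
      using kernel_nonneg[OF x] by (rule sum_ennreal)
    then show "(\<Sum>b\<in>Bs. ennreal (\<kappa> x b) * indicator A x) = indicator A x"
      by (simp add: kernel_sum[OF x] flip: sum_distrib_right)
  qed
  also have "\<dots> = emeasure \<mu> A" using A by simp
  finally show ?thesis .
qed

lemma prob_space_channel: "prob_space channel"
proof
  have "fst -` space \<mu> \<inter> space channel = space channel" by (auto simp: space_channel)
  then show "emeasure channel (space channel) = 1"
    using emeasure_channel_fst[of "space \<mu>"] by (simp add: emeasure_space_1)
qed

end

text \<open>Under a product law on words the letter at \<open>i\<close> has law \<open>p i\<close>:
  \<open>h\<close> is absorbed into the factor at \<open>i\<close>, and all other factors sum to
  1.\<close>

lemma sum_PiE_prod_marginal:
  fixes p :: "'i \<Rightarrow> 'b \<Rightarrow> real"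
  assumes J: "finite J" "i \<in> J" and B: "finite B" and p: "\<And>j. j \<in> J \<Longrightarrow> (\<Sum>b\<in>B. p j b) = 1"
  shows "(\<Sum>w\<in>PiE J (\<lambda>_. B). (\<Prod>j\<in>J. p j (w j)) * h (w i)) = (\<Sum>b\<in>B. p i b * h b)"
proof -
  have "(\<Sum>w\<in>PiE J (\<lambda>_. B). (\<Prod>j\<in>J. p j (w j)) * h (w i))
    = (\<Sum>w\<in>PiE J (\<lambda>_. B). \<Prod>j\<in>J. p j (w j) * (if j = i then h (w j) else 1))"
    using J by (intro sum.cong refl) (simp add: prod.distrib)
  also have "\<dots> = (\<Prod>j\<in>J. \<Sum>b\<in>B. p j b * (if j = i then h b else 1))"
    using J B by (subst prod_sum_PiE) auto
  also have "\<dots> = (\<Prod>j\<in>J. if j = i then (\<Sum>b\<in>B. p i b * h b) else 1)"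
    using p by (intro prod.cong refl) auto
  also have "\<dots> = (\<Sum>b\<in>B. p i b * h b)" using J by simp
  finally show ?thesis .
qed

section \<open>Codes and the random pairs that they realise\<close>

locale invariant_action = lipschitz_action X T
  for X :: "'a metric" and T :: "real ^ 'n \<Rightarrow> 'a \<Rightarrow> 'a" +
  fixes \<mu> :: "'a measure"
  assumes invariant: "\<mu> \<in> invariant_measures X T"
begin

sublocale \<mu>: prob_space \<mu>
  using invariant by (simp add: invariant_measures_def)

lemma sets_\<mu> [measurable_cong]: "sets \<mu> = sets (metric_borel X)"
  using invariant by (simp add: invariant_measures_def)

lemma space_\<mu> [simp]: "space \<mu> = mspace X"
  using sets_eq_imp_space_eq[OF sets_\<mu>] by simp

lemma distr_T: "distr \<mu> (metric_borel X) (T u) = \<mu>"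
  using invariant by (simp add: invariant_measures_def)

lemma integral_T:
  fixes g :: "'a \<Rightarrow> real"
  assumes "g \<in> borel_measurable (metric_borel X)"
  shows "(\<integral>x. g (T u x) \<partial>\<mu>) = (\<integral>x. g x \<partial>\<mu>)"
proof -
  have "(\<integral>x. g x \<partial>distr \<mu> (metric_borel X) (T u)) = (\<integral>x. g (T u x) \<partial>\<mu>)"
    using T_measurable assms by (intro integral_distr) (simp_all cong: measurable_cong_sets add: sets_\<mu>)
  then show ?thesis by (simp add: distr_T)
qed

text \<open>The weights \<open>q\<close> stand in for the law of the code word. Allowing any
  positive weights of sum at most 1 keeps the notion stable under products and admits uniform
  weights.\<close>

definition is_code :: "real \<Rightarrow> ('a \<Rightarrow> 'b \<Rightarrow> real) \<Rightarrow> ('b \<Rightarrow> real) \<Rightarrow> 'b set \<Rightarrow> ('b \<Rightarrow> real ^ 'n \<Rightarrow> 'a) \<Rightarrow> bool" where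
  "is_code L \<kappa> q Bs y \<longleftrightarrow> kernel \<mu> \<kappa> Bs \<and> (\<forall>b\<in>Bs. 0 < q b) \<and> (\<Sum>b\<in>Bs. q b) \<le> 1 \<and> (\<forall>b\<in>Bs. y b \<in> L1_maps L X)"

text \<open>Mean relative entropy of the rows of the kernel against \<open>q\<close>. It equals the
  mutual information of source and word if \<open>q\<close> is the law of the word.\<close>

definition code_rate :: "('a \<Rightarrow> 'b \<Rightarrow> real) \<Rightarrow> ('b \<Rightarrow> real) \<Rightarrow> 'b set \<Rightarrow> real" where
  "code_rate \<kappa> q Bs = (\<integral>x. (\<Sum>b\<in>Bs. \<kappa> x b * log 2 (\<kappa> x b / q b)) \<partial>\<mu>)"

definition code_distortion :: "real \<Rightarrow> ('a \<Rightarrow> 'b \<Rightarrow> real) \<Rightarrow> 'b set \<Rightarrow> ('b \<Rightarrow> real ^ 'n \<Rightarrow> 'a) \<Rightarrow> real" where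
  "code_distortion L \<kappa> Bs y = (\<integral>x. (\<Sum>b\<in>Bs. \<kappa> x b * distortion L x (y b)) \<partial>\<mu>)"

text \<open>The Donsker--Varadhan bound, with test function \<open>\<phi>\<close>.\<close>

lemma code_rate_lower:
  assumes code: "is_code L \<kappa> q Bs y" and "prob_space P"
    and G: "G \<in> measurable P (metric_borel X)" "distr P (metric_borel X) G = \<mu>"
    and \<phi>: "\<And>b. b \<in> Bs \<Longrightarrow> (\<lambda>\<theta>. \<phi> \<theta> b) \<in> borel_measurable P"
    and bd: "\<And>b \<theta>. b \<in> Bs \<Longrightarrow> \<theta> \<in> space P \<Longrightarrow> \<bar>\<phi> \<theta> b\<bar> \<le> C"
    and one: "\<And>b. b \<in> Bs \<Longrightarrow> (\<integral>\<theta>. 2 powr \<phi> \<theta> b \<partial>P) \<le> 1"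
  shows "(\<integral>\<theta>. (\<Sum>b\<in>Bs. \<kappa> (G \<theta>) b * \<phi> \<theta> b) \<partial>P) \<le> code_rate \<kappa> q Bs"
proof -
  interpret P: prob_space P by fact
  interpret K0: kernel \<mu> \<kappa> Bs using code by (simp add: is_code_def)
  have q: "\<And>b. b \<in> Bs \<Longrightarrow> 0 < q b" "(\<Sum>b\<in>Bs. q b) \<le> 1" using code by (auto simp: is_code_def)
  have Gs: "G \<theta> \<in> mspace X" if "\<theta> \<in> space P" for \<theta> using measurable_space[OF G(1) that] by simp
  have kG: "(\<lambda>\<theta>. \<kappa> (G \<theta>) b) \<in> borel_measurable P" if "b \<in> Bs" for b
    using measurable_compose[OF G(1), of "\<lambda>x. \<kappa> x b"] K0.kernel_measurable[OF that]
    by (simp cong: measurable_cong_sets add: sets_\<mu>)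
  \<comment> \<open>The kernel is pulled back along \<open>G\<close>, so the test function may
    depend on the parameter \<open>\<theta>\<close> and not only on the point
    \<open>G \<theta>\<close>.\<close>
  interpret K: kernel P "\<lambda>\<theta>. \<kappa> (G \<theta>)" Bs
    by unfold_locales (use K0.finite_Bs K0.kernel_nonneg K0.kernel_sum kG Gs in auto)
  have rate: "code_rate \<kappa> q Bs = (\<integral>\<theta>. (\<Sum>b\<in>Bs. \<kappa> (G \<theta>) b * log 2 (\<kappa> (G \<theta>) b / q b)) \<partial>P)"
  proof -
    have "(\<lambda>x. \<Sum>b\<in>Bs. \<kappa> x b * log 2 (\<kappa> x b / q b)) \<in> borel_measurable \<mu>"
      using K0.integrable_kernel_log q by (intro borel_measurable_sum) (auto intro: borel_measurable_integrable)
    then show ?thesis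
      unfolding code_rate_def
      by (subst G(2)[symmetric], intro integral_distr[OF G(1)])
         (simp cong: measurable_cong_sets add: sets_\<mu>)
  qed
  have log: "log 2 (2 powr \<phi> \<theta> b) = \<phi> \<theta> b" for \<theta> b by simp
  show ?thesis
    unfolding rate
  proof (rule K.gibbs[OF q(1), where \<psi>="\<lambda>\<theta> b. 2 powr \<phi> \<theta> b", unfolded log])
    fix b assume b: "b \<in> Bs"
    show "integrable P (\<lambda>\<theta>. \<kappa> (G \<theta>) b * \<phi> \<theta> b)"
      using b by (intro K.integrable_kernel_mult[where C=C] \<phi> bd)
    show "integrable P (\<lambda>\<theta>. 2 powr \<phi> \<theta> b)"
    proof (rule P.integrable_const_bound[where B="2 powr C"])
      show "AE \<theta> in P. norm (2 powr \<phi> \<theta> b) \<le> 2 powr C"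
        using bd[OF b] by (intro AE_I2) (force intro: powr_mono simp: abs_le_iff)
      note [measurable] = \<phi>[OF b]
      show "(\<lambda>\<theta>. 2 powr \<phi> \<theta> b) \<in> borel_measurable P" by measurable
    qed
  next
    have "(\<Sum>b\<in>Bs. q b * (\<integral>\<theta>. 2 powr \<phi> \<theta> b \<partial>P)) \<le> (\<Sum>b\<in>Bs. q b * 1)"
      using one q(1) by (intro sum_mono mult_left_mono) (auto intro: less_imp_le)
    then show "(\<Sum>b\<in>Bs. q b * (\<integral>\<theta>. 2 powr \<phi> \<theta> b \<partial>P)) \<le> 1" using q(2) by simp
  qed auto
qed

text \<open>The Donsker--Varadhan bound for the test function 0; single terms of the sum may well be
  negative.\<close>

lemma code_rate_nonneg:
  assumes "is_code L \<kappa> q Bs y" shows "0 \<le> code_rate \<kappa> q Bs"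
proof -
  have "(\<lambda>x. x) \<in> measurable \<mu> (metric_borel X)" "distr \<mu> (metric_borel X) (\<lambda>x. x) = \<mu>"
    by (simp_all add: sets_\<mu> cong: measurable_cong_sets) (metis distr_id2 sets_\<mu>)
  from code_rate_lower[OF assms \<mu>.prob_space_axioms this, of "\<lambda>_ _. 0" 0]
  show ?thesis by (simp add: \<mu>.prob_space)
qed

text \<open>The channel of the code is itself an admissible random pair, and for every choice of
  partitions its mutual information is bounded by the same rate.\<close>

lemma rate_distortion_L_le_code_rate:
  assumes L: "0 < L" and code: "is_code L \<kappa> q Bs y"
    and dist: "code_distortion L \<kappa> Bs y < \<epsilon> * L ^ CARD('n)"
  shows "rate_distortion_L X T \<mu> L \<epsilon> \<le> ereal (code_rate \<kappa> q Bs)"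
proof -
  interpret kernel \<mu> \<kappa> Bs using code by (simp add: is_code_def)
  interpret channel: prob_space channel by (rule prob_space_channel)
  have q: "\<And>b. b \<in> Bs \<Longrightarrow> 0 < q b" "(\<Sum>b\<in>Bs. q b) \<le> 1" and y: "\<And>b. b \<in> Bs \<Longrightarrow> y b \<in> L1_maps L X"
    using code by (auto simp: is_code_def)
  let ?X = "metric_borel X" and ?Y = "metric_borel (L1_space L X :: (real ^ 'n \<Rightarrow> 'a) set metric)"
  define \<Phi> :: "'a \<times> 'b \<Rightarrow> 'a \<times> (real ^ 'n \<Rightarrow> 'a) set" where "\<Phi> p = (fst p, ae_class L (y (snd p)))" for p
  have fstm: "fst \<in> measurable channel ?X"
    by (simp cong: measurable_cong_sets add: sets_channel sets_\<mu>[symmetric])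
  have sndm: "(\<lambda>p. ae_class L (y (snd p))) \<in> measurable channel ?Y"
  proof -
    have "(\<lambda>b. ae_class L (y b)) \<in> measurable (count_space Bs) ?Y"
      using y by (auto intro!: ae_class_in)
    from measurable_compose[OF measurable_snd this] show ?thesis
      by (simp cong: measurable_cong_sets add: sets_channel)
  qed
  have \<Phi>m: "\<Phi> \<in> measurable channel (?X \<Otimes>\<^sub>M ?Y)"
    unfolding \<Phi>_def using fstm sndm by (rule measurable_Pair)
  \<comment> \<open>\<open>rate_distortion_L\<close> ranges over measures on pairs of a point and a
    class, so the channel is transported to that type.\<close>
  define M where "M = distr channel (?X \<Otimes>\<^sub>M ?Y) \<Phi>"
  have "prob_space M" unfolding M_def using \<Phi>m by (rule channel.prob_space_distr)
  have M1: "fst \<in> measurable M ?X" and M2: "snd \<in> measurable M ?Y" by (simp_all add: M_def)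
  have law: "distr M ?X fst = \<mu>"
  proof (rule measure_eqI)
    fix A assume "A \<in> sets (distr M ?X fst)"
    then have A: "A \<in> sets ?X" by simp
    have "emeasure (distr M ?X fst) A = emeasure (distr channel ?X (fst \<circ> \<Phi>)) A"
      unfolding M_def using \<Phi>m by (subst distr_distr) simp_all
    also have "\<dots> = emeasure channel (fst -` A \<inter> space channel)"
      using fstm A by (subst emeasure_distr) (simp_all add: \<Phi>_def o_def)
    also have "\<dots> = emeasure \<mu> A" using A by (intro emeasure_channel_fst) (simp add: sets_\<mu>)
    finally show "emeasure (distr M ?X fst) A = emeasure \<mu> A" .
  qed (simp add: sets_\<mu>)
  have dm: "(\<lambda>x. distortion L x (y b)) \<in> borel_measurable \<mu>" if "b \<in> Bs" for b
    using distortion_measurable[of L "y b"] y[OF that] L by (simp cong: measurable_cong_sets add: sets_\<mu>)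
  have "prob_space.expectation M (\<lambda>w. 1 / L ^ CARD('n) * distortion L (fst w) (rep (snd w)))
    = (\<integral>p. 1 / L ^ CARD('n) * distortion L (fst (\<Phi> p)) (rep (snd (\<Phi> p))) \<partial>channel)"
    unfolding M_def
  proof (rule integral_distr[OF \<Phi>m])
    have "(\<lambda>w. distortion L (fst w) (rep (snd w))) \<in> borel_measurable (?X \<Otimes>\<^sub>M ?Y)"
      using L by (intro distortion_joint_measurable) simp_all
    then show "(\<lambda>w. 1 / L ^ CARD('n) * distortion L (fst w) (rep (snd w))) \<in> borel_measurable (?X \<Otimes>\<^sub>M ?Y)"
      by simp
  qed
  \<comment> \<open>The representative chosen by \<open>rep\<close> differs from the code word on a
    null set only, which the distortion does not see.\<close>
  also have "\<dots> = (\<integral>p. 1 / L ^ CARD('n) * distortion L (fst p) (y (snd p)) \<partial>channel)"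
  proof (intro Bochner_Integration.integral_cong refl)
    fix p assume "p \<in> space channel"
    then have p: "fst p \<in> mspace X" "snd p \<in> Bs" by (auto simp: space_channel)
    have "distortion L (fst p) (rep (ae_class L (y (snd p)))) = distortion L (fst p) (y (snd p))"
      using p y by (intro distortion_cong_AE rep_ae_class rep_in(2) ae_class_in)
    then show "1 / L ^ CARD('n) * distortion L (fst (\<Phi> p)) (rep (snd (\<Phi> p))) =
       1 / L ^ CARD('n) * distortion L (fst p) (y (snd p))" by (simp add: \<Phi>_def)
  qed
  also have "\<dots> = 1 / L ^ CARD('n) * code_distortion L \<kappa> Bs y"
    using integral_channel[of "\<lambda>x b. distortion L x (y b)"] dm
    by (simp add: code_distortion_def distortion_nonneg)
  also have "\<dots> < \<epsilon>" using dist L by (simp add: field_simps)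
  finally have ex: "prob_space.expectation M
      (\<lambda>w. 1 / L ^ CARD('n) * (LINT u|cube_measure L. mdist X (T u (fst w)) (rep (snd w) u))) < \<epsilon>"
    by (simp add: distortion_def)
  have "mutual_info M ?X ?Y fst snd \<le> ereal (code_rate \<kappa> q Bs)"
    unfolding mutual_info_def
  proof (rule SUP_least, clarify)
    fix P Q assume P: "finite_measurable_partition ?X P" and Q: "finite_measurable_partition ?Y Q"
    let ?A = "cell P \<circ> fst" and ?B = "cell Q \<circ> snd"
    have sP: "simple_function ?X (cell P)" and sQ: "simple_function ?Y (cell Q)"
      by (rule simple_function_cell[OF P refl], rule simple_function_cell[OF Q refl])
    have sA: "simple_function M ?A" unfolding comp_def using M1 sP by (rule simple_function_comp)
    have sB: "simple_function M ?B" unfolding comp_def using M2 sQ by (rule simple_function_comp)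
    have sF: "simple_function \<mu> (cell P)" using P sets_\<mu> by (rule simple_function_cell)
    \<comment> \<open>The reference weights sit on the index of the code word, so the right-hand
      side is independent of the partitions.\<close>
    have "finite_mutual_info M ?A ?B \<le> (\<integral>x. (\<Sum>w\<in>Bs. \<kappa> x w * log 2 (\<kappa> x w / q w)) \<partial>\<mu>)"
    proof (rule finite_mutual_info_le[OF \<open>prob_space M\<close> sA sB sF q, where G="\<lambda>b. cell Q (ae_class L (y b))"])
      fix a c
      have [measurable]: "cell P \<in> measurable ?X (count_space UNIV)" "cell Q \<in> measurable ?Y (count_space UNIV)"
        "cell P \<in> measurable \<mu> (count_space UNIV)"
        using sP sQ sF by (auto intro: measurable_simple_function)
      have E: "{w \<in> space (?X \<Otimes>\<^sub>M ?Y). cell P (fst w) = a \<and> cell Q (snd w) = c} \<in> sets (?X \<Otimes>\<^sub>M ?Y)"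
        by measurable
      let ?g = "\<lambda>x b. if cell P x = a \<and> cell Q (ae_class L (y b)) = c then 1 else 0 :: real"
      have "measure M {w \<in> space M. ?A w = a \<and> ?B w = c}
        = measure channel (\<Phi> -` {w \<in> space (?X \<Otimes>\<^sub>M ?Y). cell P (fst w) = a \<and> cell Q (snd w) = c} \<inter> space channel)"
        using measure_distr[OF \<Phi>m E] by (simp add: M_def)
      also have "\<dots> = (\<integral>p. indicator (\<Phi> -` {w \<in> space (?X \<Otimes>\<^sub>M ?Y). cell P (fst w) = a \<and> cell Q (snd w) = c} \<inter> space channel) p \<partial>channel)"
        using measurable_sets[OF \<Phi>m E] by simp
      also have "\<dots> = (\<integral>p. ?g (fst p) (snd p) \<partial>channel)"
        using measurable_space[OF \<Phi>m]
        by (intro Bochner_Integration.integral_cong refl) (auto simp: indicator_def \<Phi>_def)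
      also have "\<dots> = (\<integral>x. (\<Sum>b\<in>Bs. \<kappa> x b * ?g x b) \<partial>\<mu>)"
        by (rule integral_channel) auto
      also have "\<dots> = (\<integral>x. (\<Sum>b\<in>Bs. if cell P x = a \<and> cell Q (ae_class L (y b)) = c then \<kappa> x b else 0) \<partial>\<mu>)"
        by (intro Bochner_Integration.integral_cong refl sum.cong) auto
      finally show "measure M {w \<in> space M. ?A w = a \<and> ?B w = c} = \<dots>" .
    qed
    then show "ereal (finite_mutual_info M (cell P \<circ> fst) (cell Q \<circ> snd)) \<le> ereal (code_rate \<kappa> q Bs)"
      by (simp add: code_rate_def)
  qed
  then show ?thesis
    unfolding rate_distortion_L_def
    by (intro Inf_lower2[of "mutual_info M ?X ?Y fst snd"])
       (use \<open>prob_space M\<close> M1 M2 law ex in blast)+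
qed

end

section \<open>Discretising a random pair into a finite code\<close>

text \<open>Numbering the net and taking the least admissible index makes the choice of a nearby
  point measurable.\<close>

lemma (in compact_metric) finite_net:
  assumes "0 < e"
  shows "\<exists>idx (n :: nat) c. idx \<in> measurable (metric_borel X) (count_space UNIV) \<and>
    (\<forall>x\<in>mspace X. idx x < n \<and> mdist X (c (idx x)) x < e) \<and> (\<forall>i<n. c i \<in> mspace X)"
proof -
  obtain K where K: "finite K" "K \<subseteq> mspace X" "\<And>x. x \<in> mspace X \<Longrightarrow> \<exists>a\<in>K. mdist X a x < e"
    using totally_bounded[OF assms] by metis
  obtain ks where ks: "set ks = K" using K(1) finite_list by blast
  define idx where "idx x = (LEAST i. i < length ks \<and> mdist X (ks ! i) x < e)" for x
  have idx: "idx x < length ks \<and> mdist X (ks ! idx x) x < e" if x: "x \<in> mspace X" for x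
    unfolding idx_def
  proof (rule LeastI_ex)
    obtain a where "a \<in> K" "mdist X a x < e" using K(3)[OF x] by blast
    then show "\<exists>i. i < length ks \<and> mdist X (ks ! i) x < e" using ks by (metis in_set_conv_nth)
  qed
  show ?thesis
  proof (intro exI conjI)
    show "idx \<in> measurable (metric_borel X) (count_space UNIV)"
      unfolding idx_def
    proof (rule measurable_Least)
      fix i
      show "Measurable.pred (metric_borel X) (\<lambda>x. i < length ks \<and> mdist X (ks ! i) x < e)"
      proof (cases "i < length ks")
        case True
        then have "ks ! i \<in> mspace X" using K(2) ks nth_mem by blast
        then have [measurable]: "(\<lambda>x. mdist X (ks ! i) x) \<in> borel_measurable (metric_borel X)"
          by (rule mdist_right_measurable)
        show ?thesis by measurable
      qed simp
    qed
    show "\<forall>x\<in>mspace X. idx x < length ks \<and> mdist X (ks ! idx x) x < e" using idx by blast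
    show "\<forall>i<length ks. ks ! i \<in> mspace X" using K(2) ks nth_mem by blast
  qed
qed

definition fibres :: "'a measure \<Rightarrow> ('a \<Rightarrow> 'b) \<Rightarrow> 'a set set" where
  "fibres S h = (\<lambda>v. h -` {v} \<inter> space S) ` h ` space S"

lemma finite_measurable_partition_fibres:
  assumes "simple_function S h" shows "finite_measurable_partition S (fibres S h)"
  unfolding finite_measurable_partition_def partition_on_def
proof (intro conjI)
  show "finite (fibres S h)" using simple_functionD(1)[OF assms] by (simp add: fibres_def)
  show "fibres S h \<subseteq> sets S" using simple_functionD(2)[OF assms] by (auto simp: fibres_def)
  show "disjoint (fibres S h)" by (auto simp: fibres_def disjoint_def)
qed (auto simp: fibres_def)

lemma fibresD: "b \<in> fibres S h \<Longrightarrow> x \<in> b \<Longrightarrow> x \<in> space S"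
  "b \<in> fibres S h \<Longrightarrow> x \<in> b \<Longrightarrow> x' \<in> b \<Longrightarrow> h x = h x'"
  by (auto simp: fibres_def)

context invariant_action
begin

lemma measure_mspace [simp]: "measure \<mu> (mspace X) = 1"
  using \<mu>.prob_space by simp

text \<open>The space of maps is not compact, so
  the partition on that side only records, up to rounding, the distortions from finitely many points.\<close>

lemma code_exists:
  assumes L: "0 < L" and lt: "rate_distortion_L X T \<mu> L \<epsilon> < ereal r"
  shows "\<exists>\<kappa> q (Bs :: (real ^ 'n \<Rightarrow> 'a) set set set) y. is_code L \<kappa> q Bs y \<and> code_rate \<kappa> q Bs \<le> r \<and>
           code_distortion L \<kappa> Bs y < \<epsilon> * L ^ CARD('n)"
proof -
  let ?X = "metric_borel X" and ?Y = "metric_borel (L1_space L X :: (real ^ 'n \<Rightarrow> 'a) set metric)"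
  obtain M :: "('a \<times> (real ^ 'n \<Rightarrow> 'a) set) measure" and \<xi> Y where M: "prob_space M"
    and \<xi>: "\<xi> \<in> measurable M ?X" and law: "distr M ?X \<xi> = \<mu>" and Y: "Y \<in> measurable M ?Y"
    and ex: "prob_space.expectation M
              (\<lambda>w. 1 / L ^ CARD('n) * (LINT u|cube_measure L. mdist X (T u (\<xi> w)) (rep (Y w) u))) < \<epsilon>"
    and mi: "mutual_info M ?X ?Y \<xi> Y < ereal r"
    using lt unfolding rate_distortion_L_def Inf_less_iff by blast
  interpret M: prob_space M by fact
  define D where "D x f = distortion L x f" for x f
  define E where "E = (\<integral>w. D (\<xi> w) (rep (Y w)) \<partial>M)"
  have Ld: "L ^ CARD('n) > 0" using L by simp
  have E: "E < \<epsilon> * L ^ CARD('n)"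
    using ex Ld by (simp add: E_def D_def distortion_def field_simps)
  \<comment> \<open>The slack is cut into six parts, of which four are spent: one on replacing the
    source point by a sample of its cell, three on comparing with the given pair.\<close>
  define lam where "lam = (\<epsilon> * L ^ CARD('n) - E) / 6"
  have lam: "lam > 0" using E by (simp add: lam_def)
  define C where "C = L ^ CARD('n) * exp (real CARD('n) * L)"
  have C: "C > 0" using Ld by (simp add: C_def)
  \<comment> \<open>Mesh at which moving to a net point changes a distortion by at most
    \<open>lam / 2\<close>.\<close>
  define e where "e = lam / (2 * C)"
  have e: "e > 0" "C * e = lam / 2" using lam C by (simp_all add: e_def)
  obtain idx and n :: nat and c where idxm: "idx \<in> measurable ?X (count_space UNIV)"
    and idx: "\<And>x. x \<in> mspace X \<Longrightarrow> idx x < n" "\<And>x. x \<in> mspace X \<Longrightarrow> mdist X (c (idx x)) x < e"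
    and c: "\<And>i. i < n \<Longrightarrow> c i \<in> mspace X"
    using finite_net[OF e(1)] by blast
  have D_lip: "D x f \<le> D x' f + C * mdist X x x'" if "x \<in> mspace X" "x' \<in> mspace X" "f \<in> L1_maps L X" for x x' f
    unfolding D_def C_def using L that by (intro distortion_lipschitz) auto
  have D_c: "D x f \<le> D (c (idx x)) f + lam / 2" "D (c (idx x)) f \<le> D x f + lam / 2"
    if x: "x \<in> mspace X" and f: "f \<in> L1_maps L X" for x f
  proof -
    have ci: "c (idx x) \<in> mspace X" using idx(1)[OF x] c by blast
    have "C * mdist X (c (idx x)) x \<le> C * e" using idx(2)[OF x] C by (intro mult_left_mono) auto
    with D_lip[OF x ci f] D_lip[OF ci x f] e(2)
    show "D x f \<le> D (c (idx x)) f + lam / 2" "D (c (idx x)) f \<le> D x f + lam / 2"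
      by (simp_all add: mdist_commute)
  qed
  have D_bd: "0 \<le> D x f" "D x f \<le> L ^ CARD('n) * diam" if "x \<in> mspace X" "f \<in> L1_maps L X" for x f
    using that L by (auto simp: D_def distortion_nonneg intro: distortion_le_diam)
  have sidx: "simple_function ?X idx"
  proof (subst simple_function_eq_measurable)
    have "idx ` space ?X \<subseteq> {..<n}" using idx(1) by auto
    then show "finite (idx ` space ?X) \<and> idx \<in> measurable ?X (count_space UNIV)"
      using idxm finite_subset by blast
  qed
  \<comment> \<open>Rounding at resolution \<open>lam\<close>, bounded because distortions are; the
    restriction to indices below \<open>n\<close> makes the range a finite set of functions.\<close>
  define h where "h F = restrict (\<lambda>i. \<lfloor>D (c i) (rep F) / lam\<rfloor>) {..<n}" for F
  have repY: "rep F \<in> L1_maps L X" if "F \<in> space ?Y" for F using that by (simp add: rep_in)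
  have sh: "simple_function ?Y h"
    unfolding simple_function_def
  proof
    have "h ` space ?Y \<subseteq> PiE {..<n} (\<lambda>_. {0..\<lfloor>L ^ CARD('n) * diam / lam\<rfloor>})"
    proof (rule image_subsetI)
      fix F assume F: "F \<in> space ?Y"
      have "\<lfloor>D (c i) (rep F) / lam\<rfloor> \<in> {0..\<lfloor>L ^ CARD('n) * diam / lam\<rfloor>}" if "i < n" for i
        using lam D_bd[OF c[OF that] repY[OF F]] by (simp add: floor_mono divide_right_mono)
      then show "h F \<in> PiE {..<n} (\<lambda>_. {0..\<lfloor>L ^ CARD('n) * diam / lam\<rfloor>})"
        unfolding h_def restrict_PiE_iff by simp
    qed
    then show "finite (h ` space ?Y)" by (rule finite_subset) (intro finite_PiE, auto)
    show "\<forall>m\<in>h ` space ?Y. h -` {m} \<inter> space ?Y \<in> sets ?Y"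
    proof
      fix m assume "m \<in> h ` space ?Y"
      then obtain F0 where m: "m = h F0" by blast
      have "h -` {m} \<inter> space ?Y = {F \<in> space ?Y. \<forall>i\<in>{..<n}. \<lfloor>D (c i) (rep F) / lam\<rfloor> = m i}"
        unfolding m by (auto simp: h_def fun_eq_iff restrict_def) metis
      also have "\<dots> \<in> sets ?Y"
      proof (rule sets.sets_Collect_finite_All)
        fix i assume "i \<in> {..<n}"
        then have [measurable]: "(\<lambda>F. D (c i) (rep F)) \<in> borel_measurable ?Y"
          unfolding D_def using c by (intro distortion_rep_measurable) auto
        show "{F \<in> space ?Y. \<lfloor>D (c i) (rep F) / lam\<rfloor> = m i} \<in> sets ?Y" by measurable
      qed simp
      finally show "h -` {m} \<inter> space ?Y \<in> sets ?Y" .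
    qed
  qed
  define \<alpha> where "\<alpha> = fibres ?X idx"
  define Q where "Q = fibres ?Y h"
  have \<alpha>: "finite_measurable_partition ?X \<alpha>" and Q: "finite_measurable_partition ?Y Q"
    unfolding \<alpha>_def Q_def using sidx sh by (auto intro: finite_measurable_partition_fibres)
  have fin: "finite \<alpha>" "finite Q" using \<alpha> Q by (auto simp: finite_measurable_partition_def)
  have s\<alpha>: "simple_function ?X (cell \<alpha>)" and sQ: "simple_function ?Y (cell Q)" and s\<mu>: "simple_function \<mu> (cell \<alpha>)"
    by (rule simple_function_cell[OF \<alpha> refl], rule simple_function_cell[OF Q refl], rule simple_function_cell[OF \<alpha> sets_\<mu>])
  let ?A = "cell \<alpha> \<circ> \<xi>" and ?B = "cell Q \<circ> Y"
  have sA: "simple_function M ?A" unfolding comp_def using \<xi> s\<alpha> by (rule simple_function_comp)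
  have sB: "simple_function M ?B" unfolding comp_def using Y sQ by (rule simple_function_comp)
  have \<xi>s: "\<xi> w \<in> mspace X" and Ys: "Y w \<in> space ?Y" if "w \<in> space M" for w
    using measurable_space[OF \<xi> that] measurable_space[OF Y that] by auto
  have A\<alpha>: "?A ` space M \<subseteq> \<alpha>" and BQ: "?B ` space M \<subseteq> Q" and C\<alpha>: "cell \<alpha> ` space \<mu> \<subseteq> \<alpha>"
    using cell_in(1)[OF \<alpha>] cell_in(1)[OF Q] \<xi>s Ys by auto
  define P where "P a b = measure M {w \<in> space M. ?A w = a \<and> ?B w = b}" for a b
  define PA where "PA a = measure M {w \<in> space M. ?A w = a}" for a
  define PB where "PB b = measure M {w \<in> space M. ?B w = b}" for b
  have PA: "PA a = (\<Sum>b\<in>Q. P a b)" for a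
    unfolding PA_def P_def by (rule M.measure_eq_sum_joint[OF sA sB fin(2) BQ])
  have PA\<mu>: "PA a = measure \<mu> {x \<in> space \<mu>. cell \<alpha> x = a}" for a
  proof -
    have [measurable]: "cell \<alpha> \<in> measurable ?X (count_space UNIV)" using s\<alpha> by (rule measurable_simple_function)
    have "{x \<in> space ?X. cell \<alpha> x = a} \<in> sets ?X" by measurable
    from measure_distr[OF \<xi> this] \<xi>s show ?thesis
      by (auto simp: law PA_def intro!: arg_cong[where f="measure M"])
  qed
  have [measurable]: "(\<lambda>w. cell \<alpha> (\<xi> w)) \<in> measurable M (count_space UNIV)" "(\<lambda>w. cell Q (Y w)) \<in> measurable M (count_space UNIV)"
    using measurable_simple_function[OF sA] measurable_simple_function[OF sB] by (simp_all add: comp_def)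
  have ev: "{w \<in> space M. cell \<alpha> (\<xi> w) = a} \<in> sets M" "{w \<in> space M. cell Q (Y w) = b} \<in> sets M" for a b
    by measurable
  have P0: "0 \<le> P a b" "0 \<le> PA a" "0 \<le> PB b" and PleA: "P a b \<le> PA a" and PleB: "P a b \<le> PB b" for a b
    unfolding P_def PA_def PB_def using ev by (auto intro!: M.finite_measure_mono)
  have PB1: "(\<Sum>b\<in>Q. PB b) = 1"
    using M.integral_comp_simple_function(1)[OF sB fin(2) BQ, of "\<lambda>_. 1"] by (simp add: PB_def M.prob_space)
  \<comment> \<open>Cells of probability 0 are dropped, because reference weights have to be
    positive.\<close>
  define Bs where "Bs = {b \<in> Q. 0 < PB b}"
  have Bs: "finite Bs" "Bs \<subseteq> Q" using fin by (auto simp: Bs_def)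
  have sumBs: "(\<Sum>b\<in>Bs. f b) = (\<Sum>b\<in>Q. f b)" if "\<And>b. b \<in> Q \<Longrightarrow> PB b = 0 \<Longrightarrow> f b = 0" for f :: "_ \<Rightarrow> real"
  proof (rule sum.mono_neutral_left)
    show "\<forall>i\<in>Q - Bs. f i = 0"
    proof
      fix i assume "i \<in> Q - Bs"
      then have "i \<in> Q" "PB i = 0" using P0(3)[of i] by (auto simp: Bs_def)
      then show "f i = 0" by (rule that)
    qed
  qed (use fin Bs in auto)
  have P_PB0: "P a b = 0" if "PB b = 0" for a b using PleB[of a b] P0(1)[of a b] that by simp
  \<comment> \<open>Conditional law of the second cell given the first. On a cell of measure 0 the
    marginal is the default, so that every row still sums to 1.\<close>
  define k where "k a b = (if PA a = 0 then PB b else P a b / PA a)" for a b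
  have PAk: "PA a * k a b = P a b" for a b
    using PleA[of a b] P0(1)[of a b] by (simp add: k_def)
  define \<kappa> where "\<kappa> x b = k (cell \<alpha> x) b" for x b
  \<comment> \<open>The code word of a cell is an arbitrary map in it; \<open>nearF\<close> shows
    that the choice costs little.\<close>
  define y :: "(real ^ 'n \<Rightarrow> 'a) set set \<Rightarrow> real ^ 'n \<Rightarrow> 'a" where "y b = rep (SOME F. F \<in> b)" for b
  have bsp: "b \<subseteq> space ?Y" and bne: "b \<noteq> {}" if "b \<in> Q" for b
    using Q that by (auto simp: finite_measurable_partition_def partition_on_def)
  have someb: "(SOME F. F \<in> b) \<in> b" if "b \<in> Q" for b
    using bne[OF that] by (simp add: some_in_eq)
  have y: "y b \<in> L1_maps L X" if "b \<in> Q" for b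
    unfolding y_def using someb[OF that] bsp[OF that] by (intro repY) auto
  have ksum: "(\<Sum>b\<in>Bs. k a b) = 1" for a
  proof (cases "PA a = 0")
    case True
    then show ?thesis using sumBs[of PB] PB1 by (simp add: k_def)
  next
    case False
    then have "(\<Sum>b\<in>Bs. k a b) = (\<Sum>b\<in>Bs. P a b) / PA a" by (simp add: k_def sum_divide_distrib)
    also have "\<dots> = 1" using sumBs[of "P a"] P_PB0 PA[of a] False by simp
    finally show ?thesis .
  qed
  have kern: "kernel \<mu> \<kappa> Bs"
  proof
    show "(\<lambda>x. \<kappa> x b) \<in> borel_measurable \<mu>" for b
      unfolding \<kappa>_def by (rule borel_measurable_integrable) (rule \<mu>.integral_comp_simple_function(2)[OF s\<mu> fin(1) C\<alpha>])
    show "0 \<le> \<kappa> x b" for x b unfolding \<kappa>_def k_def using P0 by simp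
  qed (use Bs ksum in \<open>auto simp: \<kappa>_def\<close>)
  interpret K: kernel \<mu> \<kappa> Bs by (rule kern)
  have code: "is_code L \<kappa> PB Bs y"
    unfolding is_code_def using kern Bs y sumBs[of PB] PB1 by (auto simp: Bs_def)
  \<comment> \<open>Functions that depend on the cells alone integrate to sums against the joint law
    \<open>P\<close>. Rate and discretised distortion are both of this kind.\<close>
  have master: "(\<integral>x. (\<Sum>b\<in>Bs. \<kappa> x b * g (cell \<alpha> x) b) \<partial>\<mu>) = (\<Sum>a\<in>\<alpha>. \<Sum>b\<in>Q. P a b * g a b)" for g
  proof -
    have "(\<integral>x. (\<Sum>b\<in>Bs. \<kappa> x b * g (cell \<alpha> x) b) \<partial>\<mu>) = (\<Sum>a\<in>\<alpha>. PA a * (\<Sum>b\<in>Bs. k a b * g a b))"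
      unfolding \<kappa>_def PA\<mu> by (rule \<mu>.integral_comp_simple_function(1)[OF s\<mu> fin(1) C\<alpha>])
    also have "\<dots> = (\<Sum>a\<in>\<alpha>. \<Sum>b\<in>Bs. P a b * g a b)"
      by (simp add: sum_distrib_left PAk flip: mult.assoc)
    also have "\<dots> = (\<Sum>a\<in>\<alpha>. \<Sum>b\<in>Q. P a b * g a b)"
      by (intro sum.cong refl sumBs) (simp add: P_PB0)
    finally show ?thesis .
  qed
  \<comment> \<open>Here the reference weights are the law of the second cell, so the rate is
    exactly the mutual information of the discretised pair and lies below the supremum.\<close>
  have rate: "code_rate \<kappa> PB Bs = finite_mutual_info M ?A ?B"
  proof -
    have "code_rate \<kappa> PB Bs = (\<Sum>a\<in>\<alpha>. \<Sum>b\<in>Q. P a b * log 2 (k a b / PB b))"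
      unfolding code_rate_def using master[of "\<lambda>a b. log 2 (k a b / PB b)"] by (simp add: \<kappa>_def)
    also have "\<dots> = (\<Sum>a\<in>\<alpha>. \<Sum>b\<in>Q. P a b * log 2 (P a b / (PA a * PB b)))"
    proof (intro sum.cong refl)
      fix a b
      show "P a b * log 2 (k a b / PB b) = P a b * log 2 (P a b / (PA a * PB b))"
      proof (cases "P a b = 0")
        case False
        then have "PA a \<noteq> 0" using PleA[of a b] P0(1)[of a b] by linarith
        then show ?thesis by (simp add: k_def)
      qed simp
    qed
    also have "\<dots> = finite_mutual_info M ?A ?B"
      by (subst finite_mutual_info_eq[OF M sA sB fin(1) A\<alpha> fin(2) BQ]) (simp add: P_def PA_def PB_def)
    finally show ?thesis .
  qed
  have "ereal (finite_mutual_info M ?A ?B) \<le> mutual_info M ?X ?Y \<xi> Y"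
    unfolding mutual_info_def by (rule SUP_upper2[of "(\<alpha>, Q)"]) (use \<alpha> Q in auto)
  from le_less_trans[OF this mi] have rate_le: "code_rate \<kappa> PB Bs \<le> r" by (simp add: rate)
  define g where "g a b = D (SOME x. x \<in> a) (y b)" for a b
  have near: "D x f \<le> D x' f + lam" if a: "a \<in> \<alpha>" "x \<in> a" "x' \<in> a" and f: "f \<in> L1_maps L X" for a x x' f
  proof -
    have aF: "a \<in> fibres ?X idx" using a(1) by (simp add: \<alpha>_def)
    have x: "x \<in> mspace X" "x' \<in> mspace X" "idx x = idx x'"
      using fibresD(1)[OF aF a(2)] fibresD(1)[OF aF a(3)] fibresD(2)[OF aF a(2,3)] by simp_all
    show ?thesis using D_c(1)[OF x(1) f] D_c(2)[OF x(2) f] x(3) by simp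
  qed
  \<comment> \<open>Half of \<open>lam\<close> for moving \<open>x\<close> to its net point,
    \<open>lam\<close> for the rounding in \<open>h\<close>, and half of \<open>lam\<close> for
    moving back.\<close>
  have nearF: "D x (y b) \<le> D x (rep F) + 2 * lam" if x: "x \<in> mspace X" and b: "b \<in> Q" "F \<in> b" for x b F
  proof -
    have F: "rep F \<in> L1_maps L X" using b bsp[OF b(1)] by (intro repY) auto
    have "h (SOME F. F \<in> b) = h F"
      using b(1) by (intro fibresD(2)[OF _ someb[OF b(1)] b(2)]) (simp add: Q_def)
    then have "h (SOME F. F \<in> b) (idx x) = h F (idx x)" by simp
    then have fl: "\<lfloor>D (c (idx x)) (y b) / lam\<rfloor> = \<lfloor>D (c (idx x)) (rep F) / lam\<rfloor>"
      using idx(1)[OF x] by (simp add: h_def y_def)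
    have "D (c (idx x)) (y b) / lam < of_int \<lfloor>D (c (idx x)) (rep F) / lam\<rfloor> + 1"
      using fl by linarith
    also have "\<dots> \<le> D (c (idx x)) (rep F) / lam + 1" by simp
    finally have "D (c (idx x)) (y b) \<le> D (c (idx x)) (rep F) + lam" using lam by (simp add: field_simps)
    then show ?thesis using D_c(1)[OF x y[OF b(1)]] D_c(2)[OF x F] by simp
  qed
  have cellin: "x \<in> cell \<alpha> x" "cell \<alpha> x \<in> \<alpha>" "(SOME z. z \<in> cell \<alpha> x) \<in> cell \<alpha> x" if "x \<in> mspace X" for x
    using cell_in[OF \<alpha>, of x] that someI[of "\<lambda>z. z \<in> cell \<alpha> x" x] by simp_all
  have dist1: "code_distortion L \<kappa> Bs y \<le> (\<Sum>a\<in>\<alpha>. \<Sum>b\<in>Q. P a b * g a b) + lam"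
  proof -
    have sint: "integrable \<mu> (\<lambda>x. \<kappa> x b * g (cell \<alpha> x) b)" for b
      unfolding \<kappa>_def by (rule \<mu>.integral_comp_simple_function(2)[OF s\<mu> fin(1) C\<alpha>])
    have "code_distortion L \<kappa> Bs y \<le> (\<integral>x. (\<Sum>b\<in>Bs. \<kappa> x b * g (cell \<alpha> x) b) + lam \<partial>\<mu>)"
      unfolding code_distortion_def
    proof (rule integral_mono)
      show "integrable \<mu> (\<lambda>x. \<Sum>b\<in>Bs. \<kappa> x b * distortion L x (y b))"
      proof (rule Bochner_Integration.integrable_sum)
        fix b assume b: "b \<in> Bs"
        then have yb: "y b \<in> L1_maps L X" using Bs y by auto
        show "integrable \<mu> (\<lambda>x. \<kappa> x b * distortion L x (y b))"
        proof (rule K.integrable_kernel_mult[OF b, where C="L ^ CARD('n) * diam"])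
          show "(\<lambda>x. distortion L x (y b)) \<in> borel_measurable \<mu>"
            using distortion_measurable[OF _ yb] L by (simp cong: measurable_cong_sets add: sets_\<mu>)
        qed (use D_bd[OF _ yb] in \<open>auto simp: D_def\<close>)
      qed
      show "integrable \<mu> (\<lambda>x. (\<Sum>b\<in>Bs. \<kappa> x b * g (cell \<alpha> x) b) + lam)"
        using sint by (intro Bochner_Integration.integrable_add Bochner_Integration.integrable_sum) auto
      fix x assume "x \<in> space \<mu>"
      then have x: "x \<in> mspace X" by simp
      have "(\<Sum>b\<in>Bs. \<kappa> x b * distortion L x (y b)) \<le> (\<Sum>b\<in>Bs. \<kappa> x b * (g (cell \<alpha> x) b + lam))"
      proof (rule sum_mono)
        fix b assume b: "b \<in> Bs"
        then have "y b \<in> L1_maps L X" using Bs y by auto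
        from near[OF cellin(2)[OF x] cellin(1)[OF x] cellin(3)[OF x] this]
        show "\<kappa> x b * distortion L x (y b) \<le> \<kappa> x b * (g (cell \<alpha> x) b + lam)"
          using K.kernel_nonneg[of x b] x b by (intro mult_left_mono) (auto simp: g_def D_def)
      qed
      also have "\<dots> = (\<Sum>b\<in>Bs. \<kappa> x b * g (cell \<alpha> x) b) + (\<Sum>b\<in>Bs. \<kappa> x b) * lam"
        by (simp add: distrib_left sum.distrib sum_distrib_right)
      finally show "(\<Sum>b\<in>Bs. \<kappa> x b * distortion L x (y b)) \<le> (\<Sum>b\<in>Bs. \<kappa> x b * g (cell \<alpha> x) b) + lam"
        using K.kernel_sum[of x] x by simp
    qed
    also have "\<dots> = (\<integral>x. (\<Sum>b\<in>Bs. \<kappa> x b * g (cell \<alpha> x) b) \<partial>\<mu>) + lam"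
      using sint by (subst Bochner_Integration.integral_add) (auto simp: \<mu>.prob_space)
    finally show ?thesis by (simp add: master)
  qed
  have dist2: "(\<Sum>a\<in>\<alpha>. \<Sum>b\<in>Q. P a b * g a b) \<le> E + 3 * lam"
  proof -
    have sAB: "simple_function M (\<lambda>w. (?A w, ?B w))" using sA sB by (rule simple_function_Pair)
    have V: "finite (\<alpha> \<times> Q)" "(\<lambda>w. (?A w, ?B w)) ` space M \<subseteq> \<alpha> \<times> Q" using fin A\<alpha> BQ by auto
    have Di: "integrable M (\<lambda>w. D (\<xi> w) (rep (Y w)))"
    proof (rule M.integrable_const_bound[where B="L ^ CARD('n) * diam"])
      show "(\<lambda>w. D (\<xi> w) (rep (Y w))) \<in> borel_measurable M"
        unfolding D_def using L \<xi> Y by (intro distortion_joint_measurable) auto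
      show "AE w in M. norm (D (\<xi> w) (rep (Y w))) \<le> L ^ CARD('n) * diam"
        using D_bd[OF \<xi>s repY[OF Ys]] by (intro AE_I2) simp
    qed
    note G = M.integral_comp_simple_function[OF sAB V, of "\<lambda>p. g (fst p) (snd p)"]
    have "(\<Sum>a\<in>\<alpha>. \<Sum>b\<in>Q. P a b * g a b) = (\<Sum>p\<in>\<alpha>\<times>Q. P (fst p) (snd p) * g (fst p) (snd p))"
      by (simp add: sum.cartesian_product split_beta)
    also have "\<dots> = (\<integral>w. g (?A w) (?B w) \<partial>M)"
      using G(1) by (simp add: P_def prod_eq_iff)
    also have "\<dots> \<le> (\<integral>w. D (\<xi> w) (rep (Y w)) + 3 * lam \<partial>M)"
    proof (rule integral_mono)
      show "integrable M (\<lambda>w. g (?A w) (?B w))" using G(2) by simp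
      show "integrable M (\<lambda>w. D (\<xi> w) (rep (Y w)) + 3 * lam)" using Di by simp
      fix w assume w: "w \<in> space M"
      have B: "cell Q (Y w) \<in> Q" "Y w \<in> cell Q (Y w)" using cell_in[OF Q Ys[OF w]] .
      have "g (?A w) (?B w) \<le> D (\<xi> w) (y (?B w)) + lam"
        unfolding g_def comp_def
        using near[OF cellin(2)[OF \<xi>s[OF w]] cellin(3)[OF \<xi>s[OF w]] cellin(1)[OF \<xi>s[OF w]] y[OF B(1)]] .
      also have "D (\<xi> w) (y (?B w)) \<le> D (\<xi> w) (rep (Y w)) + 2 * lam"
        using nearF[OF \<xi>s[OF w] B] by simp
      finally show "g (?A w) (?B w) \<le> D (\<xi> w) (rep (Y w)) + 3 * lam" by simp
    qed
    also have "\<dots> = E + 3 * lam" using Di by (simp add: E_def M.prob_space)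
    finally show ?thesis .
  qed
  have "code_distortion L \<kappa> Bs y < \<epsilon> * L ^ CARD('n)"
  proof -
    have "code_distortion L \<kappa> Bs y \<le> E + 4 * lam" using dist1 dist2 by linarith
    moreover have "6 * lam = \<epsilon> * L ^ CARD('n) - E" by (simp add: lam_def)
    ultimately show ?thesis using lam by linarith
  qed
  with code rate_le show ?thesis by blast
qed

end

section \<open>Block codes and convergence of the rate per volume\<close>

lemma finite_box_index: "finite {i :: 'n::finite \<Rightarrow> nat. \<forall>j. i j < n}"
  and card_box_index: "card {i :: 'n::finite \<Rightarrow> nat. \<forall>j. i j < n} = n ^ CARD('n)"
proof -
  have eq: "{i :: 'n \<Rightarrow> nat. \<forall>j. i j < n} = PiE UNIV (\<lambda>_. {..<n})" by auto
  show "finite {i :: 'n \<Rightarrow> nat. \<forall>j. i j < n}" unfolding eq by (rule finite_PiE) auto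
  show "card {i :: 'n \<Rightarrow> nat. \<forall>j. i j < n} = n ^ CARD('n)"
    unfolding eq by (simp add: card_PiE)
qed

lemma integral_lborel_shift:
  fixes g :: "'e::euclidean_space \<Rightarrow> real"
  assumes "g \<in> borel_measurable borel"
  shows "(\<integral>u. g (u - a) \<partial>lborel) = (\<integral>u. g u \<partial>lborel)"
    and "integrable lborel (\<lambda>u. g (u - a)) \<longleftrightarrow> integrable lborel g"
proof -
  have e: "(distr lborel borel ((+) (- a)) :: 'e measure) = lborel" by (rule lborel_distr_plus)
  have "(\<integral>u. g u \<partial>distr lborel borel ((+) (- a))) = (\<integral>u. g (- a + u) \<partial>lborel)"
    using assms by (intro integral_distr) auto
  then show "(\<integral>u. g (u - a) \<partial>lborel) = (\<integral>u. g u \<partial>lborel)" by (simp add: e)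
  have "integrable (distr lborel borel ((+) (- a))) g \<longleftrightarrow> integrable lborel (\<lambda>u. g (- a + u))"
    using assms by (intro integrable_distr_eq) auto
  then show "integrable lborel (\<lambda>u. g (u - a)) \<longleftrightarrow> integrable lborel g" by (simp add: e)
qed

context lipschitz_action
begin

lemma distortion_lborel:
  fixes f :: "real ^ 'n \<Rightarrow> 'a"
  shows "distortion L x f = (\<integral>u. indicator (cube L) u * mdist X (T u x) (f u) \<partial>lborel)"
  unfolding distortion_def cube_measure_def by (subst integral_restrict_space) auto

lemma integrable_distortion_lborel:
  fixes f :: "real ^ 'n \<Rightarrow> 'a"
  assumes "x \<in> mspace X" "f \<in> L1_maps L X"
  shows "integrable lborel (\<lambda>u. indicator (cube L) u * mdist X (T u x) (f u))"
  using integrable_distortion[OF assms] unfolding cube_measure_def by (subst (asm) integrable_restrict_space) auto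

definition block_shift :: "real \<Rightarrow> ('n \<Rightarrow> nat) \<Rightarrow> real ^ 'n" where
  "block_shift L0 i = (\<chi> j. L0 * real (i j))"

definition block_index :: "real \<Rightarrow> real ^ 'n \<Rightarrow> 'n \<Rightarrow> nat" where
  "block_index L0 u j = nat \<lfloor>u $ j / L0\<rfloor>"

text \<open>\<open>nat\<close> sends negative floors to 0, so the test for membership in
  \<open>cube L0\<close> is what keeps points with a negative coordinate out of the blocks. Outside
  all blocks the value is the default \<open>x0\<close>.\<close>

definition block_splice :: "real \<Rightarrow> nat \<Rightarrow> 'a \<Rightarrow> (('n \<Rightarrow> nat) \<Rightarrow> real ^ 'n \<Rightarrow> 'a) \<Rightarrow> real ^ 'n \<Rightarrow> 'a" where
  "block_splice L0 n x0 f u = (let i = block_index L0 u in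
     if (\<forall>j. i j < n) \<and> u - block_shift L0 i \<in> cube L0 then f i (u - block_shift L0 i) else x0)"

lemma block_index_measurable [measurable]:
  "block_index L0 \<in> measurable borel (count_space UNIV)"
proof (rule measurable_count_space_eq2_countable[THEN iffD2], intro conjI ballI)
  fix i :: "'n \<Rightarrow> nat"
  have "block_index L0 -` {i} \<inter> space borel = {u \<in> space borel. \<forall>j. nat \<lfloor>u $ j / L0\<rfloor> = i j}"
    by (auto simp: block_index_def fun_eq_iff)
  also have "\<dots> \<in> sets borel" by measurable
  finally show "block_index L0 -` {i} \<inter> space borel \<in> sets borel" .
qed auto

lemma block_splice_measurable:
  assumes f: "\<And>i. \<forall>j. i j < n \<Longrightarrow> f i \<in> L1_maps L0 X" and x0: "x0 \<in> mspace X"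
  shows "block_splice L0 n x0 f \<in> measurable borel (metric_borel X)"
proof -
  define g where "g i v = (if (\<forall>j. i j < n) \<and> v \<in> cube L0 then f i v else x0)" for i v
  have gm: "g i \<in> measurable borel (metric_borel X)" for i
  proof (cases "\<forall>j. i j < n")
    case True
    have "f i \<in> measurable (restrict_space lborel (cube L0)) (metric_borel X)"
      using f[OF True] by (simp add: L1_maps_def cube_measure_def)
    then have "(\<lambda>v. if v \<in> cube L0 then f i v else x0) \<in> measurable lborel (metric_borel X)"
      by (subst (asm) measurable_restrict_space_iff[where c=x0]) (use x0 in auto)
    then show ?thesis using True by (simp add: g_def[abs_def])
  next
    case False
    then have "g i v = x0" for v unfolding g_def by (simp only: simp_thms if_False)
    then have "g i = (\<lambda>_. x0)" by (rule ext)
    then show ?thesis using x0 by simp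
  qed
  have "(\<lambda>u. g (block_index L0 u) (u - block_shift L0 (block_index L0 u))) \<in> measurable borel (metric_borel X)"
  proof (rule measurable_compose_countable[where f="\<lambda>i u. g i (u - block_shift L0 i)" and g="block_index L0"])
    show "(\<lambda>u. g i (u - block_shift L0 i)) \<in> measurable borel (metric_borel X)" for i
      by (rule measurable_compose[OF _ gm]) simp
  qed (rule block_index_measurable)
  moreover have "block_splice L0 n x0 f = (\<lambda>u. g (block_index L0 u) (u - block_shift L0 (block_index L0 u)))"
    by (rule ext) (simp add: block_splice_def g_def Let_def)
  ultimately show ?thesis by simp
qed

lemma block_splice_L1_maps:
  assumes "\<And>i. \<forall>j. i j < n \<Longrightarrow> f i \<in> L1_maps L0 X" "x0 \<in> mspace X"
  shows "block_splice L0 n x0 f \<in> L1_maps L X"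
  unfolding L1_maps_def cube_measure_def
  by (rule measurable_restrict_space1) (use block_splice_measurable[OF assms] in simp)

text \<open>The action law turns the part of the integral over block \<open>i\<close> into the
  distortion of the translated point on the small cube. The leftover near the boundary is charged
  with the worst distortion.\<close>

lemma distortion_block_splice_le:
  assumes L0: "0 < L0" and n: "real n * L0 \<le> L" and x: "x \<in> mspace X" and x0: "x0 \<in> mspace X"
    and f: "\<And>i. \<forall>j. i j < n \<Longrightarrow> f i \<in> L1_maps L0 X"
  shows "distortion L x (block_splice L0 n x0 f) \<le>
    (\<Sum>i | \<forall>j. i j < n. distortion L0 (T (block_shift L0 i) x) (f i)) + diam * (L ^ CARD('n) - (real n * L0) ^ CARD('n))"
proof -
  let ?J = "{i :: 'n \<Rightarrow> nat. \<forall>j. i j < n}"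
  let ?a = "block_shift L0"
  have nL0: "0 \<le> real n * L0" using L0 by simp
  then have L: "0 \<le> L" using n by linarith
  define t where "t i v = indicator (cube L0) v * mdist X (T v (T (?a i) x)) (f i v)" for i v
  \<comment> \<open>The part of the large cube that whole blocks leave uncovered.\<close>
  define R :: "(real ^ 'n) set" where "R = cube L - cube (real n * L0) " 
  have R: "R \<in> sets borel" "R \<subseteq> cube L" by (auto simp: R_def)
  have sub: "cube (real n * L0) \<subseteq> (cube L :: (real ^ 'n) set)" using n by (auto simp: cube_def intro: less_le_trans)
  have mR: "measure lborel R = L ^ CARD('n) - (real n * L0) ^ CARD('n)"
  proof -
    have "measure lborel R = measure lborel (cube L :: (real ^ 'n) set) - measure lborel (cube (real n * L0) :: (real ^ 'n) set)"
      unfolding R_def using sub L nL0 by (intro measure_Diff) (auto simp: emeasure_cube)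
    then show ?thesis using L nL0 by (simp add: measure_def emeasure_cube)
  qed
  have iR: "integrable lborel (indicator R :: real ^ 'n \<Rightarrow> real)"
  proof -
    have "emeasure lborel R \<le> emeasure lborel (cube L :: (real ^ 'n) set)" using R by (intro emeasure_mono) auto
    also have "\<dots> < \<infinity>" using L by (simp add: emeasure_cube)
    finally show ?thesis using R by (intro integrable_real_indicator) auto
  qed
  have t: "integrable lborel (t i)" "(\<integral>v. t i v \<partial>lborel) = distortion L0 (T (?a i) x) (f i)" if "i \<in> ?J" for i
    unfolding t_def using integrable_distortion_lborel[of "T (?a i) x" "f i" L0] f[of i] that x
    by (auto simp: distortion_lborel)
  have tm: "t i \<in> borel_measurable borel" if "i \<in> ?J" for i
    using borel_measurable_integrable[OF t(1)[OF that]] by simp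
  have ts: "integrable lborel (\<lambda>u. t i (u - ?a i))" "(\<integral>u. t i (u - ?a i) \<partial>lborel) = distortion L0 (T (?a i) x) (f i)"
    if "i \<in> ?J" for i
    using integral_lborel_shift[OF tm[OF that], of "?a i"] t[OF that] by simp_all
  have tn: "0 \<le> t i v" for i v by (simp add: t_def)
  have S: "block_splice L0 n x0 f \<in> L1_maps L X" using f x0 by (rule block_splice_L1_maps)
  have "distortion L x (block_splice L0 n x0 f) = (\<integral>u. indicator (cube L) u * mdist X (T u x) (block_splice L0 n x0 f u) \<partial>lborel)"
    by (rule distortion_lborel)
  also have "\<dots> \<le> (\<integral>u. (\<Sum>i\<in>?J. t i (u - ?a i)) + diam * indicator R u \<partial>lborel)"
  proof (rule integral_mono)
    show "integrable lborel (\<lambda>u. indicator (cube L) u * mdist X (T u x) (block_splice L0 n x0 f u))"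
      using x S by (rule integrable_distortion_lborel)
    show "integrable lborel (\<lambda>u. (\<Sum>i\<in>?J. t i (u - ?a i)) + diam * indicator R u)"
      using ts iR by (intro Bochner_Integration.integrable_add Bochner_Integration.integrable_sum integrable_mult_right) auto
    fix u :: "real ^ 'n"
    have sn: "0 \<le> (\<Sum>i\<in>?J. t i (u - ?a i))" by (intro sum_nonneg tn)
    show "indicator (cube L) u * mdist X (T u x) (block_splice L0 n x0 f u) \<le> (\<Sum>i\<in>?J. t i (u - ?a i)) + diam * indicator R u"
    proof (cases "u \<in> cube L")
      case False
      then show ?thesis using sn diam_nonneg by simp
    next
      case u: True
      let ?i = "block_index L0 u"
      have uj: "real (?i j) \<le> u $ j / L0" "u $ j / L0 < real (?i j) + 1" for j
      proof -
        have "0 \<le> u $ j / L0" using u L0 by (simp add: cube_def)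
        then have "real (?i j) = of_int \<lfloor>u $ j / L0\<rfloor>" by (simp add: block_index_def)
        then show "real (?i j) \<le> u $ j / L0" "u $ j / L0 < real (?i j) + 1" by linarith+
      qed
      have uin: "u - ?a ?i \<in> cube L0"
        using uj L0 by (auto simp: cube_def block_shift_def field_simps)
      have Ssp: "block_splice L0 n x0 f u \<in> mspace X" using L1_maps_space[OF S u] .
      show ?thesis
      proof (cases "?i \<in> ?J")
        case True
        have "mdist X (T u x) (block_splice L0 n x0 f u) = t ?i (u - ?a ?i)"
          using True uin x by (simp add: t_def block_splice_def Let_def flip: T_add)
        also have "\<dots> \<le> (\<Sum>i\<in>?J. t i (u - ?a i))"
          using True tn finite_box_index by (intro member_le_sum) auto
        moreover have "0 \<le> diam * indicator R u" using diam_nonneg by simp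
        ultimately show ?thesis using u by simp
      next
        case False
        then obtain j where "n \<le> ?i j" by (auto simp: not_less)
        then have "real n \<le> u $ j / L0" using uj(1)[of j] by linarith
        then have "real n * L0 \<le> u $ j" using L0 by (simp add: field_simps)
        then have "u \<in> R" using u by (auto simp: R_def cube_def not_less)
        then show ?thesis using u sn mdist_le_diam[of "T u x", OF _ Ssp] x by simp
      qed
    qed
  qed
  also have "\<dots> = (\<Sum>i\<in>?J. distortion L0 (T (?a i) x) (f i)) + diam * (L ^ CARD('n) - (real n * L0) ^ CARD('n))"
  proof -
    have "(\<integral>u. (\<Sum>i\<in>?J. t i (u - ?a i)) + diam * indicator R u \<partial>lborel)
      = (\<integral>u. (\<Sum>i\<in>?J. t i (u - ?a i)) \<partial>lborel) + (\<integral>u. diam * indicator R u \<partial>lborel)"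
      using ts iR by (intro Bochner_Integration.integral_add Bochner_Integration.integrable_sum integrable_mult_right) auto
    also have "(\<integral>u. (\<Sum>i\<in>?J. t i (u - ?a i)) \<partial>lborel) = (\<Sum>i\<in>?J. distortion L0 (T (?a i) x) (f i))"
      using ts by (subst Bochner_Integration.integral_sum) auto
    also have "(\<integral>u. diam * indicator R u \<partial>lborel) = diam * (L ^ CARD('n) - (real n * L0) ^ CARD('n))"
      using mR R by simp
    finally show ?thesis .
  qed
  finally show ?thesis .
qed

end

context invariant_action
begin

lemma mspace_nonempty: "mspace X \<noteq> {}"
  using \<mu>.not_empty by simp

text \<open>Given \<open>x\<close>, the block \<open>i\<close> is coded by the kernel at the
  translate of \<open>x\<close>, and \<open>K x w / q' w\<close> factors. The logarithm becomes a
  sum, in which each term sees one letter and by invariance contributes the same rate. Since the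
  reference weights are multiplied along, this additivity is an identity.\<close>

lemma block_code:
  fixes Bs :: "'b set"
  assumes L0: "0 < L0" and n: "real n * L0 \<le> L" and code: "is_code L0 \<kappa> q Bs y"
  shows "\<exists>\<kappa>' q' (Bs' :: (('n \<Rightarrow> nat) \<Rightarrow> 'b) set) y'. is_code L \<kappa>' q' Bs' y' \<and>
     code_rate \<kappa>' q' Bs' = real (n ^ CARD('n)) * code_rate \<kappa> q Bs \<and>
     code_distortion L \<kappa>' Bs' y' \<le> real (n ^ CARD('n)) * code_distortion L0 \<kappa> Bs y
        + diam * (L ^ CARD('n) - (real n * L0) ^ CARD('n))"
proof -
  interpret kernel \<mu> \<kappa> Bs using code by (simp add: is_code_def)
  have q: "\<And>b. b \<in> Bs \<Longrightarrow> 0 < q b" "(\<Sum>b\<in>Bs. q b) \<le> 1" and y: "\<And>b. b \<in> Bs \<Longrightarrow> y b \<in> L1_maps L0 X"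
    using code by (auto simp: is_code_def)
  obtain x0 where x0: "x0 \<in> mspace X" using mspace_nonempty by blast
  define J where "J = {i :: 'n \<Rightarrow> nat. \<forall>j. i j < n}"
  have J: "finite J" "card J = n ^ CARD('n)" by (simp_all add: J_def finite_box_index card_box_index)
  let ?a = "block_shift L0"
  define WS where "WS = PiE J (\<lambda>_. Bs)"
  have WS: "finite WS" unfolding WS_def by (intro finite_PiE J finite_Bs)
  have wB: "w i \<in> Bs" if "w \<in> WS" "i \<in> J" for w i using that by (auto simp: WS_def)
  define K where "K x w = (\<Prod>i\<in>J. \<kappa> (T (?a i) x) (w i))" for x w
  define q' where "q' w = (\<Prod>i\<in>J. q (w i))" for w
  define S where "S w = block_splice L0 n x0 (\<lambda>i. y (w i))" for w
  have km: "(\<lambda>x. \<kappa> x b) \<in> borel_measurable (metric_borel X)" if "b \<in> Bs" for b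
    using kernel_measurable[OF that] by (simp cong: measurable_cong_sets add: sets_\<mu>)
  have kTm: "(\<lambda>x. \<kappa> (T u x) b) \<in> borel_measurable \<mu>" if "b \<in> Bs" for u b
    using measurable_compose[OF T_measurable km[OF that]] by (simp cong: measurable_cong_sets add: sets_\<mu>)
  have kT0: "0 \<le> \<kappa> (T u x) b" if "x \<in> mspace X" "b \<in> Bs" for u x b
    using kernel_nonneg[of "T u x" b] that by simp
  have kT1: "(\<Sum>b\<in>Bs. \<kappa> (T u x) b) = 1" if "x \<in> mspace X" for u x
    using kernel_sum[of "T u x"] that by simp
  have marg: "(\<Sum>w\<in>WS. K x w * h (w i)) = (\<Sum>b\<in>Bs. \<kappa> (T (?a i) x) b * h b)"
    if "i \<in> J" "x \<in> mspace X" for i x and h :: "'b \<Rightarrow> real"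
    unfolding WS_def K_def using that J finite_Bs kT1
    by (intro sum_PiE_prod_marginal[where p="\<lambda>j. \<kappa> (T (?a j) x)"]) auto
  have K1: "(\<Sum>w\<in>WS. K x w) = 1" if "x \<in> mspace X" for x
  proof -
    have "(\<Sum>w\<in>WS. K x w) = (\<Prod>i\<in>J. \<Sum>b\<in>Bs. \<kappa> (T (?a i) x) b)"
      unfolding WS_def K_def using J finite_Bs by (subst prod_sum_PiE) auto
    then show ?thesis using kT1[OF that] by simp
  qed
  have kern: "kernel \<mu> K WS"
  proof
    show "0 \<le> K x w" if "x \<in> space \<mu>" "w \<in> WS" for x w
      unfolding K_def using that wB kT0 by (intro prod_nonneg) auto
    show "(\<lambda>x. K x w) \<in> borel_measurable \<mu>" if "w \<in> WS" for w
      unfolding K_def using that wB kTm by (intro borel_measurable_prod) auto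
  qed (use WS K1 in auto)
  interpret K: kernel \<mu> K WS by (rule kern)
  have qsum: "(\<Sum>w\<in>WS. q' w) \<le> 1"
  proof -
    have "(\<Sum>w\<in>WS. q' w) = (\<Prod>i\<in>J. \<Sum>b\<in>Bs. q b)"
      unfolding WS_def q'_def using J finite_Bs by (subst prod_sum_PiE) auto
    also have "\<dots> \<le> 1" using q by (intro prod_le_1) (auto intro: sum_nonneg less_imp_le)
    finally show ?thesis .
  qed
  have q'0: "0 < q' w" if "w \<in> WS" for w unfolding q'_def using that wB q by (intro prod_pos) auto
  have S: "S w \<in> L1_maps L X" if "w \<in> WS" for w
    unfolding S_def using that wB y x0 by (intro block_splice_L1_maps) (auto simp: J_def)
  have code': "is_code L K q' WS S" unfolding is_code_def using kern q'0 qsum S by blast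
  have rate: "code_rate K q' WS = real (n ^ CARD('n)) * code_rate \<kappa> q Bs"
  proof -
    define r where "r x = (\<Sum>b\<in>Bs. \<kappa> x b * log 2 (\<kappa> x b / q b))" for x
    have rm: "r \<in> borel_measurable (metric_borel X)"
    proof -
      have "r \<in> borel_measurable \<mu>" unfolding r_def
        using integrable_kernel_log q by (intro borel_measurable_sum) (auto intro: borel_measurable_integrable)
      then show ?thesis by (simp cong: measurable_cong_sets add: sets_\<mu>)
    qed
    have rT: "(\<lambda>x. r (T u x)) \<in> borel_measurable \<mu>" for u
      using measurable_compose[OF T_measurable rm] by (simp cong: measurable_cong_sets add: sets_\<mu>)
    have rbd: "\<bar>r x\<bar> \<le> (\<Sum>b\<in>Bs. (1 + \<bar>ln (q b)\<bar>) / ln 2)" if "x \<in> mspace X" for x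
      unfolding r_def using that kernel_nonneg[of x] kernel_le_1[of x] q
      by (intro order_trans[OF sum_abs] sum_mono abs_mult_log_le) auto
    have rint: "integrable \<mu> (\<lambda>x. r (T u x))" for u
      by (rule \<mu>.integrable_const_bound[where B="\<Sum>b\<in>Bs. (1 + \<bar>ln (q b)\<bar>) / ln 2"])
         (use rbd rT in \<open>auto intro!: AE_I2\<close>)
    have "code_rate K q' WS = (\<integral>x. (\<Sum>i\<in>J. r (T (?a i) x)) \<partial>\<mu>)"
      unfolding code_rate_def
    proof (intro Bochner_Integration.integral_cong refl)
      fix x assume "x \<in> space \<mu>"
      then have x: "x \<in> mspace X" by simp
      have "(\<Sum>w\<in>WS. K x w * log 2 (K x w / q' w))
        = (\<Sum>w\<in>WS. \<Sum>i\<in>J. K x w * log 2 (\<kappa> (T (?a i) x) (w i) / q (w i)))"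
      proof (rule sum.cong[OF refl])
        fix w assume w: "w \<in> WS"
        show "K x w * log 2 (K x w / q' w) = (\<Sum>i\<in>J. K x w * log 2 (\<kappa> (T (?a i) x) (w i) / q (w i)))"
        \<comment> \<open>If the product is not 0, all its factors are positive and its logarithm
          splits.\<close>
        proof (cases "K x w = 0")
          case False
          then have pos: "0 < \<kappa> (T (?a i) x) (w i)" if "i \<in> J" for i
            using kT0[OF x wB[OF w that], of "?a i"] J that by (auto simp: K_def less_le)
          have "K x w / q' w = (\<Prod>i\<in>J. \<kappa> (T (?a i) x) (w i) / q (w i))"
            by (simp add: K_def q'_def prod_dividef)
          moreover have "ln (\<Prod>i\<in>J. \<kappa> (T (?a i) x) (w i) / q (w i)) = (\<Sum>i\<in>J. ln (\<kappa> (T (?a i) x) (w i) / q (w i)))"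
          proof (intro ln_prod)
            fix i assume i: "i \<in> J"
            show "\<kappa> (T (?a i) x) (w i) / q (w i) \<noteq> 0"
              using pos[OF i] q(1)[OF wB[OF w i]] by simp
          qed (rule J(1))
          ultimately show ?thesis
            by (simp add: log_def sum_distrib_left sum_divide_distrib)
        qed simp
      qed
      also have "\<dots> = (\<Sum>i\<in>J. \<Sum>w\<in>WS. K x w * log 2 (\<kappa> (T (?a i) x) (w i) / q (w i)))" by (rule sum.swap)
      also have "\<dots> = (\<Sum>i\<in>J. r (T (?a i) x))"
      proof (rule sum.cong[OF refl])
        fix i assume i: "i \<in> J"
        show "(\<Sum>w\<in>WS. K x w * log 2 (\<kappa> (T (?a i) x) (w i) / q (w i))) = r (T (?a i) x)"
          using marg[OF i x, of "\<lambda>b. log 2 (\<kappa> (T (?a i) x) b / q b)"] by (simp add: r_def)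
      qed
      finally show "(\<Sum>w\<in>WS. K x w * log 2 (K x w / q' w)) = (\<Sum>i\<in>J. r (T (?a i) x))" .
    qed
    also have "\<dots> = (\<Sum>i\<in>J. \<integral>x. r (T (?a i) x) \<partial>\<mu>)"
      by (rule Bochner_Integration.integral_sum) (rule rint)
    also have "\<dots> = (\<Sum>i\<in>J. code_rate \<kappa> q Bs)"
      by (intro sum.cong refl) (simp add: integral_T[OF rm], simp add: code_rate_def r_def[abs_def])
    finally show ?thesis using J by simp
  qed
  have dist: "code_distortion L K WS S \<le> real (n ^ CARD('n)) * code_distortion L0 \<kappa> Bs y
        + diam * (L ^ CARD('n) - (real n * L0) ^ CARD('n))"
  proof -
    define r where "r x = (\<Sum>b\<in>Bs. \<kappa> x b * distortion L0 x (y b))" for x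
    have L: "0 \<le> L" using n L0 by (meson mult_nonneg_nonneg of_nat_0_le_iff less_imp_le order_trans)
    have dm: "(\<lambda>x. distortion L0 x (y b)) \<in> borel_measurable (metric_borel X)" if "b \<in> Bs" for b
      using L0 y[OF that] by (intro distortion_measurable) auto
    have rm: "r \<in> borel_measurable (metric_borel X)"
      unfolding r_def using km dm by (intro borel_measurable_sum borel_measurable_times)
    have rT: "(\<lambda>x. r (T u x)) \<in> borel_measurable \<mu>" for u
      using measurable_compose[OF T_measurable rm] by (simp cong: measurable_cong_sets add: sets_\<mu>)
    have rbd: "\<bar>r x\<bar> \<le> L0 ^ CARD('n) * diam" if x: "x \<in> mspace X" for x
    proof -
      have "r x \<le> (\<Sum>b\<in>Bs. \<kappa> x b * (L0 ^ CARD('n) * diam))"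
        unfolding r_def using kernel_nonneg[of x] x y L0 by (intro sum_mono mult_left_mono distortion_le_diam) auto
      also have "\<dots> = L0 ^ CARD('n) * diam" using kernel_sum[of x] x by (simp flip: sum_distrib_right)
      finally have "r x \<le> L0 ^ CARD('n) * diam" .
      moreover have "0 \<le> r x" unfolding r_def using kernel_nonneg[of x] x by (auto intro!: sum_nonneg mult_nonneg_nonneg distortion_nonneg)
      ultimately show ?thesis by simp
    qed
    have rint: "integrable \<mu> (\<lambda>x. r (T u x))" for u
      by (rule \<mu>.integrable_const_bound[where B="L0 ^ CARD('n) * diam"])
         (use rbd rT in \<open>auto intro!: AE_I2\<close>)
    let ?c = "diam * (L ^ CARD('n) - (real n * L0) ^ CARD('n))"
    have "code_distortion L K WS S \<le> (\<integral>x. (\<Sum>i\<in>J. r (T (?a i) x)) + ?c \<partial>\<mu>)"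
      unfolding code_distortion_def
    proof (rule integral_mono)
      show "integrable \<mu> (\<lambda>x. \<Sum>w\<in>WS. K x w * distortion L x (S w))"
      proof (rule Bochner_Integration.integrable_sum)
        fix w assume w: "w \<in> WS"
        show "integrable \<mu> (\<lambda>x. K x w * distortion L x (S w))"
        proof (rule K.integrable_kernel_mult[OF w, where C="L ^ CARD('n) * diam"])
          show "(\<lambda>x. distortion L x (S w)) \<in> borel_measurable \<mu>"
            using distortion_measurable[OF L S[OF w]] by (simp cong: measurable_cong_sets add: sets_\<mu>)
        qed (use distortion_le_diam[OF L _ S[OF w]] in \<open>auto simp: distortion_nonneg\<close>)
      qed
      show "integrable \<mu> (\<lambda>x. (\<Sum>i\<in>J. r (T (?a i) x)) + ?c)"
        using rint by (intro Bochner_Integration.integrable_add Bochner_Integration.integrable_sum) auto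
      fix x assume "x \<in> space \<mu>"
      then have x: "x \<in> mspace X" by simp
      have "(\<Sum>w\<in>WS. K x w * distortion L x (S w))
        \<le> (\<Sum>w\<in>WS. K x w * ((\<Sum>i\<in>J. distortion L0 (T (?a i) x) (y (w i))) + ?c))"
      proof (intro sum_mono mult_left_mono)
        fix w assume w: "w \<in> WS"
        show "distortion L x (S w) \<le> (\<Sum>i\<in>J. distortion L0 (T (?a i) x) (y (w i))) + ?c"
          unfolding S_def J_def using wB[OF w] y
          by (intro distortion_block_splice_le L0 n x x0) (auto simp: J_def)
        show "0 \<le> K x w" using K.kernel_nonneg[of x w] x w by simp
      qed
      also have "\<dots> = (\<Sum>w\<in>WS. \<Sum>i\<in>J. K x w * distortion L0 (T (?a i) x) (y (w i))) + (\<Sum>w\<in>WS. K x w) * ?c"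
        by (simp add: distrib_left sum.distrib sum_distrib_left sum_distrib_right)
      also have "(\<Sum>w\<in>WS. \<Sum>i\<in>J. K x w * distortion L0 (T (?a i) x) (y (w i)))
        = (\<Sum>i\<in>J. \<Sum>w\<in>WS. K x w * distortion L0 (T (?a i) x) (y (w i)))" by (rule sum.swap)
      also have "\<dots> = (\<Sum>i\<in>J. r (T (?a i) x))"
        using marg[OF _ x] by (intro sum.cong refl) (simp add: r_def)
      finally show "(\<Sum>w\<in>WS. K x w * distortion L x (S w)) \<le> (\<Sum>i\<in>J. r (T (?a i) x)) + ?c"
        using K1[OF x] by simp
    qed
    also have "\<dots> = (\<Sum>i\<in>J. \<integral>x. r (T (?a i) x) \<partial>\<mu>) + ?c"
      using rint by (subst Bochner_Integration.integral_add) (auto simp: \<mu>.prob_space)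
    also have "(\<Sum>i\<in>J. \<integral>x. r (T (?a i) x) \<partial>\<mu>) = (\<Sum>i\<in>J. code_distortion L0 \<kappa> Bs y)"
      by (intro sum.cong refl) (simp add: integral_T[OF rm], simp add: code_distortion_def r_def[abs_def])
    finally show ?thesis using J by simp
  qed
  show ?thesis using code' rate dist by blast
qed

text \<open>Whole blocks fill a fraction of the cube that tends to 1. The strict inequality for the
  distortion leaves room for the cost \<open>diam\<close> of the remaining fraction once
  \<open>L\<close> is large.\<close>

lemma eventually_rate_distortion_L_le:
  fixes Bs :: "'b set"
  assumes L0: "0 < L0" and code: "is_code L0 \<kappa> q Bs y"
    and dist: "code_distortion L0 \<kappa> Bs y < \<epsilon> * L0 ^ CARD('n)"
  shows "eventually (\<lambda>L. rate_distortion_L X T \<mu> L \<epsilon> / ereal (L ^ CARD('n)) \<le> ereal (code_rate \<kappa> q Bs / L0 ^ CARD('n))) at_top"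
proof -
  define c where "c = code_distortion L0 \<kappa> Bs y / L0 ^ CARD('n)"
  have L0d: "0 < L0 ^ CARD('n)" using L0 by simp
  have c: "c < \<epsilon>" using dist L0d by (simp add: c_def field_simps)
  \<comment> \<open>The fraction of the volume of \<open>cube L\<close> that is filled by whole
    blocks.\<close>
  define f where "f L = (real (nat \<lfloor>L / L0\<rfloor>) * L0 / L) ^ CARD('n)" for L
  have f_lim: "(f \<longlongrightarrow> 1) at_top"
  proof -
    have "((\<lambda>L. real (nat \<lfloor>L / L0\<rfloor>) * L0 / L) \<longlongrightarrow> 1) at_top"
    proof (rule tendsto_sandwich[where f="\<lambda>L. 1 - L0 / L" and h="\<lambda>_. 1"])
      show "\<forall>\<^sub>F L in at_top. 1 - L0 / L \<le> real (nat \<lfloor>L / L0\<rfloor>) * L0 / L"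
        using eventually_gt_at_top[of 0]
      proof eventually_elim
        case (elim L)
        have "L / L0 - 1 \<le> real (nat \<lfloor>L / L0\<rfloor>)" by linarith
        then have "(L / L0 - 1) * L0 / L \<le> real (nat \<lfloor>L / L0\<rfloor>) * L0 / L"
          using L0 elim by (intro divide_right_mono mult_right_mono) auto
        moreover have "(L / L0 - 1) * L0 / L = 1 - L0 / L" using L0 elim by (simp add: diff_divide_distrib left_diff_distrib)
        ultimately show ?case by simp
      qed
      show "\<forall>\<^sub>F L in at_top. real (nat \<lfloor>L / L0\<rfloor>) * L0 / L \<le> 1"
        using eventually_gt_at_top[of 0]
      proof eventually_elim
        case (elim L)
        have "0 \<le> L / L0" using L0 elim by simp
        then have "real (nat \<lfloor>L / L0\<rfloor>) \<le> L / L0" by linarith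
        then have "real (nat \<lfloor>L / L0\<rfloor>) * L0 \<le> L" using L0 by (simp only: pos_le_divide_eq)
        then show ?case using elim by simp
      qed
      have "((\<lambda>L. 1 - L0 / L) \<longlongrightarrow> 1 - 0) at_top"
        by (intro tendsto_diff tendsto_const tendsto_divide_0[OF tendsto_const] filterlim_at_top_imp_at_infinity filterlim_ident)
      then show "((\<lambda>L. 1 - L0 / L) \<longlongrightarrow> 1) at_top" by simp
    qed simp
    from tendsto_power[OF this, of "CARD('n)"] show ?thesis by (simp add: f_def[abs_def])
  qed
  have "((\<lambda>L. f L * c + diam * (1 - f L)) \<longlongrightarrow> 1 * c + diam * (1 - 1)) at_top"
    by (intro tendsto_intros f_lim)
  then have "\<forall>\<^sub>F L in at_top. f L * c + diam * (1 - f L) < \<epsilon>"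
    using c by (intro order_tendstoD(2)) auto
  then show ?thesis
    using eventually_gt_at_top[of 0]
  proof eventually_elim
    case (elim L)
    define n where "n = nat \<lfloor>L / L0\<rfloor>"
    have Ld: "0 < L ^ CARD('n)" using elim by simp
    have n: "real n * L0 \<le> L"
    proof -
      have "0 \<le> L / L0" using L0 elim by simp
      then have "real n \<le> L / L0" unfolding n_def by linarith
      then show ?thesis using L0 by (simp add: field_simps)
    qed
    obtain \<kappa>' q' and Bs' :: "(('n \<Rightarrow> nat) \<Rightarrow> 'b) set" and y' where code': "is_code L \<kappa>' q' Bs' y'"
      and rate': "code_rate \<kappa>' q' Bs' = real (n ^ CARD('n)) * code_rate \<kappa> q Bs"
      and dist': "code_distortion L \<kappa>' Bs' y' \<le> real (n ^ CARD('n)) * code_distortion L0 \<kappa> Bs y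
        + diam * (L ^ CARD('n) - (real n * L0) ^ CARD('n))"
      using block_code[OF L0 n code] by blast
    have fL: "(real n * L0) ^ CARD('n) = f L * L ^ CARD('n)"
      using elim by (simp add: f_def n_def power_divide)
    have "real (n ^ CARD('n)) * code_distortion L0 \<kappa> Bs y = (real n * L0) ^ CARD('n) * c"
      using L0 by (simp add: c_def power_mult_distrib)
    with dist' have "code_distortion L \<kappa>' Bs' y' \<le> f L * L ^ CARD('n) * c + diam * (L ^ CARD('n) - f L * L ^ CARD('n))"
      by (simp only: fL)
    also have "\<dots> = (f L * c + diam * (1 - f L)) * L ^ CARD('n)" by (simp add: algebra_simps)
    finally have "code_distortion L \<kappa>' Bs' y' \<le> (f L * c + diam * (1 - f L)) * L ^ CARD('n)" .
    also have "\<dots> < \<epsilon> * L ^ CARD('n)" using elim(1) Ld by (rule mult_strict_right_mono)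
    finally have "rate_distortion_L X T \<mu> L \<epsilon> \<le> ereal (code_rate \<kappa>' q' Bs')"
      by (intro rate_distortion_L_le_code_rate[OF _ code']) (use elim in auto)
    then have "rate_distortion_L X T \<mu> L \<epsilon> / ereal (L ^ CARD('n)) \<le> ereal (code_rate \<kappa>' q' Bs') / ereal (L ^ CARD('n))"
      using Ld by (intro ereal_divide_right_mono) auto
    also have "\<dots> = ereal (real (n ^ CARD('n)) * code_rate \<kappa> q Bs / L ^ CARD('n))"
      using elim(2) by (simp add: rate')
    also have "\<dots> \<le> ereal (code_rate \<kappa> q Bs / L0 ^ CARD('n))"
    proof -
      have "(real n * L0) ^ CARD('n) \<le> L ^ CARD('n)" using n L0 by (intro power_mono) auto
      then have "real (n ^ CARD('n)) * L0 ^ CARD('n) \<le> L ^ CARD('n)" by (simp add: power_mult_distrib)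
      then have "real (n ^ CARD('n)) * L0 ^ CARD('n) * code_rate \<kappa> q Bs \<le> L ^ CARD('n) * code_rate \<kappa> q Bs"
        using code_rate_nonneg[OF code] by (rule mult_right_mono)
      then show ?thesis using Ld L0d by (simp add: field_simps)
    qed
    finally show ?case .
  qed
qed

lemma rate_distortion_L_nonneg: "0 < L \<Longrightarrow> 0 \<le> rate_distortion_L X T \<mu> L \<epsilon>"
proof (rule ccontr)
  assume L: "0 < L" and "\<not> 0 \<le> rate_distortion_L X T \<mu> L \<epsilon>"
  then have "rate_distortion_L X T \<mu> L \<epsilon> < 0" by simp
  then obtain r where r: "rate_distortion_L X T \<mu> L \<epsilon> < ereal r" "ereal r < 0" using ereal_dense2 by blast
  from code_exists[OF L r(1)] r(2) show False using code_rate_nonneg by force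
qed

text \<open>The infimum is a lower bound for each \<open>L\<close>. Conversely, an almost optimal
  pair on one cube is discretised into a code, and repeating this code in blocks transfers its rate
  to all large cubes. Subadditivity is thus proved for codes and not for random pairs.\<close>

theorem rate_distortion_tendsto:
  "((\<lambda>L. rate_distortion_L X T \<mu> L \<epsilon> / ereal (L ^ CARD('n))) \<longlongrightarrow> rate_distortion X T \<mu> \<epsilon>) at_top" (is ?lim)
  and rate_distortion_eq_INF:
  "rate_distortion X T \<mu> \<epsilon> = (INF L\<in>{0<..}. rate_distortion_L X T \<mu> L \<epsilon> / ereal (L ^ CARD('n)))" (is ?eq)
proof -
  let ?R = "\<lambda>L. rate_distortion_L X T \<mu> L \<epsilon> / ereal (L ^ CARD('n))"
  have lim: "(?R \<longlongrightarrow> (INF L\<in>{0<..}. ?R L)) at_top"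
  proof (rule order_tendstoI)
    fix a assume a: "a < (INF L\<in>{0<..}. ?R L)"
    show "\<forall>\<^sub>F L in at_top. a < ?R L"
      by (rule eventually_mono[OF eventually_gt_at_top[of "0::real"]])
         (rule less_le_trans[OF a INF_lower], simp)
  next
    fix a assume "(INF L\<in>{0<..}. ?R L) < a"
    then obtain L0 where L0: "0 < L0" "?R L0 < a" by (auto simp: INF_less_iff)
    then obtain r where r: "?R L0 < ereal r" "ereal r < a" using ereal_dense2 by blast
    have L0d: "0 < L0 ^ CARD('n)" using L0 by simp
    have "rate_distortion_L X T \<mu> L0 \<epsilon> < ereal (r * L0 ^ CARD('n))"
      using r(1) L0d L0(1) by (cases "rate_distortion_L X T \<mu> L0 \<epsilon>") (auto simp: field_simps)
    from code_exists[OF L0(1) this] obtain \<kappa> q and Bs :: "(real ^ 'n \<Rightarrow> 'a) set set set" and y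
      where code: "is_code L0 \<kappa> q Bs y" "code_rate \<kappa> q Bs \<le> r * L0 ^ CARD('n)"
        "code_distortion L0 \<kappa> Bs y < \<epsilon> * L0 ^ CARD('n)" by blast
    have "ereal (code_rate \<kappa> q Bs / L0 ^ CARD('n)) \<le> ereal r" using code(2) L0d by (simp add: field_simps)
    then have "ereal (code_rate \<kappa> q Bs / L0 ^ CARD('n)) < a" using r(2) by (rule le_less_trans)
    then show "\<forall>\<^sub>F L in at_top. ?R L < a"
      using eventually_rate_distortion_L_le[OF L0(1) code(1) code(3)]
      by (auto elim!: eventually_mono intro: le_less_trans)
  qed
  \<comment> \<open>\<open>Lim\<close> denotes the limit only now that convergence is known.\<close>
  then show ?eq unfolding rate_distortion_def by (intro tendsto_Lim) simp_all
  then show ?lim using lim by simp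
qed

end

section \<open>Bounds for the rate and criteria for the dimension\<close>

context invariant_action
begin

lemma rate_distortion_nonneg: "0 \<le> rate_distortion X T \<mu> \<epsilon>"
  unfolding rate_distortion_eq_INF
proof (rule INF_greatest)
  fix L :: real assume "L \<in> {0<..}"
  then have "0 \<le> rate_distortion_L X T \<mu> L \<epsilon>" "0 < L ^ CARD('n)" by (auto intro: rate_distortion_L_nonneg)
  then show "0 \<le> rate_distortion_L X T \<mu> L \<epsilon> / ereal (L ^ CARD('n))"
    by (cases "rate_distortion_L X T \<mu> L \<epsilon>") auto
qed

lemma rate_distortion_le_code_rate:
  assumes "0 < L" "is_code L \<kappa> q Bs y" "code_distortion L \<kappa> Bs y < \<epsilon> * L ^ CARD('n)"
  shows "rate_distortion X T \<mu> \<epsilon> \<le> ereal (code_rate \<kappa> q Bs / L ^ CARD('n))"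
  by (rule tendsto_upperbound[OF rate_distortion_tendsto eventually_rate_distortion_L_le[OF assms]]) simp

text \<open>A deterministic code: the word is the first one that approximates the orbit well, and
  uniform reference weights give the rate \<open>log 2 (real N)\<close>.\<close>

lemma rate_distortion_le_cover:
  fixes f :: "nat \<Rightarrow> real ^ 'n \<Rightarrow> 'a"
  assumes L: "0 < L" and Z: "Z \<in> sets \<mu>" "measure \<mu> Z = 1"
    and f: "\<And>i. i < N \<Longrightarrow> f i \<in> L1_maps L X"
    and cover: "\<And>x. x \<in> Z \<Longrightarrow> \<exists>i<N. distortion L x (f i) \<le> \<delta>" and \<delta>: "\<delta> < \<epsilon> * L ^ CARD('n)"
  shows "rate_distortion X T \<mu> \<epsilon> \<le> ereal (log 2 (real N) / L ^ CARD('n))"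
proof -
  have "Z \<noteq> {}" using Z(2) by auto
  then have N: "0 < N" using cover by fastforce
  define P where "P i x \<longleftrightarrow> i < N \<and> distortion L x (f i) \<le> \<delta>" for i x
  \<comment> \<open>Off the covered set the index defaults to 0, which is below \<open>N\<close>;
    the kernel is thus defined everywhere, and the bad set is null.\<close>
  define idx where "idx x = (if \<exists>i\<in>{..<N}. P i x then LEAST i. P i x else 0)" for x
  have dm: "(\<lambda>x. distortion L x (f i)) \<in> borel_measurable \<mu>" if "i < N" for i
    using distortion_measurable[OF _ f[OF that]] L by (simp cong: measurable_cong_sets add: sets_\<mu>)
  have Pm: "Measurable.pred \<mu> (P i)" for i
  proof (cases "i < N")
    case True
    note [measurable] = dm[OF True]
    show ?thesis unfolding P_def by measurable
  qed (simp add: P_def[abs_def])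
  have Em: "Measurable.pred \<mu> (\<lambda>x. \<exists>i\<in>{..<N}. P i x)"
    using Pm by (intro pred_intros_finite) auto
  have idxm: "idx \<in> measurable \<mu> (count_space UNIV)"
    unfolding idx_def by (rule measurable_If[OF measurable_Least[OF Pm] measurable_const predE[OF Em]]) simp
  have idxN: "idx x < N" for x
  proof (cases "\<exists>i\<in>{..<N}. P i x")
    case True
    then have "P (LEAST i. P i x) x" by (auto intro: LeastI)
    with True show ?thesis by (simp add: idx_def P_def)
  qed (use N in \<open>simp add: idx_def\<close>)
  have idxZ: "distortion L x (f (idx x)) \<le> \<delta>" if "x \<in> Z" for x
  proof -
    have ex: "\<exists>i\<in>{..<N}. P i x" using cover[OF that] by (auto simp: P_def)
    then have "P (LEAST i. P i x) x" by (auto intro: LeastI)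
    with ex show ?thesis by (simp add: idx_def P_def)
  qed
  define \<kappa> :: "'a \<Rightarrow> nat \<Rightarrow> real" where "\<kappa> x i = (if i = idx x then 1 else 0)" for x i
  have sumk: "(\<Sum>i<N. \<kappa> x i * h i) = h (idx x)" for x and h :: "nat \<Rightarrow> real"
    using idxN[of x] by (simp add: \<kappa>_def if_distrib[where f="\<lambda>z. z * _"] cong: if_cong)
  have kern: "kernel \<mu> \<kappa> {..<N}"
  proof
    show "(\<lambda>x. \<kappa> x i) \<in> borel_measurable \<mu>" for i
      unfolding \<kappa>_def using measurable_compose[OF idxm, of "\<lambda>j. if i = j then 1 else 0 :: real"] by simp
    show "(\<Sum>i<N. \<kappa> x i) = 1" for x using sumk[of x "\<lambda>_. 1"] by simp
  qed (auto simp: \<kappa>_def)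
  have code: "is_code L \<kappa> (\<lambda>_. 1 / real N) {..<N} f"
    unfolding is_code_def using kern N f by auto
  have "code_rate \<kappa> (\<lambda>_. 1 / real N) {..<N} = (\<integral>x. log 2 (real N) \<partial>\<mu>)"
    unfolding code_rate_def
  proof (intro Bochner_Integration.integral_cong refl)
    fix x
    show "(\<Sum>i<N. \<kappa> x i * log 2 (\<kappa> x i / (1 / real N))) = log 2 (real N)"
      using sumk[of x "\<lambda>i. log 2 (\<kappa> x i / (1 / real N))"] by (simp add: \<kappa>_def)
  qed
  then have rate: "code_rate \<kappa> (\<lambda>_. 1 / real N) {..<N} = log 2 (real N)" by simp
  have "code_distortion L \<kappa> {..<N} f = (\<integral>x. distortion L x (f (idx x)) \<partial>\<mu>)"
    unfolding code_distortion_def by (simp add: sumk)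
  also have "\<dots> \<le> (\<integral>x. \<delta> \<partial>\<mu>)"
  proof (rule integral_mono_AE)
    show "integrable \<mu> (\<lambda>x. distortion L x (f (idx x)))"
    proof (rule \<mu>.integrable_const_bound[where B="L ^ CARD('n) * diam"])
      show "AE x in \<mu>. norm (distortion L x (f (idx x))) \<le> L ^ CARD('n) * diam"
        using distortion_le_diam[OF _ _ f[OF idxN]] L by (intro AE_I2) (simp add: distortion_nonneg)
      have "(\<lambda>x. distortion L x (f (idx x))) = (\<lambda>x. \<Sum>i<N. \<kappa> x i * distortion L x (f i))" by (simp add: sumk)
      then show "(\<lambda>x. distortion L x (f (idx x))) \<in> borel_measurable \<mu>"
        using dm kernel.kernel_measurable[OF kern] by (simp only:) (intro borel_measurable_sum borel_measurable_times, auto)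
    qed
    have "AE x in \<mu>. x \<in> Z" using Z by (simp add: \<mu>.prob_eq_1)
    then show "AE x in \<mu>. distortion L x (f (idx x)) \<le> \<delta>" by eventually_elim (rule idxZ)
  qed simp
  finally have "code_distortion L \<kappa> {..<N} f < \<epsilon> * L ^ CARD('n)" using \<delta> by simp
  from rate_distortion_le_code_rate[OF L code this] show ?thesis by (simp add: rate)
qed

text \<open>If a random pair did better than \<open>\<rho>\<close>, discretising it would give a
  code doing better. The type of \<open>Bs\<close> is that of the codes which this discretisation
  produces.\<close>

lemma rate_distortion_ge:
  assumes L1: "0 < L1"
    and ge: "\<And>L \<kappa> q (Bs :: (real ^ 'n \<Rightarrow> 'a) set set set) y. L1 \<le> L \<Longrightarrow> is_code L \<kappa> q Bs y \<Longrightarrow>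
       code_distortion L \<kappa> Bs y < \<epsilon> * L ^ CARD('n) \<Longrightarrow> \<rho> * L ^ CARD('n) \<le> code_rate \<kappa> q Bs"
  shows "ereal \<rho> \<le> rate_distortion X T \<mu> \<epsilon>"
proof (rule tendsto_lowerbound[OF rate_distortion_tendsto])
  show "\<forall>\<^sub>F L in at_top. ereal \<rho> \<le> rate_distortion_L X T \<mu> L \<epsilon> / ereal (L ^ CARD('n))"
    using eventually_ge_at_top[of L1]
  proof eventually_elim
    case (elim L)
    then have L: "0 < L" using L1 by simp
    then have Ld: "0 < L ^ CARD('n)" by simp
    have "ereal (\<rho> * L ^ CARD('n)) \<le> rate_distortion_L X T \<mu> L \<epsilon>"
    proof (rule ccontr)
      assume "\<not> ereal (\<rho> * L ^ CARD('n)) \<le> rate_distortion_L X T \<mu> L \<epsilon>"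
      then have "rate_distortion_L X T \<mu> L \<epsilon> < ereal (\<rho> * L ^ CARD('n))" by simp
      then obtain r where r: "rate_distortion_L X T \<mu> L \<epsilon> < ereal r" "ereal r < ereal (\<rho> * L ^ CARD('n))"
        using ereal_dense2 by blast
      from code_exists[OF L r(1)] obtain \<kappa> q and Bs :: "(real ^ 'n \<Rightarrow> 'a) set set set" and y
        where "is_code L \<kappa> q Bs y" "code_rate \<kappa> q Bs \<le> r" "code_distortion L \<kappa> Bs y < \<epsilon> * L ^ CARD('n)"
        by blast
      with ge[OF elim this(1) this(3)] r(2) show False by simp
    qed
    then show ?case using Ld L
      by (cases "rate_distortion_L X T \<mu> L \<epsilon>") (auto simp: field_simps)
  qed
qed simp

lemma has_rdim_0:
  assumes C: "\<And>\<epsilon>. 0 < \<epsilon> \<Longrightarrow> rate_distortion X T \<mu> \<epsilon> \<le> ereal C"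
  shows "has_rdim X T \<mu> 0"
  unfolding has_rdim_def
proof (rule tendsto_sandwich)
  have aux: "0 \<le> x / ereal l" "x \<le> ereal C \<Longrightarrow> x / ereal l \<le> ereal (C / l)" if "0 \<le> x" "0 < l" for x l
    using that by (cases x; auto intro!: divide_right_mono)+
  have ev: "\<forall>\<^sub>F \<epsilon> in at_right (0::real). 0 < \<epsilon> \<and> \<epsilon> < 1"
    by (rule eventually_at_right_less[THEN eventually_conj, OF eventually_at_right_real[THEN eventually_mono]]) auto
  show "\<forall>\<^sub>F \<epsilon> in at_right 0. 0 \<le> rate_distortion X T \<mu> \<epsilon> / ereal (log 2 (1 / \<epsilon>))"
    using ev
  proof eventually_elim
    case (elim \<epsilon>)
    then have "0 < log 2 (1 / \<epsilon>)" by simp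
    from aux(1)[OF rate_distortion_nonneg this] show ?case .
  qed
  show "\<forall>\<^sub>F \<epsilon> in at_right 0. rate_distortion X T \<mu> \<epsilon> / ereal (log 2 (1 / \<epsilon>)) \<le> ereal (C / log 2 (1 / \<epsilon>))"
    using ev
  proof eventually_elim
    case (elim \<epsilon>)
    then have "0 < log 2 (1 / \<epsilon>)" by simp
    from aux(2)[OF rate_distortion_nonneg this C] elim show ?case by simp
  qed
  have "filterlim (\<lambda>\<epsilon>. log 2 (1 / \<epsilon>)) at_infinity (at_right (0::real))"
  proof (rule filterlim_at_top_imp_at_infinity)
    have "filterlim (\<lambda>\<epsilon>. - ln \<epsilon>) at_top (at_right (0::real))"
      using ln_at_0 by (simp add: filterlim_uminus_at_bot)
    then have "filterlim (\<lambda>\<epsilon>. - ln \<epsilon> * (1 / ln 2)) at_top (at_right (0::real))"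
      by (intro filterlim_at_top_mult_tendsto_pos[OF tendsto_const]) auto
    moreover have "\<forall>\<^sub>F \<epsilon> in at_right (0::real). - ln \<epsilon> * (1 / ln 2) = log 2 (1 / \<epsilon>)"
      using ev by eventually_elim (simp add: log_def ln_div)
    ultimately show "filterlim (\<lambda>\<epsilon>. log 2 (1 / \<epsilon>)) at_top (at_right (0::real))"
      by (rule filterlim_cong[OF refl refl, THEN iffD1, rotated])
  qed
  from tendsto_divide_0[OF tendsto_const this, of C]
  show "((\<lambda>\<epsilon>. ereal (C / log 2 (1 / \<epsilon>))) \<longlongrightarrow> 0) (at_right 0)"
    by (simp add: zero_ereal_def)
qed simp

text \<open>The hypothesis says that the rate is at least of order \<open>\<epsilon>\<close> to the
  power -1/2. In terms of the fourth root \<open>z\<close> of \<open>1 / \<epsilon>\<close> the rate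
  is of order \<open>z\<^sup>2\<close>, while the logarithm is of order at most
  \<open>z\<close>.\<close>

lemma has_rdim_infinity:
  assumes a: "0 < a" and c: "0 < c"
    and ge: "\<And>k \<epsilon>. 0 < \<epsilon> \<Longrightarrow> \<epsilon> \<le> a / 4 ^ k \<Longrightarrow> ereal (c * 2 ^ k) \<le> rate_distortion X T \<mu> \<epsilon>"
  shows "has_rdim X T \<mu> \<infinity>"
  unfolding has_rdim_def tendsto_PInfty
proof
  fix r :: real
  \<comment> \<open>Chosen so that \<open>c' * z * (4 * z / ln 2)\<close> equals
    \<open>c / 2 * sqrt a * z\<^sup>2\<close>, the lower bound for the rate.\<close>
  define c' where "c' = c / 2 * sqrt a * ln 2 / 4"
  have c': "0 < c'" using a c by (simp add: c'_def)
  define R where "R = max r 1"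
  \<comment> \<open>The fourth power makes \<open>z\<close> exceed \<open>(R + 1) / c'\<close>; the
    bounds 1 and \<open>a\<close> give a positive logarithm and a positive least exponent
    \<open>m\<close>.\<close>
  define e where "e = min (min 1 a) ((c' / (R + 1)) ^ 4)"
  have e: "0 < e" using a c' by (simp add: e_def R_def)
  have "\<forall>\<^sub>F \<epsilon> in at_right (0::real). 0 < \<epsilon> \<and> \<epsilon> < e"
    using e by (intro eventually_conj eventually_at_right_less eventually_at_right_real[THEN eventually_mono]) auto
  then show "\<forall>\<^sub>F \<epsilon> in at_right 0. ereal r < rate_distortion X T \<mu> \<epsilon> / ereal (log 2 (1 / \<epsilon>))"
  proof eventually_elim
    case (elim \<epsilon>)
    then have \<epsilon>: "0 < \<epsilon>" "\<epsilon> < 1" "\<epsilon> < a" "\<epsilon> < (c' / (R + 1)) ^ 4" by (auto simp: e_def)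
    have "\<exists>k. a / \<epsilon> < 4 ^ k" by (rule real_arch_pow) simp
    \<comment> \<open>The predecessor of the least exponent beyond \<open>a / \<epsilon>\<close> is
      the finest scale that \<open>\<epsilon>\<close> still resolves.\<close>
    define m where "m = (LEAST k. a / \<epsilon> < 4 ^ k)"
    have m: "a / \<epsilon> < 4 ^ m" unfolding m_def using \<open>\<exists>k. a / \<epsilon> < 4 ^ k\<close> by (rule LeastI_ex)
    have "m \<noteq> 0"
    proof
      assume "m = 0"
      then show False using m \<epsilon> by (simp add: field_simps)
    qed
    then obtain k where k: "m = Suc k" using not0_implies_Suc by blast
    have "\<not> a / \<epsilon> < 4 ^ k" using k not_less_Least[of k "\<lambda>k. a / \<epsilon> < 4 ^ k"] by (simp add: m_def)
    then have "\<epsilon> \<le> a / 4 ^ k" using \<epsilon> by (simp add: field_simps not_less)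
    then have lower: "ereal (c * 2 ^ k) \<le> rate_distortion X T \<mu> \<epsilon>" using ge \<epsilon> by simp
    define z where "z = sqrt (sqrt (1 / \<epsilon>))"
    have z: "1 < z" using \<epsilon> by (simp add: z_def)
    have z4: "z ^ 4 = 1 / \<epsilon>"
    proof -
      have "z ^ 4 = ((sqrt (sqrt (1 / \<epsilon>)))\<^sup>2)\<^sup>2" by (simp add: z_def)
      then show ?thesis using \<epsilon> by simp
    qed
    have z2: "z\<^sup>2 = sqrt (1 / \<epsilon>)" using \<epsilon> by (simp add: z_def)
    have "sqrt (a / \<epsilon>) < sqrt (4 ^ m)" using m by simp
    also have "sqrt (4 ^ m) = 2 ^ m"
    proof -
      have "(4::real) ^ m = (2 ^ m)\<^sup>2" by (simp add: power_mult[symmetric] power2_eq_square power_mult_distrib[symmetric])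
      then show ?thesis by simp
    qed
    finally have "sqrt a * z\<^sup>2 < 2 * 2 ^ k"
      using \<epsilon> a by (simp add: k z2 real_sqrt_divide)
    then have "c / 2 * (sqrt a * z\<^sup>2) < c / 2 * (2 * 2 ^ k)" using c by (intro mult_strict_left_mono) auto
    then have l1: "c / 2 * sqrt a * z\<^sup>2 < c * 2 ^ k" by (simp add: algebra_simps)
    have lg: "log 2 (1 / \<epsilon>) \<le> 4 * z / ln 2"
    proof -
      have "ln (1 / \<epsilon>) = 4 * ln z" using z by (simp add: z4[symmetric] ln_realpow)
      also have "ln z \<le> z" using ln_le_minus_one[of z] z by simp
      finally show ?thesis by (simp add: log_def divide_right_mono)
    qed
    have lgpos: "0 < log 2 (1 / \<epsilon>)" using \<epsilon> by simp
    have "1 / \<epsilon> > ((R + 1) / c') ^ 4"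
      using \<epsilon> c' by (simp add: field_simps R_def)
    then have "((R + 1) / c') ^ 4 < z ^ 4" by (simp add: z4)
    then have "(R + 1) / c' < z" by (rule power_less_imp_less_base) (use z in simp)
    then have "R + 1 < c' * z" using c' by (simp add: field_simps)
    then have "(R + 1) * (4 * z / ln 2) < c' * z * (4 * z / ln 2)" using z by (intro mult_strict_right_mono) auto
    also have "\<dots> = c / 2 * sqrt a * z\<^sup>2" by (simp add: c'_def power2_eq_square)
    also note l1
    finally have "(R + 1) * (4 * z / ln 2) < c * 2 ^ k" .
    moreover have "r * log 2 (1 / \<epsilon>) \<le> (R + 1) * (4 * z / ln 2)"
      using lg lgpos by (intro mult_mono) (auto simp: R_def)
    ultimately have "r * log 2 (1 / \<epsilon>) < c * 2 ^ k" by linarith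
    then have "ereal r < ereal (c * 2 ^ k) / ereal (log 2 (1 / \<epsilon>))"
      using lgpos by (simp add: field_simps)
    also have "\<dots> \<le> rate_distortion X T \<mu> \<epsilon> / ereal (log 2 (1 / \<epsilon>))"
      using lower lgpos by (intro ereal_divide_right_mono) auto
    finally show ?case .
  qed
qed

end

section \<open>The space and the flow\<close>

definition dist_Z :: "real \<Rightarrow> real" where
  "dist_Z s = min (s - of_int \<lfloor>s\<rfloor>) (of_int \<lfloor>s\<rfloor> + 1 - s)"

lemma dist_Z_bounds: "0 \<le> dist_Z s" "dist_Z s \<le> 1"
  unfolding dist_Z_def by linarith+

lemma dist_Z_same_floor: "\<lfloor>s\<rfloor> = \<lfloor>t\<rfloor> \<Longrightarrow> dist_Z s \<le> dist_Z t + \<bar>s - t\<bar>"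
  unfolding dist_Z_def by (simp add: min_def abs_if)

text \<open>An integer lies between the two numbers, so their distances to it add up to at most
  their difference.\<close>

lemma dist_Z_diff_floor: "\<lfloor>s\<rfloor> \<noteq> \<lfloor>t\<rfloor> \<Longrightarrow> dist_Z s + dist_Z t \<le> \<bar>s - t\<bar>"
proof -
  have *: "dist_Z s + dist_Z t \<le> t - s" if "\<lfloor>s\<rfloor> < \<lfloor>t\<rfloor>" for s t
  proof -
    have "dist_Z s \<le> of_int \<lfloor>s\<rfloor> + 1 - s" "dist_Z t \<le> t - of_int \<lfloor>t\<rfloor>" by (simp_all add: dist_Z_def)
    moreover have "of_int \<lfloor>s\<rfloor> + 1 \<le> (of_int \<lfloor>t\<rfloor> :: real)" using that by linarith
    ultimately show ?thesis by linarith
  qed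
  assume "\<lfloor>s\<rfloor> \<noteq> \<lfloor>t\<rfloor>"
  then show ?thesis using *[of s t] *[of t s] by linarith
qed

lemma dist_Z_shift: "dist_Z (s + of_int m) = dist_Z s"
  by (simp add: dist_Z_def)

text \<open>The distance from \<open>v\<close> to the walls of its unit cell. As it vanishes on the
  walls, neighbouring cells can carry unrelated bits without breaking continuity.\<close>

definition bump :: "real ^ 'n \<Rightarrow> real" where
  "bump v = Min (range (\<lambda>i. dist_Z (v $ i)))"

definition site :: "real ^ 'n \<Rightarrow> 'n \<Rightarrow> int" where
  "site v i = \<lfloor>v $ i\<rfloor>"

definition field :: "(('n \<Rightarrow> int) \<Rightarrow> bool) \<Rightarrow> real ^ 'n \<Rightarrow> real" where
  "field x v = (if x (site v) then bump v else 0)"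

lemma bump_le: "bump v \<le> dist_Z (v $ i)"
  unfolding bump_def by (rule Min_le) auto

lemma bump_attained: "\<exists>i. bump v = dist_Z (v $ i)"
proof -
  have "Min (range (\<lambda>i. dist_Z (v $ i))) \<in> range (\<lambda>i. dist_Z (v $ i))" by (rule Min_in) auto
  then obtain i where "Min (range (\<lambda>i. dist_Z (v $ i))) = dist_Z (v $ i)" by (rule imageE)
  then show ?thesis unfolding bump_def by (rule exI)
qed

lemma bump_bounds: "0 \<le> bump v" "bump v \<le> 1"
  using bump_attained[of v] dist_Z_bounds by auto

lemma field_bounds: "0 \<le> field x v" "field x v \<le> 1"
  by (auto simp: field_def bump_bounds)

text \<open>The constant 1 is uniform in the bits. Inside a cell the bump is 1-Lipschitz; between
  two cells some wall is crossed, at which both values could have dropped to 0.\<close>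

lemma field_lipschitz: "\<bar>field x v - field x w\<bar> \<le> norm (v - w)"
proof (cases "site v = site w")
  case True
  have *: "bump v \<le> bump w + norm (v - w)" if "site v = site w" for v w :: "real ^ 'n"
  proof -
    obtain i where i: "bump w = dist_Z (w $ i)" using bump_attained by blast
    have "\<lfloor>v $ i\<rfloor> = \<lfloor>w $ i\<rfloor>" using that by (auto simp: site_def fun_eq_iff)
    from dist_Z_same_floor[OF this] bump_le[of v i] i component_le_norm_cart[of "v - w" i]
    show ?thesis by simp
  qed
  from *[OF True] *[OF True[symmetric]] True show ?thesis
    by (auto simp: field_def norm_minus_commute abs_le_iff)
next
  case False
  then obtain i where i: "\<lfloor>v $ i\<rfloor> \<noteq> \<lfloor>w $ i\<rfloor>" by (auto simp: site_def fun_eq_iff)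
  have "field x v \<le> dist_Z (v $ i)" "field x w \<le> dist_Z (w $ i)"
    using bump_le[of v i] bump_le[of w i] dist_Z_bounds by (auto simp: field_def)
  then have "\<bar>field x v - field x w\<bar> \<le> dist_Z (v $ i) + dist_Z (w $ i)"
    using field_bounds(1)[of x v] field_bounds(1)[of x w] dist_Z_bounds(1)[of "v $ i"] dist_Z_bounds(1)[of "w $ i"] by linarith
  also have "\<dots> \<le> \<bar>(v - w) $ i\<bar>" using dist_Z_diff_floor[OF i] by simp
  also have "\<dots> \<le> norm (v - w)" by (rule component_le_norm_cart)
  finally show ?thesis .
qed

text \<open>The phase is added after scaling, so translation by \<open>u\<close> turns
  \<open>t\<close> into \<open>t + 4 ^ k *\<^sub>R u\<close> and leaves the bits alone.\<close>

definition profile :: "nat \<Rightarrow> real ^ 'n \<Rightarrow> (('n \<Rightarrow> int) \<Rightarrow> bool) \<Rightarrow> real ^ 'n \<Rightarrow> real" where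
  "profile k t x v = (1 / 2) ^ k * field x (4 ^ k *\<^sub>R v + t)"

definition profiles :: "(real ^ 'n \<Rightarrow> real) set" where
  "profiles = {profile k t x |k t x. True}"

lemma profile_in [simp]: "profile k t x \<in> profiles"
  by (auto simp: profiles_def)

lemma profile_bounds: "0 \<le> profile k t x v" "profile k t x v \<le> (1 / 2) ^ k" "profile k t x v \<le> 1"
proof -
  show b: "0 \<le> profile k t x v" "profile k t x v \<le> (1 / 2) ^ k"
    using field_bounds unfolding profile_def by (auto intro!: mult_nonneg_nonneg mult_left_le)
  have "(1 / 2 :: real) ^ k \<le> 1" by (rule power_le_one) auto
  with b(2) show "profile k t x v \<le> 1" by linarith
qed

lemma profile_lipschitz:
  "\<bar>profile k t x v - profile k t' x w\<bar> \<le> (1 / 2) ^ k * norm (4 ^ k *\<^sub>R (v - w) + (t - t'))"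
proof -
  have "\<bar>profile k t x v - profile k t' x w\<bar> = (1 / 2) ^ k * \<bar>field x (4 ^ k *\<^sub>R v + t) - field x (4 ^ k *\<^sub>R w + t')\<bar>"
    by (simp add: profile_def abs_mult flip: right_diff_distrib)
  also have "\<dots> \<le> (1 / 2) ^ k * norm ((4 ^ k *\<^sub>R v + t) - (4 ^ k *\<^sub>R w + t'))"
    by (intro mult_left_mono field_lipschitz) auto
  also have "(4 ^ k *\<^sub>R v + t) - (4 ^ k *\<^sub>R w + t') = 4 ^ k *\<^sub>R (v - w) + (t - t')"
    by (simp add: algebra_simps)
  finally show ?thesis .
qed

lemma profile_shift: "profile k t x (v + u) = profile k (t + 4 ^ k *\<^sub>R u) x v"
  by (simp add: profile_def algebra_simps)

lemma profiles_shift: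
  assumes "f \<in> profiles" shows "(\<lambda>v. f (v + u)) \<in> profiles"
proof -
  obtain k t x where "f = profile k t x" using assms by (auto simp: profiles_def)
  then have "(\<lambda>v. f (v + u)) = profile k (t + 4 ^ k *\<^sub>R u) x" by (simp add: profile_shift fun_eq_iff)
  then show ?thesis by simp
qed

lemma profiles_bounds: "f \<in> profiles \<Longrightarrow> 0 \<le> f v \<and> f v \<le> 1"
  using profile_bounds by (auto simp: profiles_def)

lemma profiles_continuous:
  fixes f :: "real ^ 'n \<Rightarrow> real"
  assumes "f \<in> profiles" shows "continuous_on UNIV f"
proof -
  obtain k t x where f: "f = profile k t x" using assms by (auto simp: profiles_def)
  have "(2 ^ k)-lipschitz_on UNIV (profile k t x)"
  proof (rule lipschitz_onI)
    fix v w :: "real ^ 'n"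
    have "(1 / 2) ^ k * (4 :: real) ^ k = 2 ^ k" by (simp flip: power_mult_distrib)
    then show "dist (profile k t x v) (profile k t x w) \<le> 2 ^ k * dist v w"
      using profile_lipschitz[of k t x v t w] by (simp add: dist_norm mult.assoc[symmetric])
  qed simp
  then show ?thesis unfolding f by (rule lipschitz_on_continuous_on)
qed

section \<open>Points as sampled profiles, and the weighted metric\<close>

definition dense_seq :: "nat \<Rightarrow> real ^ 'n" where
  "dense_seq = (SOME q. \<forall>X. open X \<longrightarrow> X \<noteq> {} \<longrightarrow> (\<exists>j. q j \<in> X))"

lemma dense_seq:
  fixes X :: "(real ^ 'n) set"
  assumes "open X" "X \<noteq> {}" shows "\<exists>j. dense_seq j \<in> X"
proof -
  obtain D :: "(real ^ 'n) set" where D: "countable D" "\<And>X. open X \<Longrightarrow> X \<noteq> {} \<Longrightarrow> \<exists>d\<in>D. d \<in> X"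
    using countable_dense_exists by blast
  have "D \<noteq> {}" using D(2)[of UNIV] by auto
  then have "range (from_nat_into D) = D" using D(1) by (rule range_from_nat_into)
  then have "\<exists>q :: nat \<Rightarrow> real ^ 'n. \<forall>X. open X \<longrightarrow> X \<noteq> {} \<longrightarrow> (\<exists>j. q j \<in> X)"
    using D(2) by (intro exI[of _ "from_nat_into D"]) (metis imageE)
  from someI_ex[OF this] assms show ?thesis unfolding dense_seq_def by blast
qed

lemma le_on_dense_seq:
  fixes F :: "real ^ 'n \<Rightarrow> real"
  assumes "continuous_on UNIV F" "\<And>j. F (dense_seq j) \<le> c"
  shows "F v \<le> c"
proof (rule ccontr)
  assume "\<not> F v \<le> c"
  moreover have "open {v. c < F v}" using assms(1) by (intro open_Collect_less continuous_on_const)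
  moreover have "v \<in> {v. c < F v}" using \<open>\<not> F v \<le> c\<close> by simp
  ultimately obtain j where "dense_seq j \<in> {v. c < F v}" using dense_seq[of "{v. c < F v}"] by blast
  with assms(2)[of j] show False by simp
qed

text \<open>Profiles are continuous, hence determined by their values on a dense sequence. Storing
  these values gives points of type \<open>nat \<Rightarrow> real\<close> in every
  dimension.\<close>

definition sample :: "(real ^ 'n \<Rightarrow> real) \<Rightarrow> nat \<Rightarrow> real" where
  "sample f j = f (dense_seq j)"

lemma inj_on_sample: "inj_on sample profiles"
proof (rule inj_onI)
  fix f g :: "real ^ 'n \<Rightarrow> real" assume f: "f \<in> profiles" and g: "g \<in> profiles" and eq: "sample f = sample g"
  have c: "continuous_on UNIV (\<lambda>v. f v - g v)" "continuous_on UNIV (\<lambda>v. g v - f v)"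
    by (intro continuous_on_diff profiles_continuous f g)+
  have "f (dense_seq j) = g (dense_seq j)" for j using fun_cong[OF eq, of j] by (simp add: sample_def)
  then have "f v - g v \<le> 0" "g v - f v \<le> 0" for v
    using le_on_dense_seq[OF c(1), of 0 v] le_on_dense_seq[OF c(2), of 0 v] by simp_all
  then show "f = g" by (intro ext antisym) (simp_all add: algebra_simps)
qed

definition unsample :: "(nat \<Rightarrow> real) \<Rightarrow> real ^ 'n \<Rightarrow> real" where
  "unsample = inv_into profiles sample"

lemma unsample_sample [simp]: "f \<in> profiles \<Longrightarrow> unsample (sample f) = f"
  unfolding unsample_def by (rule inv_into_f_f[OF inj_on_sample])

text \<open>The truncation is inactive on profiles; it makes the supremum finite for all arguments.\<close>

definition weighted_dist :: "(real ^ 'n \<Rightarrow> real) \<Rightarrow> (real ^ 'n \<Rightarrow> real) \<Rightarrow> real" where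
  "weighted_dist f g = (SUP v. exp (- norm v) * min 1 \<bar>f v - g v\<bar>)"

lemma weighted_dist_le:
  assumes "\<And>v. exp (- norm v) * \<bar>f v - g v\<bar> \<le> c" shows "weighted_dist f g \<le> c"
  unfolding weighted_dist_def
proof (rule cSUP_least)
  fix v
  have "exp (- norm v) * min 1 \<bar>f v - g v\<bar> \<le> exp (- norm v) * \<bar>f v - g v\<bar>"
    by (intro mult_left_mono) auto
  with assms[of v] show "exp (- norm v) * min 1 \<bar>f v - g v\<bar> \<le> c" by linarith
qed simp

lemma le_weighted_dist_truncated: "exp (- norm v) * min 1 \<bar>f v - g v\<bar> \<le> weighted_dist f g"
  unfolding weighted_dist_def
proof (rule cSUP_upper[OF UNIV_I])
  have "exp (- norm v) * min 1 \<bar>f v - g v\<bar> \<le> 1 * 1" for v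
    by (intro mult_mono) auto
  then show "bdd_above (range (\<lambda>v. exp (- norm v) * min 1 \<bar>f v - g v\<bar>))"
    by (intro bdd_aboveI[of _ 1]) auto
qed

lemma le_weighted_dist:
  assumes "f \<in> profiles" "g \<in> profiles"
  shows "exp (- norm v) * \<bar>f v - g v\<bar> \<le> weighted_dist f g"
proof -
  have "min 1 \<bar>f v - g v\<bar> = \<bar>f v - g v\<bar>"
    using profiles_bounds[OF assms(1), of v] profiles_bounds[OF assms(2), of v] by auto
  with le_weighted_dist_truncated[of v f g] show ?thesis by simp
qed

lemma Metric_space_weighted_dist: "Metric_space (sample ` (profiles :: (real ^ 'n \<Rightarrow> real) set))
    (\<lambda>a b. weighted_dist (unsample a :: real ^ 'n \<Rightarrow> real) (unsample b))"
proof
  fix a b c :: "nat \<Rightarrow> real"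
  let ?u = "unsample :: (nat \<Rightarrow> real) \<Rightarrow> real ^ 'n \<Rightarrow> real"
  show "weighted_dist (?u a) (?u b) = weighted_dist (?u b) (?u a)"
    unfolding weighted_dist_def by (simp add: abs_minus_commute)
  show "0 \<le> weighted_dist (?u a) (?u b)"
    using le_weighted_dist_truncated[of 0 "?u a" "?u b"] by (rule order_trans[rotated]) simp
  assume "a \<in> sample ` (profiles :: (real ^ 'n \<Rightarrow> real) set)" "b \<in> sample ` (profiles :: (real ^ 'n \<Rightarrow> real) set)"
  then obtain f g :: "real ^ 'n \<Rightarrow> real" where f: "f \<in> profiles" "a = sample f" and g: "g \<in> profiles" "b = sample g" by blast
  show "weighted_dist (?u a) (?u b) = 0 \<longleftrightarrow> a = b"
  proof
    assume "weighted_dist (?u a) (?u b) = 0"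
    then have "exp (- norm v) * \<bar>f v - g v\<bar> \<le> 0" for v
      using le_weighted_dist[OF f(1) g(1), of v] f g by simp
    then have "f v = g v" for v by (simp add: mult_le_0_iff)
    then have "f = g" by (rule ext)
    then show "a = b" using f g by simp
  qed (simp add: weighted_dist_def)
  assume "c \<in> sample ` (profiles :: (real ^ 'n \<Rightarrow> real) set)"
  then obtain h :: "real ^ 'n \<Rightarrow> real" where h: "h \<in> profiles" "c = sample h" by blast
  have "weighted_dist f h \<le> weighted_dist f g + weighted_dist g h"
  proof (rule weighted_dist_le)
    fix v :: "real ^ 'n"
    have "exp (- norm v) * \<bar>f v - h v\<bar> \<le> exp (- norm v) * (\<bar>f v - g v\<bar> + \<bar>g v - h v\<bar>)"
      by (intro mult_left_mono) auto
    also have "\<dots> \<le> weighted_dist f g + weighted_dist g h"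
      using le_weighted_dist[OF f(1) g(1), of v] le_weighted_dist[OF g(1) h(1), of v] by (simp add: distrib_left)
    finally show "exp (- norm v) * \<bar>f v - h v\<bar> \<le> weighted_dist f g + weighted_dist g h" .
  qed
  then show "weighted_dist (?u a) (?u c) \<le> weighted_dist (?u a) (?u b) + weighted_dist (?u b) (?u c)"
    using f g h by simp
qed

text \<open>The argument carries the dimension, which the type of the points no longer
  shows.\<close>

definition flow_space :: "'n::finite itself \<Rightarrow> (nat \<Rightarrow> real) metric" where
  "flow_space _ = metric (sample ` (profiles :: (real ^ 'n \<Rightarrow> real) set),
     \<lambda>a b. weighted_dist (unsample a :: real ^ 'n \<Rightarrow> real) (unsample b))"

definition flow :: "real ^ 'n \<Rightarrow> (nat \<Rightarrow> real) \<Rightarrow> nat \<Rightarrow> real" where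
  "flow u a = sample (\<lambda>v. unsample a (v + u))"

definition point :: "nat \<Rightarrow> real ^ 'n \<Rightarrow> (('n \<Rightarrow> int) \<Rightarrow> bool) \<Rightarrow> nat \<Rightarrow> real" where
  "point k t x = sample (profile k t x)"

text \<open>The layers overlap: the zero function belongs to all of them.\<close>

definition layer :: "'n::finite itself \<Rightarrow> nat \<Rightarrow> (nat \<Rightarrow> real) set" where
  "layer _ k = {point k (t :: real ^ 'n) x |t x. True}"

lemma mspace_flow_space: "mspace (flow_space TYPE('n::finite)) = sample ` (profiles :: (real ^ 'n \<Rightarrow> real) set)"
  unfolding flow_space_def by (rule Metric_space.mspace_metric[OF Metric_space_weighted_dist])

lemma mdist_flow_space: "mdist (flow_space TYPE('n::finite)) a b = weighted_dist (unsample a :: real ^ 'n \<Rightarrow> real) (unsample b)"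
  unfolding flow_space_def by (simp only: Metric_space.mdist_metric[OF Metric_space_weighted_dist])

lemma point_in [simp]: "point k (t :: real ^ 'n) x \<in> mspace (flow_space TYPE('n::finite))"
  by (simp add: mspace_flow_space point_def)

lemma mspace_flow_space_cases:
  assumes "a \<in> mspace (flow_space TYPE('n::finite))"
  obtains k x and t :: "real ^ 'n" where "a = point k t x"
  using assms unfolding mspace_flow_space profiles_def point_def by blast

lemma unsample_point [simp]: "unsample (point k t x) = profile k t x"
  by (simp add: point_def)

lemma flow_point: "flow u (point k t x) = point k (t + 4 ^ k *\<^sub>R u) x"
  unfolding flow_def unsample_point by (simp add: profile_shift point_def)

lemma mdist_point: "mdist (flow_space TYPE('n::finite)) (point k (t :: real ^ 'n) x) (point k' (t' :: real ^ 'n) x')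
    = weighted_dist (profile k t x) (profile k' t' x')"
  by (simp add: mdist_flow_space)

lemma abs_diff_le_mdist:
  assumes "a \<in> mspace (flow_space TYPE('n::finite))" "b \<in> mspace (flow_space TYPE('n))"
  shows "\<bar>(unsample a :: real ^ 'n \<Rightarrow> real) 0 - (unsample b :: real ^ 'n \<Rightarrow> real) 0\<bar> \<le> mdist (flow_space TYPE('n)) a b"
  using assms le_weighted_dist[of "unsample a" "unsample b" "0 :: real ^ 'n"]
  by (auto simp: mspace_flow_space mdist_flow_space)

section \<open>Compactness of the space\<close>

text \<open>Compares amplitudes only; this is what lets high layers shrink to the zero
  function.\<close>

lemma mdist_point_le_scales: "mdist (flow_space TYPE('n::finite)) (point k (t :: real ^ 'n) x) (point k' (t' :: real ^ 'n) x') \<le> (1/2) ^ k + (1/2) ^ k'"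
  unfolding mdist_point
proof (rule weighted_dist_le)
  fix v
  have "exp (- norm v) * \<bar>profile k t x v - profile k' t' x' v\<bar> \<le> 1 * ((1/2) ^ k + (1/2) ^ k')"
    using profile_bounds(1,2)[of k t x v] profile_bounds(1,2)[of k' t' x' v] by (intro mult_mono) auto
  then show "exp (- norm v) * \<bar>profile k t x v - profile k' t' x' v\<bar> \<le> (1/2) ^ k + (1/2) ^ k'" by simp
qed

text \<open>Within radius \<open>R\<close> only bits at sites of size at most \<open>b\<close> are
  visible and the phases account for the difference; beyond it the weight of the metric is below
  \<open>\<delta>\<close>.\<close>

lemma mdist_point_close:
  fixes t t' :: "real ^ 'n"
  assumes agree: "\<And>m. (\<And>i. \<bar>m i\<bar> \<le> b) \<Longrightarrow> x m = x' m"
    and b: "\<And>i. \<bar>t' $ i\<bar> + 4 ^ k * R + 1 \<le> of_int b"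
    and \<delta>: "exp (- R) \<le> \<delta>" "norm (t - t') \<le> \<delta>"
  shows "mdist (flow_space TYPE('n)) (point k t x) (point k t' x') \<le> \<delta>"
  unfolding mdist_point
proof (rule weighted_dist_le)
  fix v :: "real ^ 'n"
  show "exp (- norm v) * \<bar>profile k t x v - profile k t' x' v\<bar> \<le> \<delta>"
  proof (cases "norm v \<le> R")
    case True
    \<comment> \<open>The summand 1 in the hypothesis on \<open>b\<close> absorbs the floor in
      \<open>site\<close>.\<close>
    have s: "\<bar>site (4 ^ k *\<^sub>R v + t') i\<bar> \<le> b" for i
    proof -
      have "\<bar>v $ i\<bar> \<le> R" using component_le_norm_cart[of v i] True by simp
      then have "\<bar>4 ^ k * v $ i\<bar> \<le> 4 ^ k * R" by (simp add: abs_mult)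
      then have "\<bar>(4 ^ k *\<^sub>R v + t') $ i\<bar> + 1 \<le> of_int b" using b[of i] by simp
      then show ?thesis unfolding site_def by linarith
    qed
    have "profile k t' x v = profile k t' x' v"
      unfolding profile_def field_def using agree[of "site (4 ^ k *\<^sub>R v + t')"] s by simp
    then have "\<bar>profile k t x v - profile k t' x' v\<bar> \<le> (1/2) ^ k * norm (t - t')"
      using profile_lipschitz[of k t x v t' v] by simp
    also have "\<dots> \<le> 1 * norm (t - t')" by (intro mult_right_mono power_le_one) auto
    finally have d: "\<bar>profile k t x v - profile k t' x' v\<bar> \<le> \<delta>" using \<delta> by simp
    have "exp (- norm v) * \<bar>profile k t x v - profile k t' x' v\<bar> \<le> 1 * \<bar>profile k t x v - profile k t' x' v\<bar>"
      by (intro mult_right_mono) auto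
    with d show ?thesis by (simp only: mult_1 order_trans)
  next
    case False
    have "exp (- norm v) * \<bar>profile k t x v - profile k t' x' v\<bar> \<le> exp (- R) * 1"
      using False profile_bounds(1,3)[of k t x v] profile_bounds(1,3)[of k t' x' v] by (intro mult_mono) auto
    then show ?thesis using \<delta> by simp
  qed
qed

text \<open>An integer phase is the same as a shift of the bits. This confines phases to the unit
  cube and later carries the shift invariance of the coins over to the phase.\<close>

lemma point_integer_shift:
  fixes t :: "real ^ 'n"
  shows "point k (t + (\<chi> i. of_int (m i))) x = point k t (\<lambda>s. x (\<lambda>i. s i + m i))"
proof -
  have site: "site (w + (\<chi> i. of_int (m i))) = (\<lambda>i. site w i + m i)" for w :: "real ^ 'n"
    by (rule ext) (simp add: site_def)
  have bump: "bump (w + (\<chi> i. of_int (m i))) = bump w" for w :: "real ^ 'n"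
    by (simp add: bump_def dist_Z_shift)
  have "profile k (t + (\<chi> i. of_int (m i))) x v = profile k t (\<lambda>s. x (\<lambda>i. s i + m i)) v" for v
    unfolding profile_def field_def add.assoc[symmetric] site bump ..
  then have "profile k (t + (\<chi> i. of_int (m i))) x = profile k t (\<lambda>s. x (\<lambda>i. s i + m i))" by (rule ext)
  then show ?thesis unfolding point_def by (rule arg_cong)
qed

lemma point_reduce:
  fixes t :: "real ^ 'n"
  shows "\<exists>t' :: real ^ 'n. \<exists>x'. t' \<in> cube 1 \<and> point k t x = point k t' x'"
proof -
  let ?t = "(\<chi> i. frac (t $ i)) :: real ^ 'n"
  have "t = ?t + (\<chi> i. of_int \<lfloor>t $ i\<rfloor>)" by (simp add: vec_eq_iff frac_def)
  then have "point k t x = point k (?t + (\<chi> i. of_int \<lfloor>t $ i\<rfloor>)) x" by simp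
  also have "\<dots> = point k ?t (\<lambda>s. x (\<lambda>i. s i + \<lfloor>t $ i\<rfloor>))" by (rule point_integer_shift)
  finally have "point k t x = \<dots>" .
  moreover have "?t \<in> cube 1" by (simp add: cube_def frac_lt_1)
  ultimately show ?thesis by blast
qed

lemma layer_eq: "layer TYPE('n::finite) k = (\<lambda>(t, x). point k t x) ` (cbox 0 (\<chi> i. 1) \<times> (UNIV :: (('n \<Rightarrow> int) \<Rightarrow> bool) set))"
  (is "_ = ?R")
proof
  show "layer TYPE('n) k \<subseteq> ?R"
  proof
    fix a assume "a \<in> layer TYPE('n) k"
    then obtain t :: "real ^ 'n" and x where "a = point k t x" by (auto simp: layer_def)
    then obtain t' :: "real ^ 'n" and x' where *: "t' \<in> cube 1" "a = point k t' x'" using point_reduce by metis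
    then have "t' \<in> cbox 0 (\<chi> i. 1)" by (simp add: cube_def mem_box_cart less_imp_le)
    then show "a \<in> ?R"
      using * by (intro image_eqI[of _ _ "(t', x')"]) auto
  qed
qed (auto simp: layer_def)

lemma finite_int_box: "finite {m :: 'n::finite \<Rightarrow> int. \<forall>i. \<bar>m i\<bar> \<le> b}"
  and card_int_box: "card {m :: 'n::finite \<Rightarrow> int. \<forall>i. \<bar>m i\<bar> \<le> b} = nat (2 * b + 1) ^ CARD('n)"
proof -
  have eq: "{m :: 'n \<Rightarrow> int. \<forall>i. \<bar>m i\<bar> \<le> b} = PiE UNIV (\<lambda>_. {-b..b})"
    by (auto simp: PiE_UNIV_domain Pi_iff abs_le_iff minus_le_iff)
  show "finite {m :: 'n \<Rightarrow> int. \<forall>i. \<bar>m i\<bar> \<le> b}" unfolding eq by (rule finite_PiE) auto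
  show "card {m :: 'n \<Rightarrow> int. \<forall>i. \<bar>m i\<bar> \<le> b} = nat (2 * b + 1) ^ CARD('n)"
    unfolding eq by (simp add: card_PiE)
qed

text \<open>A layer is the continuous image of a closed cube times a product of two-point spaces,
  compact by Tychonoff; continuity holds since only finitely many bits matter up to a given
  error.\<close>

lemma compactin_layer: "compactin (mtopology_of (flow_space TYPE('n::finite))) (layer TYPE('n) k)"
proof -
  let ?C = "cbox 0 (\<chi> i. 1) :: (real ^ 'n) set"
  let ?A = "subtopology euclidean ?C"
  let ?B = "product_topology (\<lambda>_ :: 'n \<Rightarrow> int. discrete_topology (UNIV :: bool set)) UNIV"
  let ?X = "flow_space TYPE('n)"
  have "compact_space (prod_topology ?A ?B)"
    by (auto simp: compact_space_prod_topology compact_space_product_topology compact_space_discrete_topology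
      compact_space_subtopology)
  then have c: "compactin (prod_topology ?A ?B) (topspace (prod_topology ?A ?B))"
    by (simp add: compact_space_def)
  have "continuous_map (prod_topology ?A ?B) (mtopology_of ?X) (\<lambda>(t, x). point k t x)"
    unfolding continuous_map_def
  proof (intro conjI allI impI)
    fix U assume "openin (mtopology_of ?X) U"
    then have U: "U \<subseteq> mspace ?X" "\<And>a. a \<in> U \<Longrightarrow> \<exists>r>0. \<forall>c\<in>mspace ?X. mdist ?X a c < r \<longrightarrow> c \<in> U"
      by (auto simp: openin_mtopology_of)
    show "openin (prod_topology ?A ?B) {p \<in> topspace (prod_topology ?A ?B). (case p of (t, x) \<Rightarrow> point k t x) \<in> U}" (is "openin _ ?S")
      unfolding openin_prod_topology_alt
    proof (intro allI impI)
      fix t :: "real ^ 'n" and x assume "(t, x) \<in> ?S"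
      then have tC: "t \<in> ?C" and tU: "point k t x \<in> U" by auto
      obtain r where r: "r > 0" "\<And>c. c \<in> mspace ?X \<Longrightarrow> mdist ?X (point k t x) c < r \<Longrightarrow> c \<in> U"
        using U(2)[OF tU] by blast
      define \<delta> where "\<delta> = r / 2"
      have \<delta>: "0 < \<delta>" "\<delta> < r" using r by (simp_all add: \<delta>_def)
      define R where "R = - ln \<delta>"
      \<comment> \<open>The first 1 bounds the phase on the closed unit cube, the last one pays for
        the floor.\<close>
      define b where "b = \<lceil>1 + 4 ^ k * R + 1\<rceil>"
      define S where "S = {m :: 'n \<Rightarrow> int. \<forall>i. \<bar>m i\<bar> \<le> b}"
      have S: "finite S" unfolding S_def by (rule finite_int_box)
      define V where "V = ?C \<inter> ball t \<delta>"
      define W where "W = PiE UNIV (\<lambda>m. if m \<in> S then {x m} else UNIV)"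
      have "openin ?A V" unfolding V_def by (auto simp: openin_subtopology)
      moreover have "openin ?B W"
        unfolding W_def
      proof (rule product_topology_basis)
        have "{m. (if m \<in> S then {x m} else UNIV) \<noteq> topspace (discrete_topology (UNIV :: bool set))} \<subseteq> S" by auto
        then show "finite {m. (if m \<in> S then {x m} else UNIV) \<noteq> topspace (discrete_topology (UNIV :: bool set))}"
          using S by (rule finite_subset)
      qed simp
      moreover have "t \<in> V" "x \<in> W" using tC \<delta> by (auto simp: V_def W_def)
      moreover have "V \<times> W \<subseteq> ?S"
      proof clarsimp
        fix t' x' assume t': "t' \<in> V" and x': "x' \<in> W"
        have "mdist ?X (point k t x) (point k t' x') \<le> \<delta>"
        proof (rule mdist_point_close[where b=b and R=R])
          show "x m = x' m" if "\<And>i. \<bar>m i\<bar> \<le> b" for m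
          proof -
            have "m \<in> S" using that by (simp add: S_def)
            then show ?thesis using x' by (auto simp: W_def PiE_iff split: if_splits)
          qed
          show "\<bar>t' $ i\<bar> + 4 ^ k * R + 1 \<le> of_int b" for i
          proof -
            have "\<bar>t' $ i\<bar> \<le> 1" using t' by (auto simp: V_def mem_box_cart)
            moreover have "1 + 4 ^ k * R + 1 \<le> of_int b" unfolding b_def by (rule le_of_int_ceiling)
            ultimately show ?thesis by linarith
          qed
          show "exp (- R) \<le> \<delta>" using \<delta> by (simp add: R_def)
          show "norm (t - t') \<le> \<delta>" using t' by (auto simp: V_def dist_norm)
        qed
        then have "point k t' x' \<in> U" using \<delta> by (intro r(2)) auto
        then show "t' \<in> ?C \<and> point k t' x' \<in> U" using t' by (auto simp: V_def)
      qed
      ultimately show "\<exists>V W. openin ?A V \<and> openin ?B W \<and> t \<in> V \<and> x \<in> W \<and> V \<times> W \<subseteq> ?S" by blast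
    qed
  qed auto
  from image_compactin[OF c this] show ?thesis
    by (simp add: layer_eq)
qed

lemma layer_subset: "layer TYPE('n::finite) k \<subseteq> mspace (flow_space TYPE('n))"
  by (auto simp: layer_def)

lemma Union_layer: "(\<Union>k. layer TYPE('n::finite) k) = mspace (flow_space TYPE('n))"
  using layer_subset by (fastforce simp: layer_def elim: mspace_flow_space_cases)

text \<open>A member of the cover that contains the zero function swallows all but finitely many
  layers, and those remaining are compact.\<close>

lemma compact_flow_space: "compact_space (mtopology_of (flow_space TYPE('n::finite)))"
proof -
  let ?X = "flow_space TYPE('n)"
  have "compactin (mtopology_of ?X) (mspace ?X)"
    unfolding compactin_def
  proof (intro conjI allI impI)
    fix \<U> assume \<U>: "Ball \<U> (openin (mtopology_of ?X)) \<and> mspace ?X \<subseteq> \<Union> \<U>"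
    let ?z = "point 0 (0 :: real ^ 'n) (\<lambda>_. False)"
    \<comment> \<open>With all bits off, the zero function can be regarded as a point of the very
      layer with which it is compared.\<close>
    have z: "?z = point k (0 :: real ^ 'n) (\<lambda>_. False)" for k
      unfolding point_def by (rule arg_cong[where f=sample]) (auto simp: profile_def field_def)
    have "?z \<in> mspace ?X" by (rule point_in)
    then obtain U where U: "U \<in> \<U>" "?z \<in> U" using \<U> by blast
    then obtain r where r: "r > 0" "\<And>c. c \<in> mspace ?X \<Longrightarrow> mdist ?X ?z c < r \<Longrightarrow> c \<in> U"
      using \<U> unfolding openin_mtopology_of by meson
    obtain K where K: "(1/2 :: real) ^ K < r / 2" using r real_arch_pow_inv[of "r/2" "1/2"] by auto
    have "compactin (mtopology_of ?X) (\<Union>k<K. layer TYPE('n) k)"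
      by (intro compactin_Union) (auto simp: compactin_layer)
    moreover have "(\<Union>k<K. layer TYPE('n) k) \<subseteq> \<Union> \<U>" using layer_subset \<U> by blast
    ultimately obtain \<F> where \<F>: "finite \<F>" "\<F> \<subseteq> \<U>" "(\<Union>k<K. layer TYPE('n) k) \<subseteq> \<Union> \<F>"
      using \<U> unfolding compactin_def by meson
    have "mspace ?X \<subseteq> \<Union> (insert U \<F>)"
    proof
      fix a assume a: "a \<in> mspace ?X"
      then obtain k x and t :: "real ^ 'n" where a_eq: "a = point k t x" by (rule mspace_flow_space_cases)
      show "a \<in> \<Union> (insert U \<F>)"
      proof (cases "k < K")
        case True
        then have "a \<in> (\<Union>k<K. layer TYPE('n) k)" using a_eq by (auto simp: layer_def)
        then show ?thesis using \<F> by auto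
      next
        case False
        have "mdist ?X ?z a \<le> (1/2) ^ k + (1/2) ^ k"
          unfolding a_eq z[of k] by (rule mdist_point_le_scales)
        also have "(1/2 :: real) ^ k \<le> (1/2) ^ K" using False by (intro power_decreasing) auto
        finally have "mdist ?X ?z a < r" using K by simp
        then show ?thesis using r(2)[OF a] by simp
      qed
    qed
    then show "\<exists>\<F>. finite \<F> \<and> \<F> \<subseteq> \<U> \<and> mspace ?X \<subseteq> \<Union> \<F>"
      using \<F> U by (intro exI[of _ "insert U \<F>"]) auto
  qed simp
  then show ?thesis by (simp add: compact_space_def)
qed

section \<open>The translation action\<close>

text \<open>Translating by \<open>u\<close> changes the exponential weight by a factor of at most
  \<open>exp (norm u)\<close>.\<close>

lemma flow_lipschitz:
  fixes u :: "real ^ 'n"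
  assumes "a \<in> mspace (flow_space TYPE('n))" "b \<in> mspace (flow_space TYPE('n))"
  shows "mdist (flow_space TYPE('n)) (flow u a) (flow u b) \<le> exp (norm u) * mdist (flow_space TYPE('n)) a b"
proof -
  obtain f g :: "real ^ 'n \<Rightarrow> real" where f: "f \<in> profiles" "a = sample f" and g: "g \<in> profiles" "b = sample g"
    using assms by (auto simp: mspace_flow_space)
  have "weighted_dist (\<lambda>v. f (v + u)) (\<lambda>v. g (v + u)) \<le> exp (norm u) * weighted_dist f g"
  proof (rule weighted_dist_le)
    fix v
    have "- norm v \<le> norm u + - norm (v + u)" using norm_triangle_ineq[of v u] by linarith
    then have "exp (- norm v) \<le> exp (norm u) * exp (- norm (v + u))" by (simp flip: exp_add)
    then have "exp (- norm v) * \<bar>f (v + u) - g (v + u)\<bar> \<le> exp (norm u) * exp (- norm (v + u)) * \<bar>f (v + u) - g (v + u)\<bar>"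
      by (rule mult_right_mono) simp
    also have "\<dots> \<le> exp (norm u) * weighted_dist f g"
      using le_weighted_dist[OF f(1) g(1), of "v + u"] by (simp add: mult.assoc)
    finally show "exp (- norm v) * \<bar>f (v + u) - g (v + u)\<bar> \<le> exp (norm u) * weighted_dist f g" .
  qed
  then show ?thesis using f g by (simp add: mdist_flow_space flow_def profiles_shift)
qed

lemma mdist_point_time: "mdist (flow_space TYPE('n::finite)) (point k t x) (point k (t' :: real ^ 'n) x) \<le> norm (t - t')"
  unfolding mdist_point
proof (rule weighted_dist_le)
  fix v :: "real ^ 'n"
  have "exp (- norm v) * \<bar>profile k t x v - profile k t' x v\<bar> \<le> 1 * ((1/2) ^ k * norm (t - t'))"
    using profile_lipschitz[of k t x v t' v] by (intro mult_mono) auto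
  also have "\<dots> \<le> 1 * (1 * norm (t - t'))" by (intro mult_left_mono mult_right_mono power_le_one) auto
  finally show "exp (- norm v) * \<bar>profile k t x v - profile k t' x v\<bar> \<le> norm (t - t')" by simp
qed

lemma flow_in: "a \<in> mspace (flow_space TYPE('n)) \<Longrightarrow> flow (u :: real ^ 'n::finite) a \<in> mspace (flow_space TYPE('n))"
  by (erule mspace_flow_space_cases) (simp add: flow_point)

text \<open>The bound for the motion in time is \<open>4 ^ k\<close>, which is unbounded over the
  layers. It is therefore applied to the base point only, and the Lipschitz bound then passes to its
  neighbours.\<close>

lemma continuous_action_flow: "continuous_action (flow_space TYPE('n::finite)) (flow :: real ^ 'n \<Rightarrow> _)"
  unfolding continuous_action_def
proof (intro conjI ballI allI)
  let ?X = "flow_space TYPE('n)"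
  show "continuous_map (prod_topology euclidean (mtopology_of ?X)) (mtopology_of ?X) (\<lambda>(u :: real ^ 'n, a). flow u a)"
    unfolding continuous_map_def
  proof (intro conjI allI impI)
    fix U assume "openin (mtopology_of ?X) U"
    then have U: "U \<subseteq> mspace ?X" "\<And>a. a \<in> U \<Longrightarrow> \<exists>r>0. \<forall>c\<in>mspace ?X. mdist ?X a c < r \<longrightarrow> c \<in> U"
      by (auto simp: openin_mtopology_of)
    let ?D = "prod_topology euclidean (mtopology_of ?X) :: ((real ^ 'n) \<times> (nat \<Rightarrow> real)) topology"
    show "openin ?D {p \<in> topspace ?D. (case p of (u, a) \<Rightarrow> flow u a) \<in> U}" (is "openin _ ?S")
      unfolding openin_prod_topology_alt
    proof (intro allI impI)
      fix u :: "real ^ 'n" and a assume "(u, a) \<in> ?S"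
      then have a: "a \<in> mspace ?X" and aU: "flow u a \<in> U" by auto
      obtain r where r: "r > 0" "\<And>c. c \<in> mspace ?X \<Longrightarrow> mdist ?X (flow u a) c < r \<Longrightarrow> c \<in> U"
        using U(2)[OF aU] by blast
      obtain k x and t :: "real ^ 'n" where a_eq: "a = point k t x" using a by (rule mspace_flow_space_cases)
      \<comment> \<open>Each of the two motions may use \<open>r / 2\<close>. The cap 1 keeps
        \<open>norm u'\<close> below \<open>norm u + 1\<close>, from which \<open>e2\<close> takes
        its Lipschitz constant.\<close>
      define e1 where "e1 = min 1 (r / (2 * 4 ^ k))"
      define e2 where "e2 = r / (2 * exp (norm u + 1))"
      have e: "0 < e1" "0 < e2" using r by (simp_all add: e1_def e2_def)
      define V where "V = {c \<in> mspace ?X. mdist ?X a c < e2}"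
      have "openin (mtopology_of ?X) V" unfolding V_def using a by (rule openin_mtopology_of_mball)
      moreover have "openin euclidean (ball u e1)" "u \<in> ball u e1" "a \<in> V"
        using e a mdist_zero[of a ?X a] by (simp_all add: V_def del: mdist_zero)
      moreover have "ball u e1 \<times> V \<subseteq> ?S"
      proof clarsimp
        fix u' c assume u': "dist u u' < e1" and c: "c \<in> V"
        have cX: "c \<in> mspace ?X" using c by (simp add: V_def)
        have "mdist ?X (flow u a) (flow u' a) \<le> norm (4 ^ k *\<^sub>R (u - u'))"
          unfolding a_eq flow_point using mdist_point_time[of k "t + 4 ^ k *\<^sub>R u" x "t + 4 ^ k *\<^sub>R u'"]
          by (simp add: algebra_simps)
        also have "\<dots> < 4 ^ k * e1" using u' by (simp add: dist_norm)
        also have "\<dots> \<le> 4 ^ k * (r / (2 * 4 ^ k))" by (intro mult_left_mono) (auto simp: e1_def)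
        finally have d1: "mdist ?X (flow u a) (flow u' a) < r / 2" by simp
        have "norm u' \<le> norm u + 1"
          using u' norm_triangle_ineq2[of u' u] by (simp add: e1_def dist_norm norm_minus_commute)
        then have "exp (norm u') * mdist ?X a c \<le> exp (norm u + 1) * e2"
          using c by (intro mult_mono) (auto simp: V_def)
        then have d2: "mdist ?X (flow u' a) (flow u' c) \<le> r / 2"
          using flow_lipschitz[OF a cX, of u'] by (simp add: e2_def)
        have "mdist ?X (flow u a) (flow u' c) \<le> mdist ?X (flow u a) (flow u' a) + mdist ?X (flow u' a) (flow u' c)"
          using a cX by (intro mdist_triangle flow_in)
        then have "flow u' c \<in> U" using d1 d2 cX by (intro r(2) flow_in) auto
        then show "c \<in> mspace ?X \<and> flow u' c \<in> U" using cX by simp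
      qed
      ultimately show "\<exists>V W. openin euclidean V \<and> openin (mtopology_of ?X) W \<and> u \<in> V \<and> a \<in> W \<and> V \<times> W \<subseteq> ?S"
        by (intro exI[of _ "ball u e1"] exI[of _ V] conjI)
    qed
  next
    show "(\<lambda>(u :: real ^ 'n, a). flow u a) \<in> topspace (prod_topology euclidean (mtopology_of ?X)) \<rightarrow> topspace (mtopology_of ?X)"
    proof (rule funcsetI)
      fix p :: "(real ^ 'n) \<times> (nat \<Rightarrow> real)" assume "p \<in> topspace (prod_topology euclidean (mtopology_of ?X))"
      then have "snd p \<in> mspace ?X" by (simp add: mem_Times_iff)
      from flow_in[OF this, of "fst p"]
      show "(case p of (u, a) \<Rightarrow> flow u a) \<in> topspace (mtopology_of ?X)" by (simp add: split_beta)
    qed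
  qed
next
  fix a assume "a \<in> mspace (flow_space TYPE('n))"
  then obtain k x and t :: "real ^ 'n" where "a = point k t x" by (rule mspace_flow_space_cases)
  then show "flow (0 :: real ^ 'n) a = a" "\<And>u v :: real ^ 'n. flow (u + v) a = flow u (flow v a)"
    by (simp_all add: flow_point algebra_simps)
qed

lemma lipschitz_action_flow: "lipschitz_action (flow_space TYPE('n::finite)) (flow :: real ^ 'n \<Rightarrow> _)"
  by unfold_locales (rule compact_flow_space continuous_action_flow flow_lipschitz; assumption)+

lemma invariant_action_flow:
  assumes "\<nu> \<in> invariant_measures (flow_space TYPE('n::finite)) (flow :: real ^ 'n \<Rightarrow> _)"
  shows "invariant_action (flow_space TYPE('n)) (flow :: real ^ 'n \<Rightarrow> _) \<nu>"
  using lipschitz_action_flow assms by (intro invariant_action.intro invariant_action_axioms.intro)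

section \<open>Ergodic measures\<close>

lemma cube_1_net:
  assumes "0 < \<delta>"
  shows "\<exists>N :: (real ^ 'n) set. finite N \<and> N \<subseteq> cbox 0 (\<chi> i. 1) \<and> (\<forall>t\<in>cube 1. \<exists>t'\<in>N. norm (t - t') \<le> \<delta>)"
proof -
  let ?C = "cbox 0 (\<chi> i. 1) :: (real ^ 'n) set"
  have c: "seq_compact ?C" by (rule compact_imp_seq_compact) (rule compact_cbox)
  obtain N :: "(real ^ 'n) set" where N: "finite N" "N \<subseteq> ?C" "?C \<subseteq> (\<Union>x\<in>N. ball x \<delta>)"
    using seq_compact_imp_totally_bounded[OF c, rule_format, OF assms] by (elim exE conjE)
  have "\<exists>t'\<in>N. norm (t - t') \<le> \<delta>" if "t \<in> cube 1" for t
  proof -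
    have "t \<in> ?C" using that by (simp add: cube_def mem_box_cart less_imp_le)
    then obtain t' where "t' \<in> N" "t \<in> ball t' \<delta>" using N(3) by blast
    then show ?thesis by (intro bexI[of _ t']) (auto simp: dist_norm norm_minus_commute)
  qed
  with N(1,2) show ?thesis by blast
qed

text \<open>A layer has finite entropy: on a cube of side \<open>L\<close> an orbit is determined up to a small error by
  its phase and by the bits in a box with \<open>(4 \<cdot> 4\<^sup>k L)\<^sup>d\<close> sites.\<close>

lemma rate_distortion_layer_le:
  fixes \<nu> :: "(nat \<Rightarrow> real) measure"
  assumes \<nu>: "\<nu> \<in> invariant_measures (flow_space TYPE('n::finite)) (flow :: real ^ 'n \<Rightarrow> _)"
    and layer: "measure \<nu> (layer TYPE('n) k) = 1" and \<epsilon>: "0 < \<epsilon>"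
  shows "rate_distortion (flow_space TYPE('n)) (flow :: real ^ 'n \<Rightarrow> _) \<nu> \<epsilon> \<le> ereal ((4 * 4 ^ k) ^ CARD('n) + 1)"
proof -
  let ?X = "flow_space TYPE('n)"
  interpret invariant_action ?X "flow :: real ^ 'n \<Rightarrow> _" \<nu>
    using \<nu> by (rule invariant_action_flow)
  define \<delta> where "\<delta> = \<epsilon> / 2"
  have \<delta>: "0 < \<delta>" "\<delta> < \<epsilon>" using \<epsilon> by (simp_all add: \<delta>_def)
  define R where "R = max 0 (- ln \<delta>)"
  have R: "0 \<le> R" "exp (- R) \<le> \<delta>"
  proof -
    have "exp (- R) \<le> exp (ln \<delta>)" by (simp add: R_def)
    then show "exp (- R) \<le> \<delta>" using \<delta> by simp
  qed (simp add: R_def)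
  obtain N :: "(real ^ 'n) set" where N: "finite N" "N \<subseteq> cbox 0 (\<chi> i. 1)" "\<And>t. t \<in> cube 1 \<Longrightarrow> \<exists>t'\<in>N. norm (t - t') \<le> \<delta>"
    using cube_1_net[OF \<delta>(1)] by blast
  \<comment> \<open>The first bound makes the margin around the cube negligible against
    \<open>L\<close>, the second makes the phase net cost at most one bit per volume.\<close>
  define L where "L = max (R + 4) (log 2 (real (card N)))"
  have L: "R + 4 \<le> L" "log 2 (real (card N)) \<le> L" by (simp_all add: L_def)
  then have L0: "0 < L" "1 \<le> L" using R by simp_all
  define M :: real where "M = 4 ^ k"
  have M: "1 \<le> M" unfolding M_def by simp
  \<comment> \<open>Sites that matter: 1 for the phase, \<open>M * L\<close> for translations in the
    cube, \<open>M * R\<close> for the window of the metric, 1 for the floor.\<close>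
  define b where "b = \<lceil>1 + M * L + M * R + 1\<rceil>"
  have b: "1 + M * L + M * R + 1 \<le> of_int b" "of_int b \<le> 1 + M * L + M * R + 2"
    unfolding b_def by linarith+
  define Box where "Box = {m :: 'n \<Rightarrow> int. \<forall>i. \<bar>m i\<bar> \<le> b}"
  have Box: "finite Box" "card Box = nat (2 * b + 1) ^ CARD('n)"
    by (simp_all add: Box_def finite_int_box card_int_box)
  \<comment> \<open>One code word for every phase in the net and every bit pattern in the box;
    outside the box the bits of the code word are off.\<close>
  define I where "I = N \<times> Pow Box"
  have I: "finite I" "card I = card N * 2 ^ card Box"
    using N(1) Box(1) by (simp_all add: I_def card_cartesian_product card_Pow)
  obtain h where h: "bij_betw h {0..<card I} I" using ex_bij_betw_nat_finite[OF I(1)] by blast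
  define f :: "nat \<Rightarrow> real ^ 'n \<Rightarrow> nat \<Rightarrow> real" where "f i u = flow u (point k (fst (h i)) (\<lambda>m. m \<in> snd (h i)))" for i u
  have fL1: "f i \<in> L1_maps L ?X" for i
    unfolding f_def by (rule orbit_L1_maps) (rule point_in)
  have close: "\<exists>i<card I. distortion L a (f i) \<le> \<delta> * L ^ CARD('n)" if a_layer: "a \<in> layer TYPE('n) k" for a
  proof -
    obtain t0 :: "real ^ 'n" and x0 where "a = point k t0 x0" using a_layer by (auto simp: layer_def)
    then obtain t :: "real ^ 'n" and x where t: "t \<in> cube 1" and a: "a = point k t x" using point_reduce by metis
    obtain t' where t': "t' \<in> N" "norm (t - t') \<le> \<delta>" using N(3)[OF t] by blast
    have "(t', {m \<in> Box. x m}) \<in> I" using t' by (auto simp: I_def)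
    then obtain i where i: "i < card I" "h i = (t', {m \<in> Box. x m})"
      using h by (force simp: bij_betw_def)
    have aX: "a \<in> mspace ?X" unfolding a by (rule point_in)
    have "distortion L a (f i) \<le> distortion L a (\<lambda>u. flow u a) + L ^ CARD('n) * \<delta>"
    proof (rule distortion_mono_const[OF less_imp_le[OF L0(1)] aX aX fL1 orbit_L1_maps[OF aX]])
      fix u :: "real ^ 'n" assume u: "u \<in> cube L"
      have "mdist ?X (flow u a) (f i u) \<le> \<delta>"
        unfolding a f_def i(2) fst_conv snd_conv flow_point
      proof (rule mdist_point_close[where b=b and R=R])
        show "x m = (m \<in> {m \<in> Box. x m})" if "\<And>i. \<bar>m i\<bar> \<le> b" for m using that by (simp add: Box_def)
        show "\<bar>(t' + 4 ^ k *\<^sub>R u) $ i\<bar> + 4 ^ k * R + 1 \<le> of_int b" for i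
        proof -
          have "\<bar>t' $ i\<bar> \<le> 1" using t'(1) N(2) by (auto simp: mem_box_cart subset_iff)
          moreover have "0 \<le> u $ i" "u $ i \<le> L" using u by (simp_all add: cube_def less_imp_le)
          then have "\<bar>M * u $ i\<bar> \<le> M * L" using M by (simp add: abs_mult)
          moreover have "\<bar>t' $ i + M * u $ i\<bar> \<le> \<bar>t' $ i\<bar> + \<bar>M * u $ i\<bar>" by (rule abs_triangle_ineq)
          ultimately have "\<bar>t' $ i + M * u $ i\<bar> + M * R + 1 \<le> of_int b" using b(1) by linarith
          then show ?thesis by (simp add: M_def)
        qed
        show "exp (- R) \<le> \<delta>" by (rule R)
        show "norm (t + 4 ^ k *\<^sub>R u - (t' + 4 ^ k *\<^sub>R u)) \<le> \<delta>" using t'(2) by simp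
      qed
      then show "mdist ?X (flow u a) (f i u) \<le> mdist ?X (flow u a) (flow u a) + \<delta>"
        using mdist_nonneg[of ?X "flow u a" "flow u a"] by linarith
    qed
    also have "distortion L a (\<lambda>u. flow u a) = 0"
      using aX mdist_zero[of "flow u a" ?X "flow u a" for u :: "real ^ 'n"] by (simp add: distortion_def del: mdist_zero)
    finally show ?thesis using i(1) by (intro exI[of _ i]) (simp add: mult.commute)
  qed
  \<comment> \<open>A set outside the sigma-algebra would have measure 0.\<close>
  have lay: "layer TYPE('n) k \<in> sets \<nu>"
    using layer measure_notin_sets by fastforce
  have "rate_distortion ?X (flow :: real ^ 'n \<Rightarrow> _) \<nu> \<epsilon> \<le> ereal (log 2 (real (card I)) / L ^ CARD('n))"
    using \<delta> L0 by (intro rate_distortion_le_cover[OF L0(1) lay layer fL1 close]) auto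
  also have "\<dots> \<le> ereal ((4 * 4 ^ k) ^ CARD('n) + 1)"
  proof -
    have "N \<noteq> {}" using N(3)[of 0] by (auto simp: cube_def)
    then have "0 < real (card N)" using N(1) by (simp add: card_gt_0_iff)
    then have "log 2 (real (card I)) = log 2 (real (card N)) + real (card Box)"
      by (simp add: I(2) log_mult log_nat_power)
    moreover have "real (card Box) \<le> (4 * M * L) ^ CARD('n)"
    proof -
      have "0 \<le> M * L + M * R" using M L0 R by simp
      then have b0: "0 \<le> 2 * b + 1" using b(1) by linarith
      \<comment> \<open>\<open>2 * b + 1\<close> is at most
        \<open>2 * M * L + 2 * M * R + 7\<close>, and the last two summands together are at most
        \<open>2 * M * L\<close>.\<close>
      have "M * (R + 4) \<le> M * L" using L(1) M by (intro mult_left_mono) auto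
      then have "of_int (2 * b + 1) \<le> 4 * M * L" using b(2) M by (simp add: distrib_left)
      then have "real (nat (2 * b + 1)) \<le> 4 * M * L" using b0 by simp
      then show ?thesis unfolding Box(2) of_nat_power by (intro power_mono) auto
    qed
    moreover have "log 2 (real (card N)) \<le> L ^ CARD('n)"
      using L(2) L0(2) self_le_power[of L "CARD('n)"] by simp
    ultimately have "log 2 (real (card I)) \<le> ((4 * M) ^ CARD('n) + 1) * L ^ CARD('n)"
      by (simp add: power_mult_distrib distrib_right)
    then show ?thesis using L0 by (simp add: M_def field_simps)
  qed
  finally show ?thesis .
qed

lemma layer_sets: "layer TYPE('n::finite) k \<in> sets (metric_borel (flow_space TYPE('n)))"
proof (rule closedin_sets_metric_borel)
  have "Hausdorff_space (mtopology_of (flow_space TYPE('n)))"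
    unfolding mtopology_of_def by (rule Metric_space.Hausdorff_space_mtopology) simp
  then show "closedin (mtopology_of (flow_space TYPE('n))) (layer TYPE('n) k)"
    using compactin_layer by (rule compactin_imp_closedin)
qed

lemma flow_layer: "flow (u :: real ^ 'n) ` layer TYPE('n::finite) k = layer TYPE('n) k"
proof
  show "layer TYPE('n) k \<subseteq> flow u ` layer TYPE('n) k"
  proof
    fix a assume "a \<in> layer TYPE('n) k"
    then obtain t :: "real ^ 'n" and x where "a = point k t x" by (auto simp: layer_def)
    then have "a = flow u (point k (t - 4 ^ k *\<^sub>R u) x)" by (simp add: flow_point)
    then show "a \<in> flow u ` layer TYPE('n) k" 
      by (rule image_eqI[where x="point k (t - 4 ^ k *\<^sub>R u) x"]) (auto simp: layer_def)
  qed
  show "flow u ` layer TYPE('n) k \<subseteq> layer TYPE('n) k"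
  proof (rule image_subsetI)
    fix a assume "a \<in> layer TYPE('n) k"
    then obtain t :: "real ^ 'n" and x where "a = point k t x" by (auto simp: layer_def)
    then have "flow u a = point k (t + 4 ^ k *\<^sub>R u) x" by (simp add: flow_point)
    then show "flow u a \<in> layer TYPE('n) k" unfolding layer_def by blast
  qed
qed

text \<open>Countably many invariant Borel layers cover the space, so one has positive measure and,
  by ergodicity, full measure. The entropy bound of that layer does not depend on
  \<open>\<epsilon>\<close>.\<close>

lemma ergodic_has_rdim_0:
  fixes \<nu> :: "(nat \<Rightarrow> real) measure"
  assumes "\<nu> \<in> ergodic_measures (flow_space TYPE('n::finite)) (flow :: real ^ 'n \<Rightarrow> _)"
  shows "has_rdim (flow_space TYPE('n)) (flow :: real ^ 'n \<Rightarrow> _) \<nu> 0"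
proof -
  let ?X = "flow_space TYPE('n)"
  have \<nu>: "\<nu> \<in> invariant_measures ?X (flow :: real ^ 'n \<Rightarrow> _)"
    and erg: "\<And>A. A \<in> sets (metric_borel ?X) \<Longrightarrow> (\<And>u :: real ^ 'n. flow (- u) ` A = A) \<Longrightarrow> \<not> (0 < measure \<nu> A \<and> measure \<nu> A < 1)"
    using assms unfolding ergodic_measures_def by blast+
  interpret invariant_action ?X "flow :: real ^ 'n \<Rightarrow> _" \<nu>
    using \<nu> by (rule invariant_action_flow)
  have sets: "layer TYPE('n) k \<in> sets \<nu>" for k
    using layer_sets by (simp add: sets_\<mu>)
  have "\<exists>k. measure \<nu> (layer TYPE('n) k) \<noteq> 0"
  proof (rule ccontr)
    assume "\<not> ?thesis"
    then have "emeasure \<nu> (layer TYPE('n) k) = 0" for k by (simp add: \<mu>.emeasure_eq_measure)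
    then have "emeasure \<nu> (\<Union>k. layer TYPE('n) k) = 0"
      using sets by (intro emeasure_UN_eq_0) auto
    then have "measure \<nu> (mspace ?X) = 0" by (simp add: Union_layer measure_def)
    then show False by simp
  qed
  then obtain k where k: "measure \<nu> (layer TYPE('n) k) \<noteq> 0" by blast
  have "\<not> (0 < measure \<nu> (layer TYPE('n) k) \<and> measure \<nu> (layer TYPE('n) k) < 1)"
    by (rule erg[OF layer_sets flow_layer])
  then have "measure \<nu> (layer TYPE('n) k) = 1"
    using k measure_nonneg[of \<nu> "layer TYPE('n) k"] \<mu>.prob_le_1[of "layer TYPE('n) k"] by linarith
  from has_rdim_0[OF rate_distortion_layer_le[OF \<nu> this]] show ?thesis .
qed

section \<open>The mixture of the layers\<close>

type_synonym 'n param = "nat \<times> (real ^ 'n) \<times> (('n \<Rightarrow> int) \<Rightarrow> bool)"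

definition coin_space :: "(('n::finite \<Rightarrow> int) \<Rightarrow> bool) measure" where
  "coin_space = PiM UNIV (\<lambda>_. measure_pmf (bernoulli_pmf (1/2)))"

text \<open>The geometric law gives layer \<open>k\<close> the weight \<open>(1/2) ^ Suc k\<close>.
  The uniform phase plays the part of the fibre in a suspension of the shift on the bits.\<close>

definition param_space :: "('n::finite param) measure" where
  "param_space = measure_pmf (geometric_pmf (1/2)) \<Otimes>\<^sub>M (cube_measure 1 \<Otimes>\<^sub>M coin_space)"

definition param_point :: "'n::finite param \<Rightarrow> nat \<Rightarrow> real" where
  "param_point w = point (fst w) (fst (snd w)) (snd (snd w))"

lemma prob_space_coin_space: "prob_space coin_space"
  unfolding coin_space_def by (intro prob_space_PiM measure_pmf.prob_space_axioms)

lemma prob_space_cube_measure_1: "prob_space (cube_measure 1 :: (real ^ 'n) measure)"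
  by (rule prob_spaceI) (simp add: cube_measure_def emeasure_restrict_space emeasure_cube)

lemma prob_space_inner: "prob_space (cube_measure 1 \<Otimes>\<^sub>M coin_space :: ((real ^ 'n) \<times> (('n::finite \<Rightarrow> int) \<Rightarrow> bool)) measure)"
  by (intro prob_space_pair prob_space_cube_measure_1 prob_space_coin_space)

lemma prob_space_param_space: "prob_space param_space"
  unfolding param_space_def by (intro prob_space_pair prob_space_inner measure_pmf.prob_space_axioms)

lemma space_param_space: "space param_space = UNIV \<times> cube 1 \<times> UNIV"
  by (simp add: param_space_def coin_space_def space_pair_measure space_PiM)

lemma space_coin_space [simp]: "space coin_space = UNIV"
  by (simp add: coin_space_def space_PiM)

lemma coin_component_measurable [measurable]: "(\<lambda>x. x m) \<in> measurable coin_space (count_space UNIV)"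
proof -
  have "(\<lambda>x. x m) \<in> measurable coin_space (measure_pmf (bernoulli_pmf (1/2)))"
    unfolding coin_space_def by (rule measurable_component_singleton) simp
  then show ?thesis by (simp cong: measurable_cong_sets)
qed

lemma nn_integral_param_space:
  fixes f :: "'n::finite param \<Rightarrow> ennreal"
  assumes f: "f \<in> borel_measurable param_space"
  shows "(\<integral>\<^sup>+w. f w \<partial>param_space) =
    (\<integral>\<^sup>+k. \<integral>\<^sup>+t. \<integral>\<^sup>+x. f (k, t, x) \<partial>coin_space \<partial>cube_measure 1 \<partial>measure_pmf (geometric_pmf (1/2)))"
proof -
  let ?C = "cube_measure 1 :: (real ^ 'n) measure" and ?B = "coin_space :: (('n \<Rightarrow> int) \<Rightarrow> bool) measure"
  interpret B: prob_space ?B by (rule prob_space_coin_space)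
  interpret I: prob_space "?C \<Otimes>\<^sub>M ?B" by (rule prob_space_inner)
  have f': "f \<in> borel_measurable (measure_pmf (geometric_pmf (1/2)) \<Otimes>\<^sub>M (?C \<Otimes>\<^sub>M ?B))"
    using f by (simp add: param_space_def)
  have "(\<integral>\<^sup>+w. f w \<partial>param_space) = (\<integral>\<^sup>+k. \<integral>\<^sup>+p. f (k, p) \<partial>(?C \<Otimes>\<^sub>M ?B) \<partial>measure_pmf (geometric_pmf (1/2)))"
    unfolding param_space_def by (rule I.nn_integral_fst[OF f', symmetric])
  also have "\<dots> = (\<integral>\<^sup>+k. \<integral>\<^sup>+t. \<integral>\<^sup>+x. f (k, t, x) \<partial>?B \<partial>?C \<partial>measure_pmf (geometric_pmf (1/2)))"
  proof (rule nn_integral_cong)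
    fix k
    have "(\<lambda>p. f (k, p)) \<in> borel_measurable (?C \<Otimes>\<^sub>M ?B)"
      by (rule measurable_compose[OF _ f']) simp
    from B.nn_integral_fst[OF this]
    show "(\<integral>\<^sup>+p. f (k, p) \<partial>(?C \<Otimes>\<^sub>M ?B)) = (\<integral>\<^sup>+t. \<integral>\<^sup>+x. f (k, t, x) \<partial>?B \<partial>?C)" by simp
  qed
  finally show ?thesis .
qed

lemma dist_Z_measurable [measurable]: "dist_Z \<in> borel_measurable borel"
  unfolding dist_Z_def[abs_def] by measurable

lemma bump_measurable [measurable]: "bump \<in> borel_measurable (borel :: (real ^ 'n) measure)"
proof -
  have "(\<lambda>v :: real ^ 'n. Min ((\<lambda>i. dist_Z (v $ i)) ` UNIV)) \<in> borel_measurable borel"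
    by (rule borel_measurable_Min) auto
  then show ?thesis by (simp add: bump_def[abs_def])
qed

lemma site_measurable [measurable]: "site \<in> measurable (borel :: (real ^ 'n) measure) (count_space UNIV)"
proof (rule measurable_count_space_eq2_countable[THEN iffD2], intro conjI ballI)
  fix m :: "'n \<Rightarrow> int"
  have "site -` {m} \<inter> space borel = {v \<in> space borel. \<forall>i. \<lfloor>v $ i\<rfloor> = m i}"
    by (auto simp: site_def fun_eq_iff)
  also have "\<dots> \<in> sets borel" by measurable
  finally show "site -` {m} \<inter> space borel \<in> sets borel" .
qed auto

text \<open>The bit is read at a site that depends on the parameter; countably many sites reduce
  this to the single bits.\<close>

lemma profile_measurable:
  "(\<lambda>w. profile (fst w) (fst (snd w)) (snd (snd w)) v) \<in>
     borel_measurable (count_space UNIV \<Otimes>\<^sub>M (borel \<Otimes>\<^sub>M (coin_space :: (('n::finite \<Rightarrow> int) \<Rightarrow> bool) measure)))"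
proof -
  let ?N = "count_space UNIV \<Otimes>\<^sub>M (borel \<Otimes>\<^sub>M (coin_space :: (('n \<Rightarrow> int) \<Rightarrow> bool) measure))"
  have a: "(\<lambda>w. 4 ^ fst w *\<^sub>R v + fst (snd w)) \<in> borel_measurable ?N" by measurable
  have "(\<lambda>w. snd (snd w) (site (4 ^ fst w *\<^sub>R v + fst (snd w)))) \<in> measurable ?N (count_space UNIV)"
  proof (rule measurable_compose_countable[where f="\<lambda>m w. snd (snd w) m" and g="\<lambda>w. site (4 ^ fst w *\<^sub>R v + fst (snd w))"])
    show "(\<lambda>w. snd (snd w) m) \<in> measurable ?N (count_space UNIV)" for m
      by (rule measurable_compose[OF _ coin_component_measurable]) simp
    show "(\<lambda>w. site (4 ^ fst w *\<^sub>R v + fst (snd w))) \<in> measurable ?N (count_space UNIV)"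
      by (rule measurable_compose[OF a site_measurable])
  qed
  moreover have "(\<lambda>w. bump (4 ^ fst w *\<^sub>R v + fst (snd w))) \<in> borel_measurable ?N"
    by (rule measurable_compose[OF a bump_measurable])
  ultimately have "(\<lambda>w. if snd (snd w) (site (4 ^ fst w *\<^sub>R v + fst (snd w))) then bump (4 ^ fst w *\<^sub>R v + fst (snd w)) else 0) \<in> borel_measurable ?N"
    by (intro measurable_If) (auto simp: pred_def)
  then show ?thesis unfolding profile_def field_def by measurable
qed

text \<open>Both functions are continuous, so a bound on their distance is a countable conjunction
  over the dense sequence. The phase ranges over the whole space, as the flow carries it out of the
  unit cube.\<close>

lemma param_point_measurable_product:
  "(param_point :: 'n param \<Rightarrow> nat \<Rightarrow> real) \<in> measurable (count_space UNIV \<Otimes>\<^sub>M (borel \<Otimes>\<^sub>M coin_space)) (metric_borel (flow_space TYPE('n::finite)))"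
proof -
  let ?N = "count_space UNIV \<Otimes>\<^sub>M (borel \<Otimes>\<^sub>M (coin_space :: (('n \<Rightarrow> int) \<Rightarrow> bool) measure))"
  interpret lipschitz_action "flow_space TYPE('n)" "flow :: real ^ 'n \<Rightarrow> _" by (rule lipschitz_action_flow)
  show ?thesis
  proof (rule measurable_metric_borelI)
    fix a assume "a \<in> mspace (flow_space TYPE('n))"
    then obtain g :: "real ^ 'n \<Rightarrow> real" where g: "g \<in> profiles" "a = sample g" by (auto simp: mspace_flow_space)
    show "(\<lambda>w. mdist (flow_space TYPE('n)) a (param_point w)) \<in> borel_measurable ?N"
    proof (rule borel_measurableI_le)
      fix c
      let ?F = "\<lambda>w (v :: real ^ 'n). exp (- norm v) * \<bar>g v - profile (fst w) (fst (snd w)) (snd (snd w)) v\<bar>"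
      have "mdist (flow_space TYPE('n)) a (param_point w) \<le> c \<longleftrightarrow> (\<forall>j. ?F w (dense_seq j) \<le> c)" for w
      proof -
        let ?p = "profile (fst w) (fst (snd w)) (snd (snd w))"
        have eq: "mdist (flow_space TYPE('n)) a (param_point w) = weighted_dist g ?p"
          using g by (simp add: mdist_flow_space param_point_def)
        show ?thesis
        proof
          assume "mdist (flow_space TYPE('n)) a (param_point w) \<le> c"
          then have "weighted_dist g ?p \<le> c" by (simp only: eq)
          then show "\<forall>j. ?F w (dense_seq j) \<le> c"
            by (intro allI order_trans[OF le_weighted_dist[OF g(1) profile_in]])
        next
          assume *: "\<forall>j. ?F w (dense_seq j) \<le> c"
          have "continuous_on UNIV (?F w)"
            by (intro continuous_intros profiles_continuous g(1) profile_in)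
          from le_on_dense_seq[OF this] * have "?F w v \<le> c" for v by blast
          then show "mdist (flow_space TYPE('n)) a (param_point w) \<le> c"
            unfolding eq by (rule weighted_dist_le)
        qed
      qed
      then have "{w \<in> space ?N. mdist (flow_space TYPE('n)) a (param_point w) \<le> c} = {w \<in> space ?N. \<forall>j. ?F w (dense_seq j) \<le> c}"
        by simp
      also have "\<dots> \<in> sets ?N"
      proof (rule sets.sets_Collect_countable_All)
        fix j
        note [measurable] = profile_measurable[of "dense_seq j :: real ^ 'n"]
        show "{w \<in> space ?N. ?F w (dense_seq j) \<le> c} \<in> sets ?N" by measurable
      qed
      finally show "{w \<in> space ?N. mdist (flow_space TYPE('n)) a (param_point w) \<le> c} \<in> sets ?N" .
    qed
  qed (simp add: param_point_def)
qed

lemma param_space_to_product: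
  "(\<lambda>w. w) \<in> measurable (param_space :: ('n::finite param) measure)
     (count_space UNIV \<Otimes>\<^sub>M (borel \<Otimes>\<^sub>M coin_space))"
proof -
  have "fst \<in> measurable (cube_measure 1 \<Otimes>\<^sub>M coin_space :: ((real ^ 'n) \<times> (('n \<Rightarrow> int) \<Rightarrow> bool)) measure) borel"
    by (rule measurable_compose[OF measurable_fst]) (simp add: cube_measure_def measurable_restrict_space1)
  then have "(\<lambda>p. (fst p, snd p)) \<in> measurable (cube_measure 1 \<Otimes>\<^sub>M coin_space :: ((real ^ 'n) \<times> (('n \<Rightarrow> int) \<Rightarrow> bool)) measure) (borel \<Otimes>\<^sub>M coin_space)"
    by (rule measurable_Pair) simp
  then have p: "(\<lambda>p. p) \<in> measurable (cube_measure 1 \<Otimes>\<^sub>M coin_space :: ((real ^ 'n) \<times> (('n \<Rightarrow> int) \<Rightarrow> bool)) measure) (borel \<Otimes>\<^sub>M coin_space)"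
    by simp
  have s: "snd \<in> measurable (param_space :: 'n param measure) (borel \<Otimes>\<^sub>M coin_space)"
    unfolding param_space_def by (rule measurable_compose[OF measurable_snd p])
  have f: "fst \<in> measurable (param_space :: 'n param measure) (count_space UNIV)"
    unfolding param_space_def by (rule measurable_compose[OF measurable_fst]) simp
  from measurable_Pair[OF f s] show ?thesis by simp
qed

lemma param_point_measurable: "(param_point :: 'n param \<Rightarrow> nat \<Rightarrow> real) \<in> measurable param_space (metric_borel (flow_space TYPE('n::finite)))"
  by (rule measurable_compose[OF param_space_to_product param_point_measurable_product])

definition mixture :: "'n::finite itself \<Rightarrow> (nat \<Rightarrow> real) measure" where
  "mixture _ = distr (param_space :: 'n param measure) (metric_borel (flow_space TYPE('n))) param_point"

section \<open>Invariance of the mixture\<close>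

lemma coin_space_shift:
  "distr coin_space coin_space (\<lambda>x s. x (\<lambda>i. s i + m i)) = (coin_space :: (('n::finite \<Rightarrow> int) \<Rightarrow> bool) measure)"
proof -
  have "inj (\<lambda>s :: 'n \<Rightarrow> int. \<lambda>i. s i + m i)" by (auto simp: inj_def fun_eq_iff)
  from distr_PiM_reindex[OF measure_pmf.prob_space_axioms this, of UNIV "\<lambda>_. bernoulli_pmf (1/2)"]
  show ?thesis by (simp add: coin_space_def restrict_UNIV)
qed

text \<open>The integer translates of the half-open unit cube tile the space, each point lying in
  exactly one.\<close>

lemma of_int_vec_minus_cube: "(\<integral>\<^sup>+m. indicator (cube 1) (v - (\<chi> i. of_int (m i)) :: real ^ 'n) \<partial>count_space UNIV) = (1 :: ennreal)"
  and of_int_vec_plus_cube: "(\<integral>\<^sup>+m. indicator (cube 1) (v + (\<chi> i. of_int (m i)) :: real ^ 'n) \<partial>count_space UNIV) = (1 :: ennreal)"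
proof -
  have fl: "0 \<le> s - of_int k \<and> s - of_int k < 1 \<longleftrightarrow> k = \<lfloor>s\<rfloor>" for s :: real and k
    by linarith
  have "indicator (cube 1) (v - (\<chi> i. of_int (m i)) :: real ^ 'n) = (indicator {\<lambda>i. \<lfloor>v $ i\<rfloor>} m :: ennreal)" for m
    unfolding cube_def indicator_def using fl[of "v $ i" "m i" for i] by (simp add: fun_eq_iff)
  then show "(\<integral>\<^sup>+m. indicator (cube 1) (v - (\<chi> i. of_int (m i)) :: real ^ 'n) \<partial>count_space UNIV) = (1 :: ennreal)"
    by simp
  have fl': "0 \<le> s + of_int k \<and> s + of_int k < 1 \<longleftrightarrow> k = - \<lfloor>s\<rfloor>" for s :: real and k
    by linarith
  have "indicator (cube 1) (v + (\<chi> i. of_int (m i)) :: real ^ 'n) = (indicator {\<lambda>i. - \<lfloor>v $ i\<rfloor>} m :: ennreal)" for m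
    unfolding cube_def indicator_def using fl'[of "v $ i" "m i" for i] by (simp add: fun_eq_iff)
  then show "(\<integral>\<^sup>+m. indicator (cube 1) (v + (\<chi> i. of_int (m i)) :: real ^ 'n) \<partial>count_space UNIV) = (1 :: ennreal)"
    by simp
qed

lemma nn_integral_lborel_translate:
  fixes g :: "'e::euclidean_space \<Rightarrow> ennreal"
  assumes "g \<in> borel_measurable borel"
  shows "(\<integral>\<^sup>+u. g (u + a) \<partial>lborel) = (\<integral>\<^sup>+u. g u \<partial>lborel)"
proof -
  have "(\<integral>\<^sup>+u. g u \<partial>distr lborel borel ((+) a)) = (\<integral>\<^sup>+u. g (a + u) \<partial>lborel)"
    using assms by (intro nn_integral_distr) auto
  then show ?thesis by (simp add: lborel_distr_plus add.commute)
qed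

text \<open>A function with integer periods has the same integral over every translate of the unit
  cube: the translate is cut along the tiling and the pieces are moved back.\<close>

lemma nn_integral_periodic_shift:
  fixes h :: "real ^ 'n \<Rightarrow> ennreal"
  assumes hm [measurable]: "h \<in> borel_measurable borel" and per: "\<And>t m. h (t + (\<chi> i. of_int (m i))) = h t"
  shows "(\<integral>\<^sup>+t. h (t + s) \<partial>cube_measure 1) = (\<integral>\<^sup>+t. h t \<partial>cube_measure 1)"
proof -
  let ?C = "cube 1 :: (real ^ 'n) set"
  let ?z = "\<lambda>m :: 'n \<Rightarrow> int. (\<chi> i. of_int (m i)) :: real ^ 'n"
  have restr: "(\<integral>\<^sup>+t. g t \<partial>cube_measure 1) = (\<integral>\<^sup>+t. indicator ?C t * g t \<partial>lborel)" for g :: "real ^ 'n \<Rightarrow> ennreal"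
    unfolding cube_measure_def by (subst nn_integral_restrict_space) (auto simp: mult.commute)
  have "(\<integral>\<^sup>+t. h (t + s) \<partial>cube_measure 1) = (\<integral>\<^sup>+t. indicator ?C (t + s - s) * h (t + s) \<partial>lborel)"
    by (simp add: restr)
  also have "\<dots> = (\<integral>\<^sup>+t. indicator ?C (t - s) * h t \<partial>lborel)"
    by (rule nn_integral_lborel_translate[where g="\<lambda>t. indicator ?C (t - s) * h t"]) measurable
  \<comment> \<open>Inserts the tiling as a sum that equals 1 at every point.\<close>
  also have "\<dots> = (\<integral>\<^sup>+t. \<integral>\<^sup>+m. indicator ?C (t - s) * h t * indicator ?C (t - ?z m) \<partial>count_space UNIV \<partial>lborel)"
    by (subst nn_integral_cmult) (simp_all add: of_int_vec_minus_cube)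
  also have "\<dots> = (\<integral>\<^sup>+m. \<integral>\<^sup>+t. indicator ?C (t - s) * h t * indicator ?C (t - ?z m) \<partial>lborel \<partial>count_space UNIV)"
    by (rule nn_integral_count_space_nn_integral) (auto, measurable)
  also have "\<dots> = (\<integral>\<^sup>+m. \<integral>\<^sup>+t. indicator ?C (t + ?z m - s) * h t * indicator ?C t \<partial>lborel \<partial>count_space UNIV)"
  proof (rule nn_integral_cong)
    fix m
    have "(\<integral>\<^sup>+t. indicator ?C (t + ?z m - s) * h (t + ?z m) * indicator ?C (t + ?z m - ?z m) \<partial>lborel)
      = (\<integral>\<^sup>+t. indicator ?C (t - s) * h t * indicator ?C (t - ?z m) \<partial>lborel)"
      by (rule nn_integral_lborel_translate[where g="\<lambda>t. indicator ?C (t - s) * h t * indicator ?C (t - ?z m)"]) measurable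
    then show "(\<integral>\<^sup>+t. indicator ?C (t - s) * h t * indicator ?C (t - ?z m) \<partial>lborel)
      = (\<integral>\<^sup>+t. indicator ?C (t + ?z m - s) * h t * indicator ?C t \<partial>lborel)"
      by (simp add: per)
  qed
  also have "\<dots> = (\<integral>\<^sup>+t. \<integral>\<^sup>+m. indicator ?C (t + ?z m - s) * h t * indicator ?C t \<partial>count_space UNIV \<partial>lborel)"
    by (rule nn_integral_count_space_nn_integral[symmetric]) (auto, measurable)
  also have "\<dots> = (\<integral>\<^sup>+t. indicator ?C t * h t \<partial>lborel)"
  proof (rule nn_integral_cong)
    fix t
    have "(\<integral>\<^sup>+m. indicator ?C (t + ?z m - s) * h t * indicator ?C t \<partial>count_space UNIV)
      = (\<integral>\<^sup>+m. (h t * indicator ?C t) * indicator ?C (t - s + ?z m) \<partial>count_space UNIV)"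
      by (intro nn_integral_cong) (simp add: algebra_simps)
    also have "\<dots> = h t * indicator ?C t"
      by (subst nn_integral_cmult) (simp_all add: of_int_vec_plus_cube)
    finally show "(\<integral>\<^sup>+m. indicator ?C (t + ?z m - s) * h t * indicator ?C t \<partial>count_space UNIV) = indicator ?C t * h t"
      by (simp add: mult.commute)
  qed
  finally show ?thesis by (simp add: restr)
qed

text \<open>On layer \<open>k\<close> the flow adds \<open>4 ^ k *\<^sub>R u\<close> to the phase.
  After averaging over the bits the dependence on the phase has integer periods, so the uniform
  phase absorbs this shift.\<close>

lemma mixture_invariant: "mixture TYPE('n::finite) \<in> invariant_measures (flow_space TYPE('n)) (flow :: real ^ 'n \<Rightarrow> _)"
proof -
  let ?X = "flow_space TYPE('n)"
  let ?P = "param_space :: 'n param measure"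
  let ?B = "coin_space :: (('n \<Rightarrow> int) \<Rightarrow> bool) measure"
  interpret lipschitz_action ?X "flow :: real ^ 'n \<Rightarrow> _" by (rule lipschitz_action_flow)
  interpret B: prob_space ?B by (rule prob_space_coin_space)
  interpret P: prob_space ?P by (rule prob_space_param_space)
  have "distr (mixture TYPE('n)) (metric_borel ?X) (flow u) = mixture TYPE('n)" for u :: "real ^ 'n"
  proof (rule measure_eqI)
    fix A assume "A \<in> sets (distr (mixture TYPE('n)) (metric_borel ?X) (flow u))"
    then have A: "A \<in> sets (metric_borel ?X)" by simp
    \<comment> \<open>Probability of \<open>A\<close> given layer and phase; its periodicity comes
      from the shift invariance of the coins.\<close>
    define H where "H k t = (\<integral>\<^sup>+x. indicator A (point k t x) \<partial>?B)" for k and t :: "real ^ 'n"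
    have Am: "(indicator A :: _ \<Rightarrow> ennreal) \<in> borel_measurable (metric_borel ?X)" using A by simp
    have big: "(\<lambda>w. indicator A (param_point w) :: ennreal) \<in> borel_measurable (count_space UNIV \<Otimes>\<^sub>M (borel \<Otimes>\<^sub>M ?B))"
      by (rule measurable_compose[OF param_point_measurable_product Am])
    have Hm: "H k \<in> borel_measurable borel" for k
    proof -
      have "(\<lambda>p. indicator A (param_point (k, p)) :: ennreal) \<in> borel_measurable (borel \<Otimes>\<^sub>M ?B)"
        by (rule measurable_compose[OF _ big]) simp
      from B.borel_measurable_nn_integral_fst[OF this] show ?thesis
        by (simp add: H_def[abs_def] param_point_def)
    qed
    have Hper: "H k (t + (\<chi> i. of_int (m i))) = H k t" for k t m
    proof -
      have pm: "(\<lambda>x. indicator A (point k t x) :: ennreal) \<in> borel_measurable ?B"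
      proof -
        have "(\<lambda>x. (k, t, x)) \<in> measurable ?B (count_space UNIV \<Otimes>\<^sub>M (borel \<Otimes>\<^sub>M ?B))" by simp
        from measurable_compose[OF this big] show ?thesis by (simp add: param_point_def)
      qed
      have sm: "(\<lambda>x s. x (\<lambda>i. s i + m i)) \<in> measurable ?B ?B"
        using coin_component_measurable unfolding coin_space_def by (intro measurable_PiM_single') simp_all
      have "H k t = (\<integral>\<^sup>+x. indicator A (point k t x) \<partial>distr ?B ?B (\<lambda>x s. x (\<lambda>i. s i + m i)))"
        by (simp add: H_def coin_space_shift)
      also have "\<dots> = (\<integral>\<^sup>+x. indicator A (point k t (\<lambda>s. x (\<lambda>i. s i + m i))) \<partial>?B)"
        by (rule nn_integral_distr[OF sm]) (use pm in simp)
      also have "\<dots> = H k (t + (\<chi> i. of_int (m i)))" by (simp add: H_def point_integer_shift)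
      finally show ?thesis by simp
    qed
    have mass: "emeasure ?P {w \<in> space ?P. flow v (param_point w) \<in> A}
      = (\<integral>\<^sup>+k. \<integral>\<^sup>+t. H k (t + 4 ^ k *\<^sub>R v) \<partial>cube_measure 1 \<partial>measure_pmf (geometric_pmf (1/2)))" for v :: "real ^ 'n"
    proof -
      have fm: "(\<lambda>w. flow v (param_point w)) \<in> measurable ?P (metric_borel ?X)"
        by (rule measurable_compose[OF param_point_measurable T_measurable])
      have S: "{w \<in> space ?P. flow v (param_point w) \<in> A} \<in> sets ?P"
        using measurable_sets[OF fm A] by (simp add: vimage_def Int_def conj_commute)
      have "emeasure ?P {w \<in> space ?P. flow v (param_point w) \<in> A} = (\<integral>\<^sup>+w. indicator A (flow v (param_point w)) \<partial>?P)"
        using S by (subst nn_integral_indicator[symmetric]) (auto intro!: nn_integral_cong simp: indicator_def simp del: nn_integral_indicator)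
      also have "\<dots> = (\<integral>\<^sup>+k. \<integral>\<^sup>+t. \<integral>\<^sup>+x. indicator A (flow v (param_point (k, t, x))) \<partial>?B \<partial>cube_measure 1 \<partial>measure_pmf (geometric_pmf (1/2)))"
        by (rule nn_integral_param_space) (rule measurable_compose[OF fm Am])
      also have "\<dots> = (\<integral>\<^sup>+k. \<integral>\<^sup>+t. H k (t + 4 ^ k *\<^sub>R v) \<partial>cube_measure 1 \<partial>measure_pmf (geometric_pmf (1/2)))"
        by (simp add: H_def param_point_def flow_point)
      finally show ?thesis .
    qed
    have shift: "(\<integral>\<^sup>+t. H k (t + v) \<partial>cube_measure 1) = (\<integral>\<^sup>+t. H k t \<partial>cube_measure 1)" for k v
      using Hm Hper by (rule nn_integral_periodic_shift)
    have "emeasure (distr (mixture TYPE('n)) (metric_borel ?X) (flow u)) A = emeasure ?P {w \<in> space ?P. flow u (param_point w) \<in> A}"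
      unfolding mixture_def distr_distr[OF T_measurable param_point_measurable]
        emeasure_distr[OF measurable_comp[OF param_point_measurable T_measurable] A]
      by (rule arg_cong[where f="emeasure ?P"]) auto
    also have "\<dots> = (\<integral>\<^sup>+k. \<integral>\<^sup>+t. H k t \<partial>cube_measure 1 \<partial>measure_pmf (geometric_pmf (1/2)))"
      by (simp only: mass shift)
    also have "\<dots> = emeasure ?P {w \<in> space ?P. flow (0 :: real ^ 'n) (param_point w) \<in> A}" by (simp only: mass shift)
    also have "\<dots> = emeasure (mixture TYPE('n)) A"
      unfolding mixture_def emeasure_distr[OF param_point_measurable A]
      by (rule arg_cong[where f="emeasure ?P"]) (auto simp: param_point_def flow_point)
    finally show "emeasure (distr (mixture TYPE('n)) (metric_borel ?X) (flow u)) A = emeasure (mixture TYPE('n)) A" .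
  qed (simp add: mixture_def)
  moreover have "prob_space (mixture TYPE('n))"
    unfolding mixture_def by (rule P.prob_space_distr[OF param_point_measurable])
  ultimately show ?thesis by (simp add: invariant_measures_def mixture_def)
qed

section \<open>The lower bound for the rate of the mixture\<close>

text \<open>Independence of finitely many bits, obtained by projecting the infinite product to the
  coordinates in \<open>S\<close>.\<close>

lemma nn_integral_coin_space_prod:
  fixes f :: "('n::finite \<Rightarrow> int) \<Rightarrow> bool \<Rightarrow> ennreal"
  assumes S: "finite S"
  shows "(\<integral>\<^sup>+x. (\<Prod>m\<in>S. f m (x m)) \<partial>coin_space) = (\<Prod>m\<in>S. f m True * ennreal (1/2) + f m False * ennreal (1/2))"
proof -
  let ?M = "\<lambda>_ :: 'n \<Rightarrow> int. measure_pmf (bernoulli_pmf (1/2))"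
  interpret product_prob_space ?M UNIV by unfold_locales
  have fm: "(\<lambda>y. \<Prod>m\<in>S. f m (y m)) \<in> borel_measurable (PiM S ?M)"
  proof (rule borel_measurable_prod_ennreal)
    fix m assume "m \<in> S"
    then have "(\<lambda>y. y m) \<in> measurable (PiM S ?M) (measure_pmf (bernoulli_pmf (1/2)))"
      by (rule measurable_component_singleton)
    then show "(\<lambda>y. f m (y m)) \<in> borel_measurable (PiM S ?M)" by (rule measurable_compose) simp
  qed
  have "(\<integral>\<^sup>+x. (\<Prod>m\<in>S. f m (x m)) \<partial>coin_space) = (\<integral>\<^sup>+x. (\<Prod>m\<in>S. f m (restrict x S m)) \<partial>PiM UNIV ?M)"
    unfolding coin_space_def by (intro nn_integral_cong prod.cong) auto
  also have "\<dots> = (\<integral>\<^sup>+y. (\<Prod>m\<in>S. f m (y m)) \<partial>distr (PiM UNIV ?M) (PiM S ?M) (\<lambda>x. restrict x S))"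
    by (rule nn_integral_distr[symmetric, OF measurable_restrict_subset]) (use fm in simp_all)
  also have "\<dots> = (\<integral>\<^sup>+y. (\<Prod>m\<in>S. f m (y m)) \<partial>PiM S ?M)"
    using S by (subst distr_PiM_restrict_finite) auto
  also have "\<dots> = (\<Prod>m\<in>S. integral\<^sup>N (measure_pmf (bernoulli_pmf (1/2))) (f m))"
    using S by (rule product_nn_integral_prod) simp
  finally show ?thesis by simp
qed

lemma emeasure_lborel_shifted_cube:
  fixes c :: "real ^ 'n"
  assumes "0 \<le> r" shows "emeasure lborel {u. u - c \<in> cube r} = ennreal (r ^ CARD('n))"
proof -
  have m: "{u. u - c \<in> cube r} \<in> sets borel"
  proof -
    have "(\<lambda>u. u - c) -` cube r \<inter> space borel \<in> sets borel" by (rule measurable_sets[OF _ cube_borel]) simp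
    then show ?thesis by (simp add: vimage_def)
  qed
  have "emeasure lborel {u. u - c \<in> cube r} = (\<integral>\<^sup>+u. indicator (cube r) (u + - c) \<partial>lborel)"
    using m by (subst nn_integral_indicator[symmetric]) (auto intro!: nn_integral_cong simp: indicator_def simp del: nn_integral_indicator)
  also have "\<dots> = (\<integral>\<^sup>+(u :: real ^ 'n). indicator (cube r) u \<partial>lborel)"
    by (rule nn_integral_lborel_translate[of "indicator (cube r)" "- c"]) simp
  finally show ?thesis using assms by (simp add: emeasure_cube)
qed

lemma finite_cells: "finite {n :: 'n::finite \<Rightarrow> int. \<forall>i. 1 \<le> n i \<and> n i < m}"
  and card_cells: "card {n :: 'n::finite \<Rightarrow> int. \<forall>i. 1 \<le> n i \<and> n i < m} = nat (m - 1) ^ CARD('n)"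
proof -
  have eq: "{n :: 'n \<Rightarrow> int. \<forall>i. 1 \<le> n i \<and> n i < m} = PiE UNIV (\<lambda>_. {1..<m})" by auto
  show "finite {n :: 'n \<Rightarrow> int. \<forall>i. 1 \<le> n i \<and> n i < m}" unfolding eq by (rule finite_PiE) auto
  show "card {n :: 'n \<Rightarrow> int. \<forall>i. 1 \<le> n i \<and> n i < m} = nat (m - 1) ^ CARD('n)"
    unfolding eq by (simp add: card_PiE)
qed

text \<open>The distance of two profiles is tested at the origin only. In the middle part of each unit cell
  the bump is at least \<open>1/4\<close>, so no value of \<open>y\<close> is close to both symbols.\<close>

lemma distortion_ge_sum_cells:
  fixes t :: "real ^ 'n" and y :: "real ^ 'n \<Rightarrow> nat \<Rightarrow> real" and k :: nat
  assumes y: "y \<in> L1_maps L (flow_space TYPE('n))" and t: "t \<in> cube 1" and L: "0 \<le> L"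
  defines "S \<equiv> {n :: 'n \<Rightarrow> int. \<forall>i. 1 \<le> n i \<and> n i < \<lfloor>4 ^ k * L\<rfloor>}"
  shows "\<exists>h :: ('n \<Rightarrow> int) \<Rightarrow> bool \<Rightarrow> real. (\<forall>n b. 0 \<le> h n b) \<and>
    (\<forall>n\<in>S. (1/2) ^ k / 4 * (1 / (2 * 4 ^ k)) ^ CARD('n) \<le> h n True + h n False) \<and>
    (\<forall>x. (\<Sum>n\<in>S. h n (x n)) \<le> lipschitz_action.distortion (flow_space TYPE('n)) flow L (point k t x) y)"
proof -
  let ?X = "flow_space TYPE('n)"
  interpret lipschitz_action ?X "flow :: real ^ 'n \<Rightarrow> _" by (rule lipschitz_action_flow)
  interpret F: finite_measure "cube_measure L :: (real ^ 'n) measure" by (rule finite_measure_cube_measure)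
  define M :: real where "M = 4 ^ k"
  have M: "1 \<le> M" unfolding M_def by simp
  have S: "finite S" unfolding S_def by (rule finite_cells)
  define z where "z u = (unsample (y u) :: real ^ 'n \<Rightarrow> real) 0" for u
  have ys: "y u \<in> mspace ?X" if "u \<in> cube L" for u using L1_maps_space[OF y that] .
  have z01: "0 \<le> z u" "z u \<le> 1" if "u \<in> cube L" for u
  proof -
    obtain g :: "real ^ 'n \<Rightarrow> real" where "g \<in> profiles" "y u = sample g" using ys[OF \<open>u \<in> cube L\<close>] by (auto simp: mspace_flow_space)
    then show "0 \<le> z u" "z u \<le> 1" using profiles_bounds[of g 0] by (simp_all add: z_def)
  qed
  have zm: "z \<in> borel_measurable (cube_measure L)"
  proof -
    have "(\<lambda>a. (unsample a :: real ^ 'n \<Rightarrow> real) 0) \<in> borel_measurable (metric_borel ?X)"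
    proof (rule lipschitz_measurable_metric_borel)
      fix a b assume "a \<in> mspace ?X" "b \<in> mspace ?X"
      from abs_diff_le_mdist[OF this]
      show "(unsample a :: real ^ 'n \<Rightarrow> real) 0 \<le> (unsample b :: real ^ 'n \<Rightarrow> real) 0 + 1 * mdist ?X a b" by linarith
    qed
    with y show ?thesis unfolding L1_maps_def z_def by (rule measurable_compose)
  qed
  define c where "c n = (\<chi> i. (of_int (n i) + 1/4 - t $ i) / M)" for n :: "'n \<Rightarrow> int"
  \<comment> \<open>The times at which the origin sits in the middle half of cell \<open>n\<close>:
    side 1/2 after scaling, so \<open>1 / (2 * M)\<close> in time.\<close>
  define sub where "sub n = {u. u - c n \<in> cube (1 / (2 * M))}" for n
  have sub_iff: "u \<in> sub n \<longleftrightarrow> (\<forall>i. of_int (n i) + 1/4 \<le> M * u $ i + t $ i \<and> M * u $ i + t $ i < of_int (n i) + 3/4)" for u n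
  proof -
    have "0 \<le> u $ i - (of_int (n i) + 1/4 - t $ i) / M \<and> u $ i - (of_int (n i) + 1/4 - t $ i) / M < 1 / (2 * M) \<longleftrightarrow>
      of_int (n i) + 1/4 \<le> M * u $ i + t $ i \<and> M * u $ i + t $ i < of_int (n i) + 3/4" for i
    proof -
      define w where "w = u $ i - (of_int (n i) + 1/4 - t $ i) / M"
      have "M * w = M * u $ i + t $ i - of_int (n i) - 1/4" 
      proof -
        have "M * ((of_int (n i) + 1/4 - t $ i) / M) = of_int (n i) + 1/4 - t $ i" using M by simp
        then show ?thesis unfolding w_def right_diff_distrib by linarith
      qed
      moreover have "0 \<le> w \<longleftrightarrow> 0 \<le> M * w" using M by (simp add: zero_le_mult_iff)
      moreover have "w < 1 / (2 * M) \<longleftrightarrow> M * w < 1/2" using M by (simp add: field_simps)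
      ultimately show ?thesis unfolding w_def[symmetric] by linarith
    qed
    then show ?thesis by (simp add: sub_def cube_def c_def)
  qed
  have t01: "0 \<le> t $ i" "t $ i < 1" for i using t by (simp_all add: cube_def)
  \<comment> \<open>The index starts at 1 because the phase can take up almost a whole cell; the
    upper bound leaves room for one full cell below \<open>M * L\<close>.\<close>
  have sub_cube: "sub n \<subseteq> cube L" if "n \<in> S" for n
  proof
    fix u assume u: "u \<in> sub n"
    show "u \<in> cube L"
      unfolding cube_def
    proof (intro CollectI allI)
      fix i
      have n: "1 \<le> n i" "n i < \<lfloor>M * L\<rfloor>" using that by (auto simp: S_def M_def)
      have "of_int (n i) + 1/4 \<le> M * u $ i + t $ i" "M * u $ i + t $ i < of_int (n i) + 3/4" using u sub_iff by blast+
      moreover have "1 \<le> (of_int (n i) :: real)" using n(1) by linarith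
      moreover have "of_int (n i) + 1 \<le> M * L" using n(2) by linarith
      ultimately have "0 < M * u $ i" "M * u $ i < M * L" using t01[of i] by linarith+
      then show "0 \<le> u $ i \<and> u $ i < L" using M by (simp add: zero_less_mult_iff)
    qed
  qed
  have sub_site: "site (t + M *\<^sub>R u) = n" if "u \<in> sub n" for u n
  proof (rule ext)
    fix i
    have "of_int (n i) + 1/4 \<le> M * u $ i + t $ i" "M * u $ i + t $ i < of_int (n i) + 3/4" using that sub_iff by blast+
    then show "site (t + M *\<^sub>R u) i = n i" unfolding site_def vector_add_component vector_scaleR_component by simp linarith
  qed
  have sub_bump: "1/4 \<le> bump (t + M *\<^sub>R u)" if u: "u \<in> sub n" for u n
  proof -
    obtain i where i: "bump (t + M *\<^sub>R u) = dist_Z ((t + M *\<^sub>R u) $ i)" using bump_attained by blast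
    have *: "of_int (n i) + 1/4 \<le> M * u $ i + t $ i" "M * u $ i + t $ i < of_int (n i) + 3/4" using u sub_iff by blast+
    then have "\<lfloor>t $ i + M * u $ i\<rfloor> = n i" by linarith
    with * show ?thesis by (simp add: i dist_Z_def)
  qed
  have subm: "sub n \<in> sets borel" for n
  proof -
    have "(\<lambda>u. u - c n) -` cube (1 / (2 * M)) \<inter> space borel \<in> sets borel" by (rule measurable_sets[OF _ cube_borel]) simp
    then show ?thesis by (simp add: vimage_def sub_def)
  qed
  have sub_measure: "measure (cube_measure L) (sub n) = (1 / (2 * M)) ^ CARD('n)" if n: "n \<in> S" for n
  proof -
    have "emeasure (cube_measure L) (sub n) = emeasure lborel (sub n)"
      unfolding cube_measure_def using sub_cube[OF n] by (intro emeasure_restrict_space) auto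
    also have "\<dots> = ennreal ((1 / (2 * M)) ^ CARD('n))"
      unfolding sub_def using M by (intro emeasure_lborel_shifted_cube) simp
    finally show ?thesis using M by (simp add: measure_def)
  qed
  \<comment> \<open>The value at the origin that a point shows at time \<open>u\<close> if the bit
    of the cell is \<open>b\<close>.\<close>
  define v where "v b u = (1/2) ^ k * (if b then bump (t + M *\<^sub>R u) else 0)" for b u
  define g where "g n b u = indicator (sub n) u * \<bar>v b u - z u\<bar>" for n b u
  have v01: "0 \<le> v b u" "v b u \<le> 1" for b u
  proof -
    have "(1/2 :: real) ^ k * (if b then bump (t + M *\<^sub>R u) else 0) \<le> 1 * 1"
      using bump_bounds[of "t + M *\<^sub>R u"] by (intro mult_mono power_le_one) auto
    then show "0 \<le> v b u" "v b u \<le> 1" using bump_bounds[of "t + M *\<^sub>R u"] by (auto simp: v_def)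
  qed
  have bm: "(\<lambda>u. bump (t + M *\<^sub>R u)) \<in> borel_measurable (cube_measure L)"
  proof -
    have "(\<lambda>u. bump (t + M *\<^sub>R u)) \<in> borel_measurable borel"
      by (rule measurable_compose[OF _ bump_measurable]) measurable
    then show ?thesis unfolding cube_measure_def by (intro measurable_restrict_space1) simp
  qed
  have im: "(indicator (sub n) :: _ \<Rightarrow> real) \<in> borel_measurable (cube_measure L)" for n
    unfolding cube_measure_def using subm by (intro measurable_restrict_space1) simp
  have gi: "integrable (cube_measure L) (g n b)" for n b
  proof (rule F.integrable_const_bound[where B=1])
    have "v b \<in> borel_measurable (cube_measure L)"
      unfolding v_def using bm by (cases b) simp_all
    then show "g n b \<in> borel_measurable (cube_measure L)"
      unfolding g_def using zm im by (intro borel_measurable_times borel_measurable_abs borel_measurable_diff)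
    show "AE u in cube_measure L. norm (g n b u) \<le> 1"
    proof (rule AE_I2)
      fix u :: "real ^ 'n" assume "u \<in> space (cube_measure L)"
      then have "\<bar>v b u - z u\<bar> \<le> 1" using z01[of u] v01[of b u] by (simp add: abs_le_iff)
      then show "norm (g n b u) \<le> 1" by (simp add: g_def indicator_def)
    qed
  qed
  \<comment> \<open>Cost of \<open>y\<close> on the middle of cell \<open>n\<close> if the bit there
    were \<open>b\<close>. It does not involve the other bits, which makes the costs independent
    under fair coins.\<close>
  define h where "h n b = (\<integral>u. g n b u \<partial>cube_measure L)" for n b
  show ?thesis
  proof (intro exI[of _ h] conjI allI ballI)
    show "0 \<le> h n b" for n b unfolding h_def g_def by (intro integral_nonneg_AE AE_I2) simp
    show "(1/2) ^ k / 4 * (1 / (2 * 4 ^ k)) ^ CARD('n) \<le> h n True + h n False" if n: "n \<in> S" for n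
    proof -
      have "(1/2) ^ k / 4 * (1 / (2 * M)) ^ CARD('n) = (\<integral>u. indicator (sub n) u * ((1/2) ^ k / 4) \<partial>cube_measure L)"
        using sub_measure[OF n] sub_cube[OF n] by (simp add: Int_absorb2)
      also have "\<dots> \<le> (\<integral>u. g n True u + g n False u \<partial>cube_measure L)"
      proof (rule integral_mono)
        show "integrable (cube_measure L) (\<lambda>u. indicator (sub n) u * ((1/2) ^ k / 4) :: real)"
        proof (rule F.integrable_const_bound[where B="(1/2) ^ k / 4"])
          show "(\<lambda>u. indicator (sub n) u * ((1/2) ^ k / 4) :: real) \<in> borel_measurable (cube_measure L)"
            using im by (intro borel_measurable_times) auto
        qed (simp add: indicator_def)
        show "integrable (cube_measure L) (\<lambda>u. g n True u + g n False u)" using gi by (intro Bochner_Integration.integrable_add)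
        fix u
        show "indicator (sub n) u * ((1/2) ^ k / 4) \<le> g n True u + g n False u"
        proof (cases "u \<in> sub n")
          case True
          have "(1/2) ^ k * (1/4) \<le> (1/2) ^ k * bump (t + M *\<^sub>R u)" using sub_bump[OF True] by (intro mult_left_mono) auto
          then have "(1/2) ^ k / 4 \<le> v True u" by (simp add: v_def)
          moreover have "v False u = 0" by (simp add: v_def)
          ultimately have "(1/2) ^ k / 4 \<le> \<bar>v True u - z u\<bar> + \<bar>v False u - z u\<bar>" by linarith
          then show ?thesis using True by (simp add: g_def)
        qed (simp add: g_def)
      qed
      also have "\<dots> = h n True + h n False" unfolding h_def using gi by (intro Bochner_Integration.integral_add)
      finally show ?thesis by (simp add: M_def)
    qed
    fix x
    have "(\<Sum>n\<in>S. h n (x n)) = (\<integral>u. (\<Sum>n\<in>S. g n (x n) u) \<partial>cube_measure L)"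
      unfolding h_def using gi by (intro Bochner_Integration.integral_sum[symmetric])
    also have "\<dots> \<le> (\<integral>u. mdist ?X (flow u (point k t x)) (y u) \<partial>cube_measure L)"
    proof (rule integral_mono)
      show "integrable (cube_measure L) (\<lambda>u. \<Sum>n\<in>S. g n (x n) u)" using gi by (intro Bochner_Integration.integrable_sum)
      show "integrable (cube_measure L) (\<lambda>u. mdist ?X (flow u (point k t x)) (y u))"
        using y by (intro integrable_distortion) auto
      fix u :: "real ^ 'n" assume "u \<in> space (cube_measure L)"
      then have u: "u \<in> cube L" by simp
      let ?n = "site (t + M *\<^sub>R u)"
      \<comment> \<open>The middle parts are disjoint, so at each time only the cell seen by the
        origin can contribute.\<close>
      have "(\<Sum>n\<in>S. g n (x n) u) = (\<Sum>n\<in>S. if n = ?n then g ?n (x ?n) u else 0)"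
      proof (rule sum.cong[OF refl])
        fix n
        show "g n (x n) u = (if n = ?n then g ?n (x ?n) u else 0)"
          using sub_site[of u n] by (cases "u \<in> sub n") (auto simp: g_def)
      qed
      also have "\<dots> \<le> \<bar>v (x ?n) u - z u\<bar>"
        using S by (simp add: g_def indicator_def)
      also have "v (x ?n) u = profile k (t + M *\<^sub>R u) x 0"
        by (simp add: v_def profile_def field_def)
      also have "\<bar>profile k (t + M *\<^sub>R u) x 0 - z u\<bar> \<le> mdist ?X (flow u (point k t x)) (y u)"
        using abs_diff_le_mdist[OF point_in ys[OF u], of k "t + M *\<^sub>R u" x] by (simp add: flow_point z_def M_def)
      finally show "(\<Sum>n\<in>S. g n (x n) u) \<le> mdist ?X (flow u (point k t x)) (y u)" .
    qed
    also have "\<dots> = distortion L (point k t x) y" by (simp add: distortion_def)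
    finally show "(\<Sum>n\<in>S. h n (x n)) \<le> distortion L (point k t x) y" .
  qed
qed

text \<open>With \<open>p = 2 powr (- a)\<close> and \<open>q = 2 powr (- b)\<close>, the product
  \<open>(1 - p) * (1 - q)\<close> is nonnegative, so \<open>p + q \<le> 1 + p * q\<close>, which is
  at most 3/2.\<close>

lemma two_powr_average_le:
  assumes "0 \<le> a" "0 \<le> b" "1 \<le> a + b"
  shows "2 powr (- a) * (1/2) + 2 powr (- b) * (1/2) \<le> (3/4 :: real)"
proof -
  have "2 powr (- a) \<le> 2 powr 0" "2 powr (- b) \<le> 2 powr 0" using assms by (intro powr_mono; simp)+
  then have "0 \<le> (1 - 2 powr (- a)) * (1 - 2 powr (- b))" by simp
  moreover have "2 powr (- a) * 2 powr (- b) \<le> 2 powr (- 1 :: real)"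
    unfolding powr_add[symmetric] using assms by (intro powr_mono) auto
  moreover have "2 powr (- 1 :: real) = 1/2" by (simp add: powr_minus)
  ultimately show ?thesis by (simp add: algebra_simps)
qed

text \<open>The test function rewards small distortion on layer \<open>k\<close> only. For a fixed
  code word its exponential moment factors over independent cells, and each factor is at most 1
  because no word suits both values of a bit. \<open>\<eta>\<close> is the least total cost of the
  two values in one cell.\<close>

lemma mixture_code_rate_ge:
  fixes L \<epsilon> :: real and k :: nat and Bs :: "'b set"
  defines "N \<equiv> real (card {n :: 'n::finite \<Rightarrow> int. \<forall>i. 1 \<le> n i \<and> n i < \<lfloor>4 ^ k * L\<rfloor>})"
    and "\<eta> \<equiv> (1/2) ^ k / 4 * (1 / (2 * 4 ^ k)) ^ CARD('n)"
  assumes L: "0 < L"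
    and code: "invariant_action.is_code (flow_space TYPE('n)) (mixture TYPE('n)) L \<kappa> q Bs (y :: 'b \<Rightarrow> real ^ 'n \<Rightarrow> nat \<Rightarrow> real)"
  shows "(1/2) ^ Suc k * log 2 (4/3) * N
      - invariant_action.code_distortion (flow_space TYPE('n)) flow (mixture TYPE('n)) L \<kappa> Bs y / \<eta>
    \<le> invariant_action.code_rate (mixture TYPE('n)) \<kappa> q Bs"
proof -
  let ?X = "flow_space TYPE('n)"
  let ?P = "param_space :: 'n param measure"
  let ?B = "coin_space :: (('n \<Rightarrow> int) \<Rightarrow> bool) measure"
  interpret invariant_action ?X "flow :: real ^ 'n \<Rightarrow> _" "mixture TYPE('n)"
    by (rule invariant_action_flow[OF mixture_invariant])
  interpret P: prob_space ?P by (rule prob_space_param_space)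
  interpret B: prob_space ?B by (rule prob_space_coin_space)
  interpret C: prob_space "cube_measure 1 :: (real ^ 'n) measure" by (rule prob_space_cube_measure_1)
  have kern: "kernel (mixture TYPE('n)) \<kappa> Bs" and y: "\<And>b. b \<in> Bs \<Longrightarrow> y b \<in> L1_maps L ?X"
    using code by (auto simp: is_code_def)
  interpret K: kernel "mixture TYPE('n)" \<kappa> Bs by (rule kern)
  define S where "S = {n :: 'n \<Rightarrow> int. \<forall>i. 1 \<le> n i \<and> n i < \<lfloor>4 ^ k * L\<rfloor>}"
  have S: "finite S" unfolding S_def by (rule finite_cells)
  have N: "N = real (card S)" by (simp add: N_def S_def)
  have \<eta>: "0 < \<eta>" by (simp add: \<eta>_def)
  define c where "c = log 2 (4/3 :: real)"
  have c: "0 < c" "2 powr c = 4/3" by (simp_all add: c_def)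
  define G :: "'n param \<Rightarrow> nat \<Rightarrow> real" where "G = param_point"
  have Gm: "G \<in> measurable ?P (metric_borel ?X)" unfolding G_def by (rule param_point_measurable)
  have Gd: "distr ?P (metric_borel ?X) G = mixture TYPE('n)" by (simp add: G_def mixture_def)
  have GX: "G w \<in> mspace ?X" for w by (simp add: G_def param_point_def)
  \<comment> \<open>The reward \<open>c = log 2 (4/3)\<close> per cell exactly offsets the factor
    3/4 which the cell contributes to the exponential moment.\<close>
  define \<phi> where "\<phi> w b = (if fst w = k then c * N - distortion L (G w) (y b) / \<eta> else 0)" for w b
  have fstm: "{w \<in> space ?P. fst w = k} \<in> sets ?P"
  proof -
    have "fst \<in> measurable ?P (count_space UNIV)"
      unfolding param_space_def by (rule measurable_compose[OF measurable_fst]) simp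
    then show ?thesis by measurable
  qed
  have Dm: "(\<lambda>w. distortion L (G w) (y b)) \<in> borel_measurable ?P" if "b \<in> Bs" for b
    using L y[OF that] by (intro measurable_compose[OF Gm distortion_measurable]) auto
  have \<phi>m: "(\<lambda>w. \<phi> w b) \<in> borel_measurable ?P" if "b \<in> Bs" for b
    unfolding \<phi>_def using Dm[OF that] fstm by (intro measurable_If) auto
  have D_bd: "0 \<le> distortion L (G w) (y b)" "distortion L (G w) (y b) \<le> L ^ CARD('n) * diam" if "b \<in> Bs" for w b
    using L GX[of w] y[OF that] by (simp_all add: distortion_nonneg distortion_le_diam)
  have N0: "0 \<le> N" by (simp add: N)
  have bd: "\<bar>\<phi> w b\<bar> \<le> c * N + L ^ CARD('n) * diam / \<eta>" if "b \<in> Bs" for w b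
  proof -
    have "0 \<le> distortion L (G w) (y b) / \<eta>" "distortion L (G w) (y b) / \<eta> \<le> L ^ CARD('n) * diam / \<eta>"
      using D_bd[OF that, of w] \<eta> by (auto intro: divide_right_mono)
    moreover have "0 \<le> c * N" using c N0 by simp
    ultimately show ?thesis unfolding \<phi>_def by (auto simp only: if_True if_False abs_le_iff split: if_split)
  qed
  \<comment> \<open>Bounded for fixed layer and phase, by averaging over the bits alone; the outer
    averages then preserve the bound 1.\<close>
  have inner: "(\<integral>\<^sup>+x. ennreal (2 powr \<phi> (j, t, x) b) \<partial>?B) \<le> 1" if b: "b \<in> Bs" and t: "t \<in> cube 1" for j t b
  proof (cases "j = k")
    case False
    then show ?thesis by (simp add: \<phi>_def B.emeasure_space_1[simplified])
  next
    case True
    obtain h :: "('n \<Rightarrow> int) \<Rightarrow> bool \<Rightarrow> real" where h0: "\<And>n b. 0 \<le> h n b"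
      and h1: "\<And>n. n \<in> S \<Longrightarrow> \<eta> \<le> h n True + h n False"
      and hD: "\<And>x. (\<Sum>n\<in>S. h n (x n)) \<le> distortion L (point k t x) (y b)"
      using distortion_ge_sum_cells[OF y[OF b] t, of k] L unfolding S_def \<eta>_def by auto
    have "(\<integral>\<^sup>+x. ennreal (2 powr \<phi> (j, t, x) b) \<partial>?B)
      \<le> (\<integral>\<^sup>+x. ennreal ((4/3) ^ card S) * (\<Prod>n\<in>S. ennreal (2 powr (- (h n (x n) / \<eta>)))) \<partial>?B)"
    proof (rule nn_integral_mono)
      fix x
      have "\<phi> (j, t, x) b \<le> c * N + (\<Sum>n\<in>S. - (h n (x n) / \<eta>))"
        using hD[of x] \<eta> True by (simp add: \<phi>_def G_def param_point_def sum_negf divide_right_mono flip: sum_divide_distrib)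
      then have "2 powr \<phi> (j, t, x) b \<le> 2 powr (c * N + (\<Sum>n\<in>S. - (h n (x n) / \<eta>)))" by (intro powr_mono) auto
      also have "\<dots> = (4/3) ^ card S * (\<Prod>n\<in>S. 2 powr (- (h n (x n) / \<eta>)))"
        using S by (simp add: powr_add powr_sum powr_powr[symmetric] c(2) N powr_realpow del: powr_powr)
      finally have "ennreal (2 powr \<phi> (j, t, x) b) \<le> ennreal ((4/3) ^ card S * (\<Prod>n\<in>S. 2 powr (- (h n (x n) / \<eta>))))"
        by (rule ennreal_leI)
      also have "\<dots> = ennreal ((4/3) ^ card S) * ennreal (\<Prod>n\<in>S. 2 powr (- (h n (x n) / \<eta>)))"
        by (rule ennreal_mult) (auto intro: prod_nonneg)
      also have "ennreal (\<Prod>n\<in>S. 2 powr (- (h n (x n) / \<eta>))) = (\<Prod>n\<in>S. ennreal (2 powr (- (h n (x n) / \<eta>))))"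
        by (rule prod_ennreal[symmetric]) simp
      finally show "ennreal (2 powr \<phi> (j, t, x) b) \<le> ennreal ((4/3) ^ card S) * (\<Prod>n\<in>S. ennreal (2 powr (- (h n (x n) / \<eta>))))" .
    qed
    also have "\<dots> = ennreal ((4/3) ^ card S) * (\<integral>\<^sup>+x. (\<Prod>n\<in>S. ennreal (2 powr (- (h n (x n) / \<eta>)))) \<partial>?B)"
    proof (rule nn_integral_cmult)
      show "(\<lambda>x. \<Prod>n\<in>S. ennreal (2 powr (- (h n (x n) / \<eta>)))) \<in> borel_measurable ?B"
      proof (rule borel_measurable_prod_ennreal)
        fix n
        show "(\<lambda>x. ennreal (2 powr (- (h n (x n) / \<eta>)))) \<in> borel_measurable ?B"
          by (rule measurable_compose[OF coin_component_measurable]) simp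
      qed
    qed
    also have "(\<integral>\<^sup>+x. (\<Prod>n\<in>S. ennreal (2 powr (- (h n (x n) / \<eta>)))) \<partial>?B)
      = (\<Prod>n\<in>S. ennreal (2 powr (- (h n True / \<eta>))) * ennreal (1/2) + ennreal (2 powr (- (h n False / \<eta>))) * ennreal (1/2))"
      by (rule nn_integral_coin_space_prod[OF S])
    also have "\<dots> \<le> (\<Prod>n\<in>S. ennreal (3/4))"
    proof (rule prod_mono_ennreal)
      fix n assume n: "n \<in> S"
      have "1 \<le> h n True / \<eta> + h n False / \<eta>" using h1[OF n] \<eta> by (simp add: field_simps)
      from two_powr_average_le[OF _ _ this] h0 \<eta>
      have "2 powr (- (h n True / \<eta>)) * (1/2) + 2 powr (- (h n False / \<eta>)) * (1/2) \<le> 3/4" by simp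
      then have "ennreal (2 powr (- (h n True / \<eta>)) * (1/2) + 2 powr (- (h n False / \<eta>)) * (1/2)) \<le> ennreal (3/4)"
        by (rule ennreal_leI)
      then show "ennreal (2 powr (- (h n True / \<eta>))) * ennreal (1/2) + ennreal (2 powr (- (h n False / \<eta>))) * ennreal (1/2) \<le> ennreal (3/4)"
        by (simp only: ennreal_plus[symmetric] ennreal_mult[symmetric] powr_ge_zero mult_nonneg_nonneg zero_le_divide_1_iff zero_le_numeral)
    qed
    also have "ennreal ((4/3) ^ card S) * (\<Prod>n\<in>S. ennreal (3/4)) = 1"
    proof -
      have "(4/3 :: real) ^ card S * (3/4) ^ card S = 1" by (simp flip: power_mult_distrib)
      then show ?thesis by (simp add: ennreal_power flip: ennreal_mult)
    qed
    finally show ?thesis by (simp add: mult_left_mono)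
  qed
  have one: "(\<integral>w. 2 powr \<phi> w b \<partial>?P) \<le> 1" if b: "b \<in> Bs" for b
  proof -
    have pm: "(\<lambda>w. 2 powr \<phi> w b) \<in> borel_measurable ?P" using \<phi>m[OF b] by measurable
    have "(\<integral>\<^sup>+w. ennreal (2 powr \<phi> w b) \<partial>?P)
      = (\<integral>\<^sup>+j. \<integral>\<^sup>+t. \<integral>\<^sup>+x. ennreal (2 powr \<phi> (j, t, x) b) \<partial>?B \<partial>cube_measure 1 \<partial>measure_pmf (geometric_pmf (1/2)))"
      by (rule nn_integral_param_space) (use pm in simp)
    also have "\<dots> \<le> (\<integral>\<^sup>+j. \<integral>\<^sup>+t. 1 \<partial>(cube_measure 1 :: (real ^ 'n) measure) \<partial>measure_pmf (geometric_pmf (1/2)))"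
      by (intro nn_integral_mono inner[OF b]) simp
    also have "\<dots> = 1" using C.emeasure_space_1 by (simp add: measure_pmf.emeasure_space_1[simplified])
    finally have "(\<integral>\<^sup>+w. ennreal (2 powr \<phi> w b) \<partial>?P) \<le> ennreal 1" by simp
    then have "enn2real (\<integral>\<^sup>+w. ennreal (2 powr \<phi> w b) \<partial>?P) \<le> 1" by (rule enn2real_leI[rotated]) simp
    then show ?thesis using pm by (subst integral_eq_nn_integral) auto
  qed
  have "(\<integral>w. (\<Sum>b\<in>Bs. \<kappa> (G w) b * \<phi> w b) \<partial>?P) \<le> code_rate \<kappa> q Bs"
    by (rule code_rate_lower[OF code P.prob_space_axioms Gm Gd \<phi>m bd one])
  \<comment> \<open>Off layer \<open>k\<close> the test function is 0, and subtracting the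
    nonnegative distortion there only lowers the left-hand side. So the distortion of the whole
    mixture may be used.\<close>
  moreover have "(1/2) ^ Suc k * c * N - code_distortion L \<kappa> Bs y / \<eta> \<le> (\<integral>w. (\<Sum>b\<in>Bs. \<kappa> (G w) b * \<phi> w b) \<partial>?P)"
  proof -
    have kG: "(\<lambda>w. \<kappa> (G w) b) \<in> borel_measurable ?P" if "b \<in> Bs" for b
      using measurable_compose[OF Gm, of "\<lambda>x. \<kappa> x b"] K.kernel_measurable[OF that]
      by (simp cong: measurable_cong_sets add: sets_\<mu>)
    interpret KP: kernel ?P "\<lambda>w. \<kappa> (G w)" Bs
      by unfold_locales (use K.finite_Bs K.kernel_nonneg K.kernel_sum kG GX in auto)
    define r where "r w = (\<Sum>b\<in>Bs. \<kappa> (G w) b * distortion L (G w) (y b))" for w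
    have ri: "integrable ?P r"
      unfolding r_def using D_bd Dm
      by (intro Bochner_Integration.integrable_sum KP.integrable_kernel_mult[where C="L ^ CARD('n) * diam"]) auto
    have r_int: "(\<integral>w. r w \<partial>?P) = code_distortion L \<kappa> Bs y"
    proof -
      have "(\<lambda>x. \<Sum>b\<in>Bs. \<kappa> x b * distortion L x (y b)) \<in> borel_measurable (metric_borel ?X)"
      proof (intro borel_measurable_sum borel_measurable_times)
        fix b assume b: "b \<in> Bs"
        show "(\<lambda>x. \<kappa> x b) \<in> borel_measurable (metric_borel ?X)"
          using K.kernel_measurable[OF b] by (simp cong: measurable_cong_sets add: sets_\<mu>)
        show "(\<lambda>x. distortion L x (y b)) \<in> borel_measurable (metric_borel ?X)"
          using L y[OF b] by (intro distortion_measurable) auto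
      qed
      from integral_distr[OF Gm this] show ?thesis
        by (simp add: Gd code_distortion_def r_def)
    qed
    have pk: "measure ?P {w \<in> space ?P. fst w = k} = (1/2) ^ Suc k"
    proof -
      have "emeasure ?P {w \<in> space ?P. fst w = k} = (\<integral>\<^sup>+w. indicator {w \<in> space ?P. fst w = k} w \<partial>?P)"
        using fstm by simp
      also have "\<dots> = (\<integral>\<^sup>+j. \<integral>\<^sup>+t. \<integral>\<^sup>+x. indicator {w \<in> space ?P. fst w = k} (j, t, x) \<partial>?B \<partial>cube_measure 1 \<partial>measure_pmf (geometric_pmf (1/2)))"
        by (rule nn_integral_param_space) (use fstm in simp)
      also have "\<dots> = (\<integral>\<^sup>+j. \<integral>\<^sup>+(t :: real ^ 'n). indicator {k} j \<partial>cube_measure 1 \<partial>measure_pmf (geometric_pmf (1/2)))"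
        by (intro nn_integral_cong) (simp add: indicator_def space_param_space B.emeasure_space_1[simplified])
      also have "\<dots> = ennreal (pmf (geometric_pmf (1/2)) k)"
        using C.emeasure_space_1 by (simp add: emeasure_pmf_single)
      finally show ?thesis by (simp add: measure_def)
    qed
    have "(1/2) ^ Suc k * c * N - code_distortion L \<kappa> Bs y / \<eta>
      = (\<integral>w. indicator {w \<in> space ?P. fst w = k} w * (c * N) - r w / \<eta> \<partial>?P)"
    proof -
      have "(\<integral>w. indicator {w \<in> space ?P. fst w = k} w * (c * N) - r w / \<eta> \<partial>?P)
        = (\<integral>w. indicator {w \<in> space ?P. fst w = k} w * (c * N) \<partial>?P) - (\<integral>w. r w / \<eta> \<partial>?P)"
      proof (rule Bochner_Integration.integral_diff)
        show "integrable ?P (\<lambda>w. indicator {w \<in> space ?P. fst w = k} w * (c * N))"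
          using fstm by (intro integrable_mult_left integrable_real_indicator) (auto simp: P.emeasure_eq_measure)
        show "integrable ?P (\<lambda>w. r w / \<eta>)" using ri by simp
      qed
      also have "(\<integral>w. indicator {w \<in> space ?P. fst w = k} w * (c * N) \<partial>?P) = (1/2) ^ Suc k * (c * N)"
        using pk fstm by (simp add: sets.Int_space_eq2)
      also have "(\<integral>w. r w / \<eta> \<partial>?P) = code_distortion L \<kappa> Bs y / \<eta>" by (simp add: r_int)
      finally show ?thesis by simp
    qed
    also have "\<dots> \<le> (\<integral>w. (\<Sum>b\<in>Bs. \<kappa> (G w) b * \<phi> w b) \<partial>?P)"
    proof (rule integral_mono)
      show "integrable ?P (\<lambda>w. indicator {w \<in> space ?P. fst w = k} w * (c * N) - r w / \<eta>)"
        using fstm ri by (intro Bochner_Integration.integrable_diff integrable_mult_left integrable_real_indicator integrable_divide)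
          (auto simp: P.emeasure_eq_measure)
      show "integrable ?P (\<lambda>w. \<Sum>b\<in>Bs. \<kappa> (G w) b * \<phi> w b)"
        by (intro Bochner_Integration.integrable_sum KP.integrable_kernel_mult[OF _ \<phi>m bd])
      fix w assume w: "w \<in> space ?P"
      have r0: "0 \<le> r w" unfolding r_def using KP.kernel_nonneg[OF w] D_bd by (intro sum_nonneg mult_nonneg_nonneg) auto
      show "indicator {w \<in> space ?P. fst w = k} w * (c * N) - r w / \<eta> \<le> (\<Sum>b\<in>Bs. \<kappa> (G w) b * \<phi> w b)"
      proof (cases "fst w = k")
        case True
        have "(\<Sum>b\<in>Bs. \<kappa> (G w) b * \<phi> w b) = (\<Sum>b\<in>Bs. \<kappa> (G w) b) * (c * N) - r w / \<eta>"
          using True by (simp add: \<phi>_def r_def right_diff_distrib sum_subtractf sum_distrib_right sum_divide_distrib)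
        then show ?thesis using True w KP.kernel_sum[OF w] by simp
      next
        case False
        then show ?thesis using r0 \<eta> by (simp add: \<phi>_def)
      qed
    qed
    finally show ?thesis .
  qed
  ultimately show ?thesis by (simp add: c_def)
qed

lemma mixture_has_rdim_infinity: "has_rdim (flow_space TYPE('n::finite)) (flow :: real ^ 'n \<Rightarrow> _) (mixture TYPE('n)) \<infinity>"
proof -
  let ?X = "flow_space TYPE('n)" and ?d = "CARD('n)"
  interpret invariant_action ?X "flow :: real ^ 'n \<Rightarrow> _" "mixture TYPE('n)"
    by (rule invariant_action_flow[OF mixture_invariant])
  define c :: real where "c = log 2 (4/3)"
  have c: "0 < c" by (simp add: c_def)
  \<comment> \<open>At this resolution the distortion term is half of the information term
    \<open>(1/2) ^ Suc k * c * (M * L / 2) ^ ?d\<close>; \<open>c2\<close> belongs to the half that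
    remains.\<close>
  define a where "a = c / (16 * 4 ^ ?d)"
  define c2 where "c2 = c / (4 * 2 ^ ?d)"
  have ac: "0 < a" "0 < c2" using c by (simp_all add: a_def c2_def)
  have "ereal (c2 * 2 ^ k) \<le> rate_distortion ?X (flow :: real ^ 'n \<Rightarrow> _) (mixture TYPE('n)) \<epsilon>"
    if \<epsilon>: "0 < \<epsilon>" "\<epsilon> \<le> a / 4 ^ k" for k \<epsilon>
  proof (rule rate_distortion_ge[of 4])
    fix L \<kappa> q y and Bs :: "(real ^ 'n \<Rightarrow> nat \<Rightarrow> real) set set set"
    assume L: "4 \<le> L" and code: "is_code L \<kappa> q Bs y" and dist: "code_distortion L \<kappa> Bs y < \<epsilon> * L ^ ?d"
    define M :: real where "M = 4 ^ k"
    have M: "1 \<le> M" unfolding M_def by simp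
    \<comment> \<open>From 4 on, \<open>\<lfloor>M * L\<rfloor> - 1\<close> is at least
      \<open>M * L / 2\<close>, so the cells cut off at the boundary cost a constant factor
      only.\<close>
    have side_ge_4: "4 \<le> M * L" using mult_mono[of 1 M 4 L] M L by simp
    define \<eta> where "\<eta> = (1/2) ^ k / 4 * (1 / (2 * M)) ^ ?d"
    have \<eta>: "0 < \<eta>" "1 / \<eta> = 4 * 2 ^ k * 2 ^ ?d * M ^ ?d"
      using M by (simp_all add: \<eta>_def power_divide power_mult_distrib)
    let ?S = "{n :: 'n \<Rightarrow> int. \<forall>i. 1 \<le> n i \<and> n i < \<lfloor>4 ^ k * L\<rfloor>}"
    have "card ?S = nat (\<lfloor>M * L\<rfloor> - 1) ^ ?d" by (simp add: card_cells M_def)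
    moreover have "M * L / 2 \<le> real (nat (\<lfloor>M * L\<rfloor> - 1))" using side_ge_4 by linarith
    ultimately have card_S: "(M * L / 2) ^ ?d \<le> real (card ?S)"
      using side_ge_4 by (simp add: power_mono)
    have Ld: "0 < L ^ ?d" using L by simp
    have "(1/2) ^ Suc k * c * real (card ?S) - code_distortion L \<kappa> Bs y / \<eta> \<le> code_rate \<kappa> q Bs"
      using mixture_code_rate_ge[OF _ code, of k] L by (simp add: c_def \<eta>_def M_def)
    moreover have "(1/2) ^ Suc k * c * (M * L / 2) ^ ?d \<le> (1/2) ^ Suc k * c * real (card ?S)"
      using c card_S by (intro mult_left_mono) auto
    moreover have "code_distortion L \<kappa> Bs y / \<eta> \<le> c / (4 * 2 ^ ?d) * M ^ ?d * (1/2) ^ k * L ^ ?d"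
    proof -
      have "code_distortion L \<kappa> Bs y / \<eta> \<le> (a / 4 ^ k * L ^ ?d) / \<eta>"
      proof (rule divide_right_mono)
        have "\<epsilon> * L ^ ?d \<le> a / 4 ^ k * L ^ ?d" using \<epsilon> Ld by (intro mult_right_mono) auto
        with dist show "code_distortion L \<kappa> Bs y \<le> a / 4 ^ k * L ^ ?d" by linarith
      qed (use \<eta> in simp)
      also have "\<dots> = a / 4 ^ k * L ^ ?d * (1 / \<eta>)" by simp
      also have "\<dots> = c / (4 * 2 ^ ?d) * M ^ ?d * (1/2) ^ k * L ^ ?d"
      proof -
        have p: "(4::real) ^ j = 2 ^ j * 2 ^ j" for j by (simp flip: power_mult_distrib)
        show ?thesis unfolding \<eta>(2) a_def p by (simp add: power_divide field_simps)
      qed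
      finally show ?thesis .
    qed
    moreover have "(1/2) ^ Suc k * c * (M * L / 2) ^ ?d - c / (4 * 2 ^ ?d) * M ^ ?d * (1/2) ^ k * L ^ ?d
      = c2 * (M ^ ?d * (1/2) ^ k) * L ^ ?d"
      by (simp add: c2_def power_mult_distrib power_divide field_simps)
    \<comment> \<open>Since the dimension is at least 1, the bits per volume \<open>M ^ ?d\<close>
      times the weight of order \<open>(1/2) ^ k\<close> are at least \<open>2 ^ k\<close>.\<close>
    moreover have "c2 * 2 ^ k * L ^ ?d \<le> c2 * (M ^ ?d * (1/2) ^ k) * L ^ ?d"
    proof -
      have "M \<le> M ^ ?d" using M self_le_power[of M ?d] by simp
      then have "M * (1/2) ^ k \<le> M ^ ?d * (1/2) ^ k" by (intro mult_right_mono) auto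
      moreover have "M * (1/2) ^ k = 2 ^ k" unfolding M_def by (simp flip: power_mult_distrib)
      ultimately show ?thesis using ac Ld by (intro mult_right_mono mult_left_mono) auto
    qed
    ultimately show "c2 * 2 ^ k * L ^ ?d \<le> code_rate \<kappa> q Bs" by linarith
  qed simp
  from has_rdim_infinity[OF ac this] show ?thesis .
qed

theorem theorem1p4:
  shows "\<exists>(X :: (nat \<Rightarrow> real) metric) (T :: real ^ 'n \<Rightarrow> (nat \<Rightarrow> real) \<Rightarrow> (nat \<Rightarrow> real)).
           compact_space (mtopology_of X) \<and> continuous_action X T \<and>
           (\<forall>\<nu> \<in> ergodic_measures X T. has_rdim X T \<nu> 0) \<and>
           (\<exists>\<mu> \<in> invariant_measures X T. has_rdim X T \<mu> \<infinity>)"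
  using compact_flow_space continuous_action_flow ergodic_has_rdim_0 mixture_invariant mixture_has_rdim_infinity
  by blast

end
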